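(* Let $A$ be an algebra in a ($\Bbbk$-linear) braided monoidal category $(\mathcal C,\otimes,\mathbf 1,\beta)$ for which the tensor product $\otimes_A$ of $A$-bimodules exists. Let $\Gamma$ be a finite abelian group and let $A$ be ($\Gamma$-graded and) graded-commutative with respect to a normalized two-cocycle $\kappa$ on $\Gamma$ that is a bicharacter on $\Gamma$. (i) The category $\mathrm{mod}^\circ_\Gamma\text{-}A$ of $\Gamma$-graded right $A$-modules and grade-preserving module morphisms admits a structure $(\mathrm{mod}^\circ_\Gamma\text{-}A,\widetilde\otimes)$ of a monoidal category, where $\widetilde\otimes$ is induced from $\otimes_A$ as described in the context. (ii) If $A$ is in addition coproduct-separable Frobenius, with coproduct $\Delta$, then the tensor product $m\,\widetilde\otimes\,n$ of two $\Gamma$-graded right $A$-modules $m=(\dot m,\rho^r_m)$ and $n=(\dot n,\rho^r_n)$ is the image of the morphism $$p^{[\kappa]}_{m,n}:=(\rho^r_m\otimes\rho^{(\beta;\kappa)}_n)\circ(\mathrm{id}_{\dot m}\otimes(\Delta\circ\eta)\otimes\mathrm{id}_{\dot n})\;\in\mathrm{End}(\dot m\otimes\dot n),$$ which is an idempotent.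
   Context: $\Bbbk$ is an algebraically closed field with characteristic coprime to $|\Gamma|$; $\Gamma$ is written additively; all categories are additive and $\Bbbk$-linear; associators and unitors are suppressed. A $\Gamma$-graded algebra is an algebra $A=(A,\mu,\eta)$ with $A=\bigoplus_{i\in\Gamma}A_i$ such that $\mu$ restricts to $\mu_{i,j}:A_i\otimes A_j\to A_{i+j}$. It is graded-commutative with respect to $\kappa$ iff $\mu_{j,i}\circ\beta_{A_i,A_j}=\kappa(i,j)\,\mu_{i,j}$ for all $i,j\in\Gamma$. A $\Gamma$-graded right $A$-module is a right module $(\dot m,\rho^r)$ with $\dot m=\bigoplus_{i\in\Gamma}m_i$ such that $\rho^r$ restricts to $\rho^r_{i,j}:m_i\otimes A_j\to m_{i+j}$. For such a module set $\rho^{(\beta;\kappa)}_{i,j}:=\kappa(i,j)^{-1}\,\rho^r_{j,i}\circ\beta_{A_i,m_j}:A_i\otimes m_j\to m_{i+j}$; these are the components of a left action $\rho^{(\beta;\kappa)}$, and for $\kappa$ a bicharacter $(\dot m,\rho^{(\beta;\kappa)},\rho^r)$ is an $A$-bimodule. For a right $A$-module $m=(\dot m,\rho^r)$ and a left $A$-module $n=(\dot n,\rho^l)$, $m\otimes_A n$ is the coequalizer of $\rho^r\otimes\mathrm{id}_{\dot n}$ and $\mathrm{id}_{\dot m}\otimes\rho^l$ from $\dot m\otimes A\otimes\dot n$ to $\dot m\otimes\dot n$. "The tensor product $\otimes_A$ exists" means that all such coequalizers exist and are preserved by $\otimes$, so that $\otimes_A$ is a monoidal structure on $A$-bimodules with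 unit $A$. The product $\widetilde\otimes$: for $\Gamma$-graded right $A$-modules $m,n$, $m\,\widetilde\otimes\,n$ is the right $A$-module underlying the bimodule $(\dot m,\rho^{(\beta;\kappa)}_m,\rho^r_m)\otimes_A(\dot n,\rho^{(\beta;\kappa)}_n,\rho^r_n)$; associator and unitors are inherited from $\mathcal C$ and the monoidal unit is $A$. A Frobenius algebra $(A,\mu,\eta,\Delta,\varepsilon)$ is an algebra and coalgebra with $(\mu\otimes\mathrm{id})\circ(\mathrm{id}\otimes\Delta)=\Delta\circ\mu=(\mathrm{id}\otimes\mu)\circ(\Delta\otimes\mathrm{id})$; it is coproduct-separable iff $\mu\circ\Delta=\mathrm{id}_A$.
   Formalization: In (i), existence of the graded product m ⊗̃ n is stated under the added condition that the degree idempotents induced on m ⊗_A n split in C (automatic if C is idempotent complete); without it the homogeneous parts of m ⊗_A n need not be objects of C. *)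

theory Defs
  imports
    "HOL-Algebra.Ring"
    "HOL-Computational_Algebra.Polynomial"
    "HOL-Library.Cardinality"
begin

section \<open>Linear, monoidal and braided monoidal categories\<close>

text \<open>
  Categories are small with respect to the types of objects and morphisms; every morphism
  carries its domain and codomain. Associators and unitors are kept explicit everywhere.
\<close>

record ('o, 'm, 'k) lin_cat =
  Ob :: "'o set"
  Mor :: "'m set"
  Dom :: "'m \<Rightarrow> 'o"
  Cod :: "'m \<Rightarrow> 'o"
  Id :: "'o \<Rightarrow> 'm"
  Comp :: "'m \<Rightarrow> 'm \<Rightarrow> 'm" (infixr "\<cdot>\<index>" 65)
  Add :: "'m \<Rightarrow> 'm \<Rightarrow> 'm"
  Zero :: "'o \<Rightarrow> 'o \<Rightarrow> 'm"
  Scale :: "'k \<Rightarrow> 'm \<Rightarrow> 'm"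

record ('o, 'm, 'k) mon_cat = "('o, 'm, 'k) lin_cat" +
  Tens_ob :: "'o \<Rightarrow> 'o \<Rightarrow> 'o" (infixr "\<otimes>\<^sub>o\<index>" 70)
  Tens_mor :: "'m \<Rightarrow> 'm \<Rightarrow> 'm" (infixr "\<otimes>\<^sub>m\<index>" 70)
  Unit :: "'o"
  Assoc :: "'o \<Rightarrow> 'o \<Rightarrow> 'o \<Rightarrow> 'm"
  Lunit :: "'o \<Rightarrow> 'm"
  Runit :: "'o \<Rightarrow> 'm"

record ('o, 'm, 'k) braided_cat = "('o, 'm, 'k) mon_cat" +
  Braid :: "'o \<Rightarrow> 'o \<Rightarrow> 'm"

definition homset :: "('o, 'm, 'k, 'x) lin_cat_scheme \<Rightarrow> 'o \<Rightarrow> 'o \<Rightarrow> 'm set" where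
  "homset C x y = {f \<in> Mor C. Dom C f = x \<and> Cod C f = y}"

text \<open>The fields \<open>mult\<close> and \<open>one\<close> play no role; the record is only used as an additive group.\<close>

definition homgroup :: "('o, 'm, 'k, 'x) lin_cat_scheme \<Rightarrow> 'o \<Rightarrow> 'o \<Rightarrow> 'm ring" where
  "homgroup C x y =
     \<lparr>carrier = homset C x y, monoid.mult = undefined, one = undefined,
      zero = Zero C x y, add = Add C\<rparr>"

definition inverse_mor :: "('o, 'm, 'k, 'x) lin_cat_scheme \<Rightarrow> 'm \<Rightarrow> 'm \<Rightarrow> bool" where
  "inverse_mor C f g \<longleftrightarrow>
     f \<in> homset C (Dom C f) (Cod C f) \<and> g \<in> homset C (Cod C f) (Dom C f) \<and>
     g \<cdot>\<^bsub>C\<^esub> f = Id C (Dom C f) \<and> f \<cdot>\<^bsub>C\<^esub> g = Id C (Cod C f)"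

definition iso_mor :: "('o, 'm, 'k, 'x) lin_cat_scheme \<Rightarrow> 'm \<Rightarrow> bool" where
  "iso_mor C f \<longleftrightarrow> (\<exists>g. inverse_mor C f g)"

definition inv_mor :: "('o, 'm, 'k, 'x) lin_cat_scheme \<Rightarrow> 'm \<Rightarrow> 'm" where
  "inv_mor C f = (THE g. inverse_mor C f g)"

definition mono_mor :: "('o, 'm, 'k, 'x) lin_cat_scheme \<Rightarrow> 'm \<Rightarrow> bool" where
  "mono_mor C s \<longleftrightarrow> s \<in> Mor C \<and>
     (\<forall>x \<in> Ob C. \<forall>f \<in> homset C x (Dom C s). \<forall>g \<in> homset C x (Dom C s).
        s \<cdot>\<^bsub>C\<^esub> f = s \<cdot>\<^bsub>C\<^esub> g \<longrightarrow> f = g)"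

definition factors_through :: "('o, 'm, 'k, 'x) lin_cat_scheme \<Rightarrow> 'm \<Rightarrow> 'm \<Rightarrow> bool" where
  "factors_through C f s \<longleftrightarrow> (\<exists>g \<in> homset C (Dom C f) (Dom C s). f = s \<cdot>\<^bsub>C\<^esub> g)"

text \<open>\<open>s : q \<rightarrow> y\<close> is the image of \<open>f : x \<rightarrow> y\<close>: the smallest subobject of \<open>y\<close> through which \<open>f\<close> factors.\<close>

definition is_image :: "('o, 'm, 'k, 'x) lin_cat_scheme \<Rightarrow> 'm \<Rightarrow> 'o \<Rightarrow> 'm \<Rightarrow> bool" where
  "is_image C f q s \<longleftrightarrow>
     s \<in> homset C q (Cod C f) \<and> mono_mor C s \<and> factors_through C f s \<and>
     (\<forall>s'. mono_mor C s' \<and> Cod C s' = Cod C f \<and> factors_through C f s' \<longrightarrow> factors_through C s s')"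

definition is_coequalizer ::
    "('o, 'm, 'k, 'x) lin_cat_scheme \<Rightarrow> 'm \<Rightarrow> 'm \<Rightarrow> 'o \<Rightarrow> 'm \<Rightarrow> bool" where
  "is_coequalizer C f g q \<pi> \<longleftrightarrow>
     q \<in> Ob C \<and> \<pi> \<in> homset C (Cod C f) q \<and> \<pi> \<cdot>\<^bsub>C\<^esub> f = \<pi> \<cdot>\<^bsub>C\<^esub> g \<and>
     (\<forall>z \<in> Ob C. \<forall>h \<in> homset C (Cod C f) z. h \<cdot>\<^bsub>C\<^esub> f = h \<cdot>\<^bsub>C\<^esub> g \<longrightarrow>
        (\<exists>!u. u \<in> homset C q z \<and> u \<cdot>\<^bsub>C\<^esub> \<pi> = h))"

definition splits :: "('o, 'm, 'k, 'x) lin_cat_scheme \<Rightarrow> 'm \<Rightarrow> bool" where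
  "splits C e \<longleftrightarrow>
     (\<exists>z \<in> Ob C. \<exists>r \<in> homset C (Dom C e) z. \<exists>s \<in> homset C z (Dom C e).
        s \<cdot>\<^bsub>C\<^esub> r = e \<and> r \<cdot>\<^bsub>C\<^esub> s = Id C z)"

text \<open>For finite \<open>I\<close>: \<open>s\<close> is the direct sum of the objects \<open>X j\<close>, \<open>j \<in> I\<close>.\<close>

definition is_biproduct ::
    "('o, 'm, 'k, 'x) lin_cat_scheme \<Rightarrow> 'o \<Rightarrow> 'i set \<Rightarrow> ('i \<Rightarrow> 'o) \<Rightarrow> ('i \<Rightarrow> 'm) \<Rightarrow> ('i \<Rightarrow> 'm) \<Rightarrow> bool" where
  "is_biproduct C s I X \<iota> p \<longleftrightarrow>
     s \<in> Ob C \<and>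
     (\<forall>j \<in> I. X j \<in> Ob C \<and> \<iota> j \<in> homset C (X j) s \<and> p j \<in> homset C s (X j)) \<and>
     (\<forall>j \<in> I. \<forall>l \<in> I. p j \<cdot>\<^bsub>C\<^esub> \<iota> l = (if j = l then Id C (X j) else Zero C (X l) (X j))) \<and>
     finsum (homgroup C s s) (\<lambda>j. \<iota> j \<cdot>\<^bsub>C\<^esub> p j) I = Id C s"

locale category =
  fixes C :: "('o, 'm, 'k, 'x) lin_cat_scheme" (structure)
  assumes dom_ob: "f \<in> Mor C \<Longrightarrow> Dom C f \<in> Ob C"
    and cod_ob: "f \<in> Mor C \<Longrightarrow> Cod C f \<in> Ob C"
    and id_hom: "x \<in> Ob C \<Longrightarrow> Id C x \<in> homset C x x"
    and comp_hom: "f \<in> homset C x y \<Longrightarrow> g \<in> homset C y z \<Longrightarrow> g \<cdot> f \<in> homset C x z"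
    and comp_assoc: "f \<in> homset C w x \<Longrightarrow> g \<in> homset C x y \<Longrightarrow> h \<in> homset C y z \<Longrightarrow>
                     (h \<cdot> g) \<cdot> f = h \<cdot> (g \<cdot> f)"
    and comp_id_left: "f \<in> homset C x y \<Longrightarrow> Id C y \<cdot> f = f"
    and comp_id_right: "f \<in> homset C x y \<Longrightarrow> f \<cdot> Id C x = f"

locale additive_linear_category = category C
  for C :: "('o, 'm, 'k :: field, 'x) lin_cat_scheme" (structure) +
  assumes hom_abelian_group: "x \<in> Ob C \<Longrightarrow> y \<in> Ob C \<Longrightarrow> abelian_group (homgroup C x y)"
    and scale_hom: "f \<in> homset C x y \<Longrightarrow> Scale C a f \<in> homset C x y"
    and scale_one: "f \<in> Mor C \<Longrightarrow> Scale C 1 f = f"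
    and scale_scale: "f \<in> Mor C \<Longrightarrow> Scale C a (Scale C b f) = Scale C (a * b) f"
    and scale_add_left: "f \<in> Mor C \<Longrightarrow> Scale C (a + b) f = Add C (Scale C a f) (Scale C b f)"
    and scale_add_right: "f \<in> homset C x y \<Longrightarrow> g \<in> homset C x y \<Longrightarrow>
                          Scale C a (Add C f g) = Add C (Scale C a f) (Scale C a g)"
    and comp_add_left: "f \<in> homset C x y \<Longrightarrow> g \<in> homset C y z \<Longrightarrow> h \<in> homset C y z \<Longrightarrow>
                        Add C g h \<cdot> f = Add C (g \<cdot> f) (h \<cdot> f)"
    and comp_add_right: "f \<in> homset C x y \<Longrightarrow> g \<in> homset C x y \<Longrightarrow> h \<in> homset C y z \<Longrightarrow>
                         h \<cdot> Add C f g = Add C (h \<cdot> f) (h \<cdot> g)"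
    and comp_scale_left: "f \<in> homset C x y \<Longrightarrow> g \<in> homset C y z \<Longrightarrow>
                          Scale C a g \<cdot> f = Scale C a (g \<cdot> f)"
    and comp_scale_right: "f \<in> homset C x y \<Longrightarrow> g \<in> homset C y z \<Longrightarrow>
                           g \<cdot> Scale C a f = Scale C a (g \<cdot> f)"
    \<comment> \<open>the case \<open>n = 0\<close> is the existence of a zero object\<close>
    and biproducts: "(\<And>j. j < (n :: nat) \<Longrightarrow> X j \<in> Ob C) \<Longrightarrow> \<exists>s \<iota> p. is_biproduct C s {..<n} X \<iota> p"

locale linear_monoidal_category = additive_linear_category C
  for C :: "('o, 'm, 'k :: field, 'x) mon_cat_scheme" (structure) +
  assumes unit_ob: "Unit C \<in> Ob C"
    and tens_ob: "x \<in> Ob C \<Longrightarrow> y \<in> Ob C \<Longrightarrow> x \<otimes>\<^sub>o y \<in> Ob C"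
    and tens_hom: "f \<in> homset C x y \<Longrightarrow> g \<in> homset C x' y' \<Longrightarrow>
                   f \<otimes>\<^sub>m g \<in> homset C (x \<otimes>\<^sub>o x') (y \<otimes>\<^sub>o y')"
    and tens_id: "x \<in> Ob C \<Longrightarrow> y \<in> Ob C \<Longrightarrow> Id C x \<otimes>\<^sub>m Id C y = Id C (x \<otimes>\<^sub>o y)"
    and tens_comp: "f \<in> homset C x y \<Longrightarrow> g \<in> homset C y z \<Longrightarrow>
                    f' \<in> homset C x' y' \<Longrightarrow> g' \<in> homset C y' z' \<Longrightarrow>
                    (g \<cdot> f) \<otimes>\<^sub>m (g' \<cdot> f') = (g \<otimes>\<^sub>m g') \<cdot> (f \<otimes>\<^sub>m f')"
    and tens_add_left: "f \<in> homset C x y \<Longrightarrow> g \<in> homset C x y \<Longrightarrow> h \<in> Mor C \<Longrightarrow>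
                        Add C f g \<otimes>\<^sub>m h = Add C (f \<otimes>\<^sub>m h) (g \<otimes>\<^sub>m h)"
    and tens_add_right: "f \<in> homset C x y \<Longrightarrow> g \<in> homset C x y \<Longrightarrow> h \<in> Mor C \<Longrightarrow>
                         h \<otimes>\<^sub>m Add C f g = Add C (h \<otimes>\<^sub>m f) (h \<otimes>\<^sub>m g)"
    and tens_scale_left: "f \<in> Mor C \<Longrightarrow> g \<in> Mor C \<Longrightarrow> Scale C a f \<otimes>\<^sub>m g = Scale C a (f \<otimes>\<^sub>m g)"
    and tens_scale_right: "f \<in> Mor C \<Longrightarrow> g \<in> Mor C \<Longrightarrow> f \<otimes>\<^sub>m Scale C a g = Scale C a (f \<otimes>\<^sub>m g)"
    and assoc_hom: "x \<in> Ob C \<Longrightarrow> y \<in> Ob C \<Longrightarrow> z \<in> Ob C \<Longrightarrow>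
                    Assoc C x y z \<in> homset C ((x \<otimes>\<^sub>o y) \<otimes>\<^sub>o z) (x \<otimes>\<^sub>o (y \<otimes>\<^sub>o z))"
    and assoc_iso: "x \<in> Ob C \<Longrightarrow> y \<in> Ob C \<Longrightarrow> z \<in> Ob C \<Longrightarrow> iso_mor C (Assoc C x y z)"
    and assoc_natural: "f \<in> homset C x x' \<Longrightarrow> g \<in> homset C y y' \<Longrightarrow> h \<in> homset C z z' \<Longrightarrow>
                        Assoc C x' y' z' \<cdot> ((f \<otimes>\<^sub>m g) \<otimes>\<^sub>m h) = (f \<otimes>\<^sub>m (g \<otimes>\<^sub>m h)) \<cdot> Assoc C x y z"
    and lunit_hom: "x \<in> Ob C \<Longrightarrow> Lunit C x \<in> homset C (Unit C \<otimes>\<^sub>o x) x"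
    and lunit_iso: "x \<in> Ob C \<Longrightarrow> iso_mor C (Lunit C x)"
    and lunit_natural: "f \<in> homset C x y \<Longrightarrow> Lunit C y \<cdot> (Id C (Unit C) \<otimes>\<^sub>m f) = f \<cdot> Lunit C x"
    and runit_hom: "x \<in> Ob C \<Longrightarrow> Runit C x \<in> homset C (x \<otimes>\<^sub>o Unit C) x"
    and runit_iso: "x \<in> Ob C \<Longrightarrow> iso_mor C (Runit C x)"
    and runit_natural: "f \<in> homset C x y \<Longrightarrow> Runit C y \<cdot> (f \<otimes>\<^sub>m Id C (Unit C)) = f \<cdot> Runit C x"
    and pentagon: "w \<in> Ob C \<Longrightarrow> x \<in> Ob C \<Longrightarrow> y \<in> Ob C \<Longrightarrow> z \<in> Ob C \<Longrightarrow>
                   (Id C w \<otimes>\<^sub>m Assoc C x y z) \<cdot> Assoc C w (x \<otimes>\<^sub>o y) z \<cdot> (Assoc C w x y \<otimes>\<^sub>m Id C z) =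
                   Assoc C w x (y \<otimes>\<^sub>o z) \<cdot> Assoc C (w \<otimes>\<^sub>o x) y z"
    and triangle: "x \<in> Ob C \<Longrightarrow> y \<in> Ob C \<Longrightarrow>
                   (Id C x \<otimes>\<^sub>m Lunit C y) \<cdot> Assoc C x (Unit C) y = Runit C x \<otimes>\<^sub>m Id C y"

locale linear_braided_category = linear_monoidal_category C
  for C :: "('o, 'm, 'k :: field, 'x) braided_cat_scheme" (structure) +
  assumes braid_hom: "x \<in> Ob C \<Longrightarrow> y \<in> Ob C \<Longrightarrow> Braid C x y \<in> homset C (x \<otimes>\<^sub>o y) (y \<otimes>\<^sub>o x)"
    and braid_iso: "x \<in> Ob C \<Longrightarrow> y \<in> Ob C \<Longrightarrow> iso_mor C (Braid C x y)"
    and braid_natural: "f \<in> homset C x x' \<Longrightarrow> g \<in> homset C y y' \<Longrightarrow>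
                        Braid C x' y' \<cdot> (f \<otimes>\<^sub>m g) = (g \<otimes>\<^sub>m f) \<cdot> Braid C x y"
    and hexagon1: "x \<in> Ob C \<Longrightarrow> y \<in> Ob C \<Longrightarrow> z \<in> Ob C \<Longrightarrow>
                   Assoc C y z x \<cdot> Braid C x (y \<otimes>\<^sub>o z) \<cdot> Assoc C x y z =
                   (Id C y \<otimes>\<^sub>m Braid C x z) \<cdot> Assoc C y x z \<cdot> (Braid C x y \<otimes>\<^sub>m Id C z)"
    and hexagon2: "x \<in> Ob C \<Longrightarrow> y \<in> Ob C \<Longrightarrow> z \<in> Ob C \<Longrightarrow>
                   inv_mor C (Assoc C z x y) \<cdot> Braid C (x \<otimes>\<^sub>o y) z \<cdot> inv_mor C (Assoc C x y z) =
                   (Braid C x z \<otimes>\<^sub>m Id C y) \<cdot> inv_mor C (Assoc C x z y) \<cdot> (Id C x \<otimes>\<^sub>m Braid C y z)"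


section \<open>Algebras and modules\<close>

record ('o, 'm) alg =
  aob :: "'o"
  mu :: "'m"
  eta :: "'m"

definition is_algebra :: "('o, 'm, 'k, 'x) mon_cat_scheme \<Rightarrow> ('o, 'm, 'y) alg_scheme \<Rightarrow> bool" where
  "is_algebra C A \<longleftrightarrow>
     aob A \<in> Ob C \<and>
     mu A \<in> homset C (aob A \<otimes>\<^sub>o aob A) (aob A) \<and>
     eta A \<in> homset C (Unit C) (aob A) \<and>
     mu A \<cdot> (mu A \<otimes>\<^sub>m Id C (aob A)) =
       mu A \<cdot> (Id C (aob A) \<otimes>\<^sub>m mu A) \<cdot> Assoc C (aob A) (aob A) (aob A) \<and>
     mu A \<cdot> (eta A \<otimes>\<^sub>m Id C (aob A)) = Lunit C (aob A) \<and>
     mu A \<cdot> (Id C (aob A) \<otimes>\<^sub>m eta A) = Runit C (aob A)"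
  for C (structure)

definition is_right_module ::
    "('o, 'm, 'k, 'x) mon_cat_scheme \<Rightarrow> ('o, 'm, 'y) alg_scheme \<Rightarrow> 'o \<Rightarrow> 'm \<Rightarrow> bool" where
  "is_right_module C A m \<rho> \<longleftrightarrow>
     m \<in> Ob C \<and> \<rho> \<in> homset C (m \<otimes>\<^sub>o aob A) m \<and>
     \<rho> \<cdot> (\<rho> \<otimes>\<^sub>m Id C (aob A)) = \<rho> \<cdot> (Id C m \<otimes>\<^sub>m mu A) \<cdot> Assoc C m (aob A) (aob A) \<and>
     \<rho> \<cdot> (Id C m \<otimes>\<^sub>m eta A) = Runit C m"
  for C (structure)

definition is_left_module ::
    "('o, 'm, 'k, 'x) mon_cat_scheme \<Rightarrow> ('o, 'm, 'y) alg_scheme \<Rightarrow> 'o \<Rightarrow> 'm \<Rightarrow> bool" where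
  "is_left_module C A m l \<longleftrightarrow>
     m \<in> Ob C \<and> l \<in> homset C (aob A \<otimes>\<^sub>o m) m \<and>
     l \<cdot> (mu A \<otimes>\<^sub>m Id C m) = l \<cdot> (Id C (aob A) \<otimes>\<^sub>m l) \<cdot> Assoc C (aob A) (aob A) m \<and>
     l \<cdot> (eta A \<otimes>\<^sub>m Id C m) = Lunit C m"
  for C (structure)

definition is_bimodule ::
    "('o, 'm, 'k, 'x) mon_cat_scheme \<Rightarrow> ('o, 'm, 'y) alg_scheme \<Rightarrow> 'o \<Rightarrow> 'm \<Rightarrow> 'm \<Rightarrow> bool" where
  "is_bimodule C A m l \<rho> \<longleftrightarrow>
     is_left_module C A m l \<and> is_right_module C A m \<rho> \<and>
     \<rho> \<cdot> (l \<otimes>\<^sub>m Id C (aob A)) = l \<cdot> (Id C (aob A) \<otimes>\<^sub>m \<rho>) \<cdot> Assoc C (aob A) m (aob A)"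
  for C (structure)

text \<open>
  \<open>(q, \<pi>)\<close> is \<open>m \<otimes>\<^sub>A n\<close> for a right module \<open>(m, \<rho>)\<close> and a left module \<open>(n, l)\<close>. The source of the
  parallel pair is bracketed as \<open>(m \<otimes> A) \<otimes> n\<close>.
\<close>

definition tens_pair1 ::
    "('o, 'm, 'k, 'x) mon_cat_scheme \<Rightarrow> 'm \<Rightarrow> 'o \<Rightarrow> 'm" where
  "tens_pair1 C \<rho> n = \<rho> \<otimes>\<^sub>m\<^bsub>C\<^esub> Id C n"

definition tens_pair2 ::
    "('o, 'm, 'k, 'x) mon_cat_scheme \<Rightarrow> ('o, 'm, 'y) alg_scheme \<Rightarrow> 'o \<Rightarrow> 'o \<Rightarrow> 'm \<Rightarrow> 'm" where
  "tens_pair2 C A m n l = (Id C m \<otimes>\<^sub>m\<^bsub>C\<^esub> l) \<cdot>\<^bsub>C\<^esub> Assoc C m (aob A) n"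

definition is_tensor_over ::
    "('o, 'm, 'k, 'x) mon_cat_scheme \<Rightarrow> ('o, 'm, 'y) alg_scheme \<Rightarrow>
     'o \<Rightarrow> 'm \<Rightarrow> 'o \<Rightarrow> 'm \<Rightarrow> 'o \<Rightarrow> 'm \<Rightarrow> bool" where
  "is_tensor_over C A m \<rho> n l q \<pi> \<longleftrightarrow>
     is_coequalizer C (tens_pair1 C \<rho> n) (tens_pair2 C A m n l) q \<pi>"

definition tensor_over_preserved ::
    "('o, 'm, 'k, 'x) mon_cat_scheme \<Rightarrow> ('o, 'm, 'y) alg_scheme \<Rightarrow>
     'o \<Rightarrow> 'm \<Rightarrow> 'o \<Rightarrow> 'm \<Rightarrow> 'o \<Rightarrow> 'm \<Rightarrow> bool" where
  "tensor_over_preserved C A m \<rho> n l q \<pi> \<longleftrightarrow>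
     (\<forall>z \<in> Ob C.
        is_coequalizer C (tens_pair1 C \<rho> n \<otimes>\<^sub>m Id C z) (tens_pair2 C A m n l \<otimes>\<^sub>m Id C z)
          (q \<otimes>\<^sub>o z) (\<pi> \<otimes>\<^sub>m Id C z) \<and>
        is_coequalizer C (Id C z \<otimes>\<^sub>m tens_pair1 C \<rho> n) (Id C z \<otimes>\<^sub>m tens_pair2 C A m n l)
          (z \<otimes>\<^sub>o q) (Id C z \<otimes>\<^sub>m \<pi>))"
  for C (structure)

definition bimodule_tensor_exists ::
    "('o, 'm, 'k, 'x) mon_cat_scheme \<Rightarrow> ('o, 'm, 'y) alg_scheme \<Rightarrow> bool" where
  "bimodule_tensor_exists C A \<longleftrightarrow>
     (\<forall>m lm \<rho>m n ln \<rho>n. is_bimodule C A m lm \<rho>m \<and> is_bimodule C A n ln \<rho>n \<longrightarrow>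
        (\<exists>q \<pi>. is_tensor_over C A m \<rho>m n ln q \<pi>) \<and>
        (\<forall>q \<pi>. is_tensor_over C A m \<rho>m n ln q \<pi> \<longrightarrow> tensor_over_preserved C A m \<rho>m n ln q \<pi>))"

definition is_frobenius ::
    "('o, 'm, 'k, 'x) mon_cat_scheme \<Rightarrow> ('o, 'm, 'y) alg_scheme \<Rightarrow> 'm \<Rightarrow> 'm \<Rightarrow> bool" where
  "is_frobenius C A \<Delta> \<epsilon> \<longleftrightarrow>
     is_algebra C A \<and>
     \<Delta> \<in> homset C (aob A) (aob A \<otimes>\<^sub>o aob A) \<and>
     \<epsilon> \<in> homset C (aob A) (Unit C) \<and>
     Assoc C (aob A) (aob A) (aob A) \<cdot> (\<Delta> \<otimes>\<^sub>m Id C (aob A)) \<cdot> \<Delta> = (Id C (aob A) \<otimes>\<^sub>m \<Delta>) \<cdot> \<Delta> \<and>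
     Lunit C (aob A) \<cdot> (\<epsilon> \<otimes>\<^sub>m Id C (aob A)) \<cdot> \<Delta> = Id C (aob A) \<and>
     Runit C (aob A) \<cdot> (Id C (aob A) \<otimes>\<^sub>m \<epsilon>) \<cdot> \<Delta> = Id C (aob A) \<and>
     (mu A \<otimes>\<^sub>m Id C (aob A)) \<cdot> inv_mor C (Assoc C (aob A) (aob A) (aob A)) \<cdot> (Id C (aob A) \<otimes>\<^sub>m \<Delta>)
       = \<Delta> \<cdot> mu A \<and>
     (Id C (aob A) \<otimes>\<^sub>m mu A) \<cdot> Assoc C (aob A) (aob A) (aob A) \<cdot> (\<Delta> \<otimes>\<^sub>m Id C (aob A))
       = \<Delta> \<cdot> mu A"
  for C (structure)

definition coproduct_separable ::
    "('o, 'm, 'k, 'x) mon_cat_scheme \<Rightarrow> ('o, 'm, 'y) alg_scheme \<Rightarrow> 'm \<Rightarrow> bool" where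
  "coproduct_separable C A \<Delta> \<longleftrightarrow> mu A \<cdot>\<^bsub>C\<^esub> \<Delta> = Id C (aob A)"


section \<open>Graded algebras and graded modules\<close>

text \<open>A decomposition of an object as a direct sum, with inclusions and projections.\<close>

record ('o, 'm, 'g) grading =
  part :: "'g \<Rightarrow> 'o"
  incl :: "'g \<Rightarrow> 'm"
  proj :: "'g \<Rightarrow> 'm"

record ('o, 'm, 'g) gr_alg = "('o, 'm) alg" +
  agr :: "('o, 'm, 'g) grading"

record ('o, 'm, 'g) gr_mod =
  mob :: "'o"
  act :: "'m"
  mgr :: "('o, 'm, 'g) grading"

definition is_grading ::
    "('o, 'm, 'k, 'x) lin_cat_scheme \<Rightarrow> 'o \<Rightarrow> ('o, 'm, 'g) grading \<Rightarrow> bool" where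
  "is_grading C x G \<longleftrightarrow> is_biproduct C x UNIV (part G) (incl G) (proj G)"

text \<open>A morphism \<open>x \<otimes> y \<rightarrow> z\<close> restricts to \<open>x\<^sub>i \<otimes> y\<^sub>j \<rightarrow> z\<^sub>i\<^sub>+\<^sub>j\<close>; \<open>graded_component\<close> is this restriction.\<close>

definition restricts ::
    "('o, 'm, 'k, 'x) mon_cat_scheme \<Rightarrow> ('o, 'm, 'g :: ab_group_add) grading \<Rightarrow>
     ('o, 'm, 'g) grading \<Rightarrow> ('o, 'm, 'g) grading \<Rightarrow> 'm \<Rightarrow> bool" where
  "restricts C G H K f \<longleftrightarrow>
     (\<forall>i j. factors_through C (f \<cdot> (incl G i \<otimes>\<^sub>m incl H j)) (incl K (i + j)))"
  for C (structure)

definition graded_component ::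
    "('o, 'm, 'k, 'x) mon_cat_scheme \<Rightarrow> ('o, 'm, 'g :: ab_group_add) grading \<Rightarrow>
     ('o, 'm, 'g) grading \<Rightarrow> ('o, 'm, 'g) grading \<Rightarrow> 'm \<Rightarrow> 'g \<Rightarrow> 'g \<Rightarrow> 'm" where
  "graded_component C G H K f i j = proj K (i + j) \<cdot> f \<cdot> (incl G i \<otimes>\<^sub>m incl H j)"
  for C (structure)

definition is_graded_algebra ::
    "('o, 'm, 'k, 'x) mon_cat_scheme \<Rightarrow> ('o, 'm, 'g :: ab_group_add) gr_alg \<Rightarrow> bool" where
  "is_graded_algebra C A \<longleftrightarrow>
     is_algebra C A \<and> is_grading C (aob A) (agr A) \<and> restricts C (agr A) (agr A) (agr A) (mu A)"

definition is_graded_module ::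
    "('o, 'm, 'k, 'x) mon_cat_scheme \<Rightarrow> ('o, 'm, 'g :: ab_group_add) gr_alg \<Rightarrow>
     ('o, 'm, 'g) gr_mod \<Rightarrow> bool" where
  "is_graded_module C A m \<longleftrightarrow>
     is_right_module C A (mob m) (act m) \<and> is_grading C (mob m) (mgr m) \<and>
     restricts C (mgr m) (agr A) (mgr m) (act m)"

definition regular_module :: "('o, 'm, 'g) gr_alg \<Rightarrow> ('o, 'm, 'g) gr_mod" where
  "regular_module A = \<lparr>mob = aob A, act = mu A, mgr = agr A\<rparr>"

definition normalized_two_cocycle :: "('g :: ab_group_add \<Rightarrow> 'g \<Rightarrow> 'k :: field) \<Rightarrow> bool" where
  "normalized_two_cocycle \<kappa> \<longleftrightarrow>
     (\<forall>i j. \<kappa> i j \<noteq> 0) \<and> (\<forall>i. \<kappa> 0 i = 1 \<and> \<kappa> i 0 = 1) \<and>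
     (\<forall>i j l. \<kappa> i j * \<kappa> (i + j) l = \<kappa> j l * \<kappa> i (j + l))"

definition bicharacter :: "('g :: ab_group_add \<Rightarrow> 'g \<Rightarrow> 'k :: field) \<Rightarrow> bool" where
  "bicharacter \<kappa> \<longleftrightarrow>
     (\<forall>i j. \<kappa> i j \<noteq> 0) \<and>
     (\<forall>i j l. \<kappa> (i + j) l = \<kappa> i l * \<kappa> j l) \<and> (\<forall>i j l. \<kappa> i (j + l) = \<kappa> i j * \<kappa> i l)"

definition graded_commutative ::
    "('o, 'm, 'k, 'x) braided_cat_scheme \<Rightarrow> ('o, 'm, 'g :: ab_group_add) gr_alg \<Rightarrow>
     ('g \<Rightarrow> 'g \<Rightarrow> 'k) \<Rightarrow> bool" where
  "graded_commutative C A \<kappa> \<longleftrightarrow>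
     (\<forall>i j. graded_component C (agr A) (agr A) (agr A) (mu A) j i
              \<cdot>\<^bsub>C\<^esub> Braid C (part (agr A) i) (part (agr A) j) =
            Scale C (\<kappa> i j) (graded_component C (agr A) (agr A) (agr A) (mu A) i j))"

definition left_component ::
    "('o, 'm, 'k :: field, 'x) braided_cat_scheme \<Rightarrow> ('o, 'm, 'g :: ab_group_add) gr_alg \<Rightarrow>
     ('g \<Rightarrow> 'g \<Rightarrow> 'k) \<Rightarrow> ('o, 'm, 'g) gr_mod \<Rightarrow> 'g \<Rightarrow> 'g \<Rightarrow> 'm" where
  "left_component C A \<kappa> m i j =
     Scale C (inverse (\<kappa> i j))
       (graded_component C (mgr m) (agr A) (mgr m) (act m) j i
          \<cdot>\<^bsub>C\<^esub> Braid C (part (agr A) i) (part (mgr m) j))"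

text \<open>The morphism \<open>A \<otimes> m \<rightarrow> m\<close> with components \<open>left_component\<close>.\<close>

definition left_action ::
    "('o, 'm, 'k :: field, 'x) braided_cat_scheme \<Rightarrow> ('o, 'm, 'g :: ab_group_add) gr_alg \<Rightarrow>
     ('g \<Rightarrow> 'g \<Rightarrow> 'k) \<Rightarrow> ('o, 'm, 'g) gr_mod \<Rightarrow> 'm" where
  "left_action C A \<kappa> m =
     finsum (homgroup C (aob A \<otimes>\<^sub>o mob m) (mob m))
       (\<lambda>(i, j). incl (mgr m) (i + j) \<cdot> left_component C A \<kappa> m i j
                   \<cdot> (proj (agr A) i \<otimes>\<^sub>m proj (mgr m) j)) UNIV"
  for C (structure)


section \<open>The category of graded modules and its tensor product\<close>

definition is_graded_hom ::
    "('o, 'm, 'k, 'x) mon_cat_scheme \<Rightarrow> ('o, 'm, 'g :: ab_group_add) gr_alg \<Rightarrow>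
     ('o, 'm, 'g) gr_mod \<Rightarrow> ('o, 'm, 'g) gr_mod \<Rightarrow> 'm \<Rightarrow> bool" where
  "is_graded_hom C A m n f \<longleftrightarrow>
     f \<in> homset C (mob m) (mob n) \<and>
     f \<cdot> act m = act n \<cdot> (f \<otimes>\<^sub>m Id C (aob A)) \<and>
     (\<forall>i. factors_through C (f \<cdot> incl (mgr m) i) (incl (mgr n) i))"
  for C (structure)

text \<open>Morphisms are triples of source, underlying morphism of \<open>C\<close>, and target.\<close>

type_synonym ('o, 'm, 'g) gr_mor = "('o, 'm, 'g) gr_mod \<times> 'm \<times> ('o, 'm, 'g) gr_mod"

definition underlying :: "('o, 'm, 'g) gr_mor \<Rightarrow> 'm" where
  "underlying F = fst (snd F)"

definition graded_module_category ::
    "('o, 'm, 'k, 'x) mon_cat_scheme \<Rightarrow> ('o, 'm, 'g :: ab_group_add) gr_alg \<Rightarrow>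
     (('o, 'm, 'g) gr_mod, ('o, 'm, 'g) gr_mor, 'k) lin_cat" where
  "graded_module_category C A =
     \<lparr>Ob = {m. is_graded_module C A m},
      Mor = {(m, f, n). is_graded_module C A m \<and> is_graded_module C A n \<and> is_graded_hom C A m n f},
      Dom = (\<lambda>(m, f, n). m),
      Cod = (\<lambda>(m, f, n). n),
      Id = (\<lambda>m. (m, Id C (mob m), m)),
      Comp = (\<lambda>(n, g, p) (m, f, n'). (m, g \<cdot>\<^bsub>C\<^esub> f, p)),
      Add = (\<lambda>(m, f, n) (m', g, n'). (m, Add C f g, n)),
      Zero = (\<lambda>m n. (m, Zero C (mob m) (mob n), n)),
      Scale = (\<lambda>a (m, f, n). (m, Scale C a f, n))\<rparr>"

text \<open>
  \<open>(q, \<pi>)\<close> is the graded right module underlying the tensor product over \<open>A\<close> of the bimodules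
  \<open>(m, left_action m, act m)\<close> and \<open>(n, left_action n, act n)\<close>: the right action of \<open>q\<close> is the one
  induced by that of \<open>n\<close>, and \<open>\<pi>\<close> maps \<open>m\<^sub>i \<otimes> n\<^sub>j\<close> to \<open>q\<^sub>i\<^sub>+\<^sub>j\<close>.
\<close>

definition is_graded_tensor ::
    "('o, 'm, 'k :: field, 'x) braided_cat_scheme \<Rightarrow> ('o, 'm, 'g :: ab_group_add) gr_alg \<Rightarrow>
     ('g \<Rightarrow> 'g \<Rightarrow> 'k) \<Rightarrow> ('o, 'm, 'g) gr_mod \<Rightarrow> ('o, 'm, 'g) gr_mod \<Rightarrow>
     ('o, 'm, 'g) gr_mod \<Rightarrow> 'm \<Rightarrow> bool" where
  "is_graded_tensor C A \<kappa> m n q \<pi> \<longleftrightarrow>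
     is_graded_module C A q \<and>
     is_tensor_over C A (mob m) (act m) (mob n) (left_action C A \<kappa> n) (mob q) \<pi> \<and>
     act q \<cdot> (\<pi> \<otimes>\<^sub>m Id C (aob A)) =
       \<pi> \<cdot> (Id C (mob m) \<otimes>\<^sub>m act n) \<cdot> Assoc C (mob m) (mob n) (aob A) \<and>
     restricts C (mgr m) (mgr n) (mgr q) \<pi>"
  for C (structure)

definition is_graded_tensor_choice ::
    "('o, 'm, 'k :: field, 'x) braided_cat_scheme \<Rightarrow> ('o, 'm, 'g :: ab_group_add) gr_alg \<Rightarrow>
     ('g \<Rightarrow> 'g \<Rightarrow> 'k) \<Rightarrow> (('o, 'm, 'g) gr_mod \<Rightarrow> ('o, 'm, 'g) gr_mod \<Rightarrow> ('o, 'm, 'g) gr_mod) \<Rightarrow>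
     (('o, 'm, 'g) gr_mod \<Rightarrow> ('o, 'm, 'g) gr_mod \<Rightarrow> 'm) \<Rightarrow> bool" where
  "is_graded_tensor_choice C A \<kappa> T P \<longleftrightarrow>
     (\<forall>m n. is_graded_module C A m \<and> is_graded_module C A n \<longrightarrow>
        is_graded_tensor C A \<kappa> m n (T m n) (P m n))"

text \<open>
  \<open>M\<close> is the category of graded modules, equipped with the tensor product on morphisms, the
  associator and the unitors induced along the projections \<open>P m n : m \<otimes> n \<rightarrow> T m n\<close>. The left
  unitor is the left action and the right unitor is the right action on the coequalizer.
\<close>

definition is_induced_structure ::
    "('o, 'm, 'k :: field, 'x) braided_cat_scheme \<Rightarrow> ('o, 'm, 'g :: ab_group_add) gr_alg \<Rightarrow>
     ('g \<Rightarrow> 'g \<Rightarrow> 'k) \<Rightarrow> (('o, 'm, 'g) gr_mod \<Rightarrow> ('o, 'm, 'g) gr_mod \<Rightarrow> ('o, 'm, 'g) gr_mod) \<Rightarrow>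
     (('o, 'm, 'g) gr_mod \<Rightarrow> ('o, 'm, 'g) gr_mod \<Rightarrow> 'm) \<Rightarrow>
     (('o, 'm, 'g) gr_mod, ('o, 'm, 'g) gr_mor, 'k) mon_cat \<Rightarrow> bool" where
  "is_induced_structure C A \<kappa> T P M \<longleftrightarrow>
     lin_cat.truncate M = graded_module_category C A \<and>
     Unit M = regular_module A \<and>
     (\<forall>m \<in> Ob M. \<forall>n \<in> Ob M. Tens_ob M m n = T m n) \<and>
     (\<forall>F \<in> Mor M. \<forall>G \<in> Mor M.
        underlying (Tens_mor M F G) \<cdot> P (Dom M F) (Dom M G) =
          P (Cod M F) (Cod M G) \<cdot> (underlying F \<otimes>\<^sub>m underlying G)) \<and>
     (\<forall>m \<in> Ob M. \<forall>n \<in> Ob M. \<forall>p \<in> Ob M.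
        underlying (Assoc M m n p) \<cdot> P (T m n) p \<cdot> (P m n \<otimes>\<^sub>m Id C (mob p)) =
          P m (T n p) \<cdot> (Id C (mob m) \<otimes>\<^sub>m P n p) \<cdot> Assoc C (mob m) (mob n) (mob p)) \<and>
     (\<forall>m \<in> Ob M.
        underlying (Lunit M m) \<cdot> P (regular_module A) m = left_action C A \<kappa> m \<and>
        underlying (Runit M m) \<cdot> P m (regular_module A) = act m)"
  for C (structure)

text \<open>The projection of \<open>m \<otimes> n\<close> to its part of degree \<open>k\<close>.\<close>

definition degree_projection ::
    "('o, 'm, 'k, 'x) mon_cat_scheme \<Rightarrow> ('o, 'm, 'g :: ab_group_add) gr_mod \<Rightarrow>
     ('o, 'm, 'g) gr_mod \<Rightarrow> 'g \<Rightarrow> 'm" where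
  "degree_projection C m n k =
     finsum (homgroup C (mob m \<otimes>\<^sub>o mob n) (mob m \<otimes>\<^sub>o mob n))
       (\<lambda>(i, j). (incl (mgr m) i \<cdot> proj (mgr m) i) \<otimes>\<^sub>m (incl (mgr n) j \<cdot> proj (mgr n) j))
       {(i, j). i + j = k}"
  for C (structure)

text \<open>
  \<open>m \<otimes>\<^sub>A n\<close> is a direct sum of homogeneous parts: the idempotent endomorphisms \<open>e\<close> of \<open>m \<otimes>\<^sub>A n\<close>
  induced by the degree projections split. This holds automatically if \<open>C\<close> is idempotent
  complete, but not otherwise. Take for \<open>C\<close> the full subcategory of \<open>Vect \<times> Vect\<close> on \<open>0\<close> and the
  objects \<open>(V, W)\<close> of finite dimension with \<open>W \<noteq> 0\<close>; for \<open>A\<close> the square-zero extension of the unit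
  by \<open>(0, k)\<close> in degree \<open>1 \<in> Z/2\<close>; and for \<open>m\<close> the unit in degrees \<open>0\<close> and \<open>1\<close>, with the nonzero
  action of \<open>(0, k)\<close> from degree \<open>0\<close> to \<open>1\<close>. All tensor products over \<open>A\<close> exist, but for \<open>n\<close> the
  unit with trivial action the degree \<open>1\<close> part of \<open>m \<otimes>\<^sub>A n\<close> would be \<open>(k, 0)\<close>, which is not in \<open>C\<close>.
\<close>

definition homogeneous_parts_exist ::
    "('o, 'm, 'k :: field, 'x) braided_cat_scheme \<Rightarrow> ('o, 'm, 'g :: ab_group_add) gr_alg \<Rightarrow>
     ('g \<Rightarrow> 'g \<Rightarrow> 'k) \<Rightarrow> bool" where
  "homogeneous_parts_exist C A \<kappa> \<longleftrightarrow>
     (\<forall>m n q \<pi> k e. is_graded_module C A m \<and> is_graded_module C A n \<and>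
        is_tensor_over C A (mob m) (act m) (mob n) (left_action C A \<kappa> n) q \<pi> \<and>
        e \<in> homset C q q \<and> e \<cdot> \<pi> = \<pi> \<cdot> degree_projection C m n k \<longrightarrow>
        splits C e)"
  for C (structure)

text \<open>
  \<open>(\<rho>\<^sub>m \<otimes> \<rho>\<^sub>n) \<circ> (id \<otimes> (\<Delta> \<circ> \<eta>) \<otimes> id)\<close>, where the coherence isomorphisms are
  \<open>m \<otimes> n \<cong> (m \<otimes> 1) \<otimes> n\<close> and \<open>(m \<otimes> (A \<otimes> A)) \<otimes> n \<cong> ((m \<otimes> A) \<otimes> A) \<otimes> n \<cong> (m \<otimes> A) \<otimes> (A \<otimes> n)\<close>.
\<close>

definition p_mor ::
    "('o, 'm, 'k :: field, 'x) braided_cat_scheme \<Rightarrow> ('o, 'm, 'g :: ab_group_add) gr_alg \<Rightarrow>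
     ('g \<Rightarrow> 'g \<Rightarrow> 'k) \<Rightarrow> 'm \<Rightarrow> ('o, 'm, 'g) gr_mod \<Rightarrow> ('o, 'm, 'g) gr_mod \<Rightarrow> 'm" where
  "p_mor C A \<kappa> \<Delta> m n =
     (act m \<otimes>\<^sub>m left_action C A \<kappa> n)
     \<cdot> Assoc C (mob m \<otimes>\<^sub>o aob A) (aob A) (mob n)
     \<cdot> (inv_mor C (Assoc C (mob m) (aob A) (aob A)) \<otimes>\<^sub>m Id C (mob n))
     \<cdot> ((Id C (mob m) \<otimes>\<^sub>m (\<Delta> \<cdot> eta A)) \<otimes>\<^sub>m Id C (mob n))
     \<cdot> (inv_mor C (Runit C (mob m)) \<otimes>\<^sub>m Id C (mob n))"
  for C (structure)

end

theory Submission
  imports Defs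
begin

text \<open>
  Write \<open>e\<^sub>i\<close> for the projection of a graded object to its part of degree \<open>i\<close>. The morphism
  \<open>\<beta>\<^sup>\<kappa> = \<Sum>\<^sub>i\<^sub>j \<kappa>(i,j)\<^sup>-\<^sup>1 \<beta> \<circ> (e\<^sub>i \<otimes> e\<^sub>j)\<close> is again a braiding on graded objects because \<open>\<kappa>\<close> is a bicharacter,
  and graded commutativity of \<open>A\<close> says that \<open>A\<close> is commutative for \<open>\<beta>\<^sup>\<kappa>\<close>. The left action on a graded
  right module is \<open>\<rho> \<circ> \<beta>\<^sup>\<kappa>\<close>, so everything reduces to modules over a commutative algebra in a braided
  category: the left action on \<open>m \<otimes>\<^sub>A n\<close> is the one induced from \<open>m\<close>, and the monoidal axioms follow
  by cancelling the projections onto the coequalizers. If \<open>A\<close> is separable Frobenius, the morphism \<open>p\<close>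
  coequalizes the two actions and satisfies \<open>\<pi> \<circ> p = \<pi>\<close>, so that \<open>p = s \<circ> \<pi>\<close> with \<open>\<pi> \<circ> s = id\<close>.

  Coherence is handled in left-nested form: on \<open>(h \<otimes> x) \<otimes> y\<close> a morphism \<open>f : x \<otimes> y \<rightarrow> z\<close> acts as
  \<open>(h \<otimes> f) \<circ> \<alpha>\<close>, and the pentagon only serves to compare the heads \<open>h\<close> and \<open>h \<otimes> h'\<close>.
\<close>

section \<open>Sums of morphisms and gradings\<close>

text \<open>Degrees enter only through the idempotents \<open>hp G i\<close> of a graded object. A
  morphism is graded exactly when it intertwines them, and equations are tested after composing with
  them, which replaces a calculation with homogeneous elements. Three obstacles shape the rest. Maps
  out of iterated products descend one projection at a time, and \<open>P \<otimes> Id\<close> can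
  be cancelled because \<otimes> preserves the coequalizers; the associator and its inverse
  therefore descend in opposite orders. Finally, inverses of the structure morphisms are built in
  the underlying category only, since the inverse of a graded linear morphism is again one. For p,
  the Frobenius law gives x \<Delta>(1) = \<Delta>(x) = \<Delta>(1) x, so both ways of letting A act
  before p agree, and separability makes the two legs of \<Delta>(1) multiply to 1.\<close>

context category
begin

lemma in_homset [simp]: "f \<in> homset C x y \<longleftrightarrow> f \<in> Mor C \<and> Dom C f = x \<and> Cod C f = y"
  by (simp add: homset_def)

lemma dom_cod_ob [simp]: "f \<in> Mor C \<Longrightarrow> Dom C f \<in> Ob C" "f \<in> Mor C \<Longrightarrow> Cod C f \<in> Ob C"
  by (rule dom_ob cod_ob; assumption)+

lemma id_simps [simp]:
  assumes "x \<in> Ob C"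
  shows "Id C x \<in> Mor C" "Dom C (Id C x) = x" "Cod C (Id C x) = x"
  using id_hom[OF assms] by simp_all

lemma comp_simps [simp]:
  assumes "f \<in> Mor C" "g \<in> Mor C" "Cod C f = Dom C g"
  shows "g \<cdot> f \<in> Mor C" "Dom C (g \<cdot> f) = Dom C f" "Cod C (g \<cdot> f) = Cod C g"
  using comp_hom[of f "Dom C f" "Cod C f" g "Cod C g"] assms by simp_all

lemma assoc_comp [simp]:
  assumes "f \<in> Mor C" "g \<in> Mor C" "h \<in> Mor C" "Cod C f = Dom C g" "Cod C g = Dom C h"
  shows "(h \<cdot> g) \<cdot> f = h \<cdot> (g \<cdot> f)"
  using comp_assoc[of f "Dom C f" "Cod C f" g "Cod C g" h "Cod C h"] assms by simp

lemma id_left [simp]: "f \<in> Mor C \<Longrightarrow> Cod C f = x \<Longrightarrow> Id C x \<cdot> f = f"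
  using comp_id_left[of f "Dom C f" "Cod C f"] by simp

lemma id_right [simp]: "f \<in> Mor C \<Longrightarrow> Dom C f = x \<Longrightarrow> f \<cdot> Id C x = f"
  using comp_id_right[of f "Dom C f" "Cod C f"] by simp

text \<open>The simplifier keeps composites nested to the right, where a rule for
  \<open>g \<cdot> f\<close> no longer matches once a morphism \<open>u\<close> precedes it. Here
  such a rule is extended by a tail \<open>u\<close>; \<open>reassoc1\<close> does the same when the
  right-hand side is a single morphism.\<close>

lemma reassoc:
  assumes "g \<cdot> f = g' \<cdot> f'" "f \<in> Mor C" "g \<in> Mor C" "f' \<in> Mor C" "g' \<in> Mor C" "u \<in> Mor C"
    "Cod C f = Dom C g" "Cod C f' = Dom C g'" "Cod C u = Dom C f" "Dom C f = Dom C f'"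
  shows "g \<cdot> (f \<cdot> u) = g' \<cdot> (f' \<cdot> u)"
  using arg_cong[OF assms(1), of "\<lambda>t. t \<cdot> u"] assms(2-) by simp

lemma reassoc1:
  assumes "g \<cdot> f = h" "f \<in> Mor C" "g \<in> Mor C" "u \<in> Mor C"
    "Cod C f = Dom C g" "Cod C u = Dom C f"
  shows "g \<cdot> (f \<cdot> u) = h \<cdot> u"
  using arg_cong[OF assms(1), of "\<lambda>t. t \<cdot> u"] assms(2-) by simp

section \<open>Uniqueness of inverses and cancellation of isomorphisms\<close>

lemma inverse_mor_unique: "inverse_mor C f g \<Longrightarrow> inverse_mor C f h \<Longrightarrow> g = h"
proof -
  assume a: "inverse_mor C f g" "inverse_mor C f h"
  then have "(g \<cdot> f) \<cdot> h = g \<cdot> (f \<cdot> h)"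
    by (subst assoc_comp) (auto simp: inverse_mor_def)
  with a show ?thesis by (auto simp: inverse_mor_def)
qed

lemma inv_mor_eq: "inverse_mor C f g \<Longrightarrow> inv_mor C f = g"
  unfolding inv_mor_def using inverse_mor_unique by blast

lemma inv_mor_inverse: "iso_mor C f \<Longrightarrow> inverse_mor C f (inv_mor C f)"
  unfolding iso_mor_def using inv_mor_eq by blast

lemma iso_simps [simp]:
  assumes "iso_mor C f"
  shows "f \<in> Mor C" "inv_mor C f \<in> Mor C" "Dom C (inv_mor C f) = Cod C f" "Cod C (inv_mor C f) = Dom C f"
    "inv_mor C f \<cdot> f = Id C (Dom C f)" "f \<cdot> inv_mor C f = Id C (Cod C f)"
  using inv_mor_inverse[OF assms] by (auto simp: inverse_mor_def)

lemma iso_cancel [simp]: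
  assumes "iso_mor C f" "u \<in> Mor C"
  shows "Cod C u = Dom C f \<Longrightarrow> inv_mor C f \<cdot> (f \<cdot> u) = u"
    and "Cod C u = Cod C f \<Longrightarrow> f \<cdot> (inv_mor C f \<cdot> u) = u"
  using assms by (auto simp flip: assoc_comp)

lemma iso_cancel_left:
  assumes "iso_mor C f" "u \<in> Mor C" "v \<in> Mor C" "Cod C u = Dom C f" "Cod C v = Dom C f" "f \<cdot> u = f \<cdot> v"
  shows "u = v"
proof -
  have "u = inv_mor C f \<cdot> (f \<cdot> u)" using assms(1-5) by simp
  also have "\<dots> = v" unfolding assms(6) using assms(1-5) by simp
  finally show ?thesis .
qed

lemma iso_cancel_right:
  assumes "iso_mor C f" "u \<in> Mor C" "v \<in> Mor C" "Dom C u = Cod C f" "Dom C v = Cod C f" "u \<cdot> f = v \<cdot> f"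
  shows "u = v"
proof -
  have "u = (u \<cdot> f) \<cdot> inv_mor C f" using assms(1-5) by simp
  also have "\<dots> = v" unfolding assms(6) using assms(1-5) by simp
  finally show ?thesis .
qed

lemma iso_morI:
  assumes "f \<in> Mor C" "g \<in> Mor C" "Dom C g = Cod C f" "Cod C g = Dom C f"
    "g \<cdot> f = Id C (Dom C f)" "f \<cdot> g = Id C (Cod C f)"
  shows "iso_mor C f"
  unfolding iso_mor_def inverse_mor_def using assms by auto

end

section \<open>Zero morphisms and finite sums in the hom groups\<close>

abbreviation hom_sum ::
    "('o, 'm, 'k, 'x) lin_cat_scheme \<Rightarrow> 'o \<Rightarrow> 'o \<Rightarrow> ('i \<Rightarrow> 'm) \<Rightarrow> 'i set \<Rightarrow> 'm" where
  "hom_sum C x y \<equiv> finsum (homgroup C x y)"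

context additive_linear_category
begin

lemma homgroup_simps [simp]:
  "carrier (homgroup C x y) = homset C x y"
  "add (homgroup C x y) = Add C" "zero (homgroup C x y) = Zero C x y"
  by (simp_all add: homgroup_def)

lemma zero_simps [simp]:
  assumes "x \<in> Ob C" "y \<in> Ob C"
  shows "Zero C x y \<in> Mor C" "Dom C (Zero C x y) = x" "Cod C (Zero C x y) = y"
  using abelian_group.axioms(1)[OF hom_abelian_group[OF assms], THEN abelian_monoid.zero_closed] by simp_all

lemma add_simps [simp]:
  assumes "f \<in> Mor C" "g \<in> Mor C" "Dom C g = Dom C f" "Cod C g = Cod C f"
  shows "Add C f g \<in> Mor C" "Dom C (Add C f g) = Dom C f" "Cod C (Add C f g) = Cod C f"
  using abelian_group.axioms(1)[OF hom_abelian_group[of "Dom C f" "Cod C f"], THEN abelian_monoid.a_closed, of f g] assms by simp_all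

lemma scale_simps [simp]:
  assumes "f \<in> Mor C"
  shows "Scale C a f \<in> Mor C" "Dom C (Scale C a f) = Dom C f" "Cod C (Scale C a f) = Cod C f"
  using scale_hom[of f "Dom C f" "Cod C f" a] assms by simp_all

lemma scale_comp [simp]:
  assumes "f \<in> Mor C" "g \<in> Mor C" "Cod C f = Dom C g"
  shows "Scale C a g \<cdot> f = Scale C a (g \<cdot> f)" "g \<cdot> Scale C a f = Scale C a (g \<cdot> f)"
  using comp_scale_left[of f "Dom C f" "Cod C f" g "Cod C g"]
    comp_scale_right[of f "Dom C f" "Cod C f" g "Cod C g"] assms by simp_all

declare scale_one [simp] scale_scale [simp]

lemma add_comp:
  assumes "f \<in> Mor C" "g \<in> Mor C" "h \<in> Mor C" "Dom C g = Dom C f" "Cod C g = Cod C f"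
  shows "Cod C h = Dom C f \<Longrightarrow> Add C f g \<cdot> h = Add C (f \<cdot> h) (g \<cdot> h)"
    and "Dom C h = Cod C f \<Longrightarrow> h \<cdot> Add C f g = Add C (h \<cdot> f) (h \<cdot> g)"
  using assms comp_add_left[of h "Dom C h" "Cod C h" f "Cod C f" g]
    comp_add_right[of f "Dom C f" "Cod C f" g h "Cod C h"] by simp_all

text \<open>Cancellation in the hom group. The bilinearity axioms speak of sums only, so every rule
  for zero morphisms (composition, scaling, tensoring, additive maps) is obtained by showing that
  the morphism in question equals its own double.\<close>

lemma idem_zero:
  assumes "f \<in> Mor C" "Add C f f = f"
  shows "f = Zero C (Dom C f) (Cod C f)"
proof -
  interpret abelian_group "homgroup C (Dom C f) (Cod C f)"
    by (rule hom_abelian_group) (use assms in auto)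
  show ?thesis using assms add.l_cancel_one'[of f f] by simp
qed

lemma add_zero [simp]:
  assumes "f \<in> Mor C" "Dom C f = x" "Cod C f = y"
  shows "Add C f (Zero C x y) = f" "Add C (Zero C x y) f = f"
proof -
  interpret abelian_group "homgroup C x y"
    by (rule hom_abelian_group) (use assms in auto)
  show "Add C f (Zero C x y) = f" "Add C (Zero C x y) f = f" using assms r_zero[of f] l_zero[of f] by simp_all
qed

lemma zero_comp [simp]:
  assumes "f \<in> Mor C" "y \<in> Ob C"
  shows "Cod C f = x \<Longrightarrow> Zero C x y \<cdot> f = Zero C (Dom C f) y"
    and "Dom C f = x \<Longrightarrow> f \<cdot> Zero C y x = Zero C y (Cod C f)"
proof -
  assume x: "Cod C f = x"
  then have "x \<in> Ob C" using assms by auto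
  then show "Zero C x y \<cdot> f = Zero C (Dom C f) y"
    using idem_zero[of "Zero C x y \<cdot> f"] assms x add_comp(1)[of "Zero C x y" "Zero C x y" f] by simp
next
  assume x: "Dom C f = x"
  then have "x \<in> Ob C" using assms by auto
  then show "f \<cdot> Zero C y x = Zero C y (Cod C f)"
    using idem_zero[of "f \<cdot> Zero C y x"] assms x add_comp(2)[of "Zero C y x" "Zero C y x" f] by simp
qed

lemma scale_zero [simp]:
  assumes "x \<in> Ob C" "y \<in> Ob C" shows "Scale C a (Zero C x y) = Zero C x y"
  using idem_zero[of "Scale C a (Zero C x y)"] assms
    scale_add_right[of "Zero C x y" x y "Zero C x y" a] by simp

lemma sum_simps [simp]:
  assumes "x \<in> Ob C" "y \<in> Ob C" "\<And>i. i \<in> I \<Longrightarrow> F i \<in> Mor C \<and> Dom C (F i) = x \<and> Cod C (F i) = y"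
  shows "hom_sum C x y F I \<in> Mor C" "Dom C (hom_sum C x y F I) = x" "Cod C (hom_sum C x y F I) = y"
proof -
  interpret abelian_group "homgroup C x y" by (rule hom_abelian_group) (use assms in auto)
  show "hom_sum C x y F I \<in> Mor C" "Dom C (hom_sum C x y F I) = x" "Cod C (hom_sum C x y F I) = y"
    using finsum_closed[of F I] assms(3) by (auto simp: Pi_iff)
qed

lemma sum_cong:
  assumes "x \<in> Ob C" "y \<in> Ob C" "\<And>i. i \<in> I \<Longrightarrow> F i \<in> Mor C \<and> Dom C (F i) = x \<and> Cod C (F i) = y"
    "\<And>i. i \<in> I \<Longrightarrow> F i = G i"
  shows "hom_sum C x y F I = hom_sum C x y G I"
proof -
  interpret abelian_group "homgroup C x y" by (rule hom_abelian_group) (use assms in auto)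
  show ?thesis by (rule finsum_cong') (use assms in \<open>auto simp: Pi_iff\<close>)
qed

text \<open>A sum is tied to one hom group, while composing or tensoring with a fixed morphism moves
  to another. Stating this once for an additive map \<open>\<phi>\<close> between two hom groups
  yields all distributive laws.\<close>

lemma sum_additive:
  assumes "x \<in> Ob C" "y \<in> Ob C" "x' \<in> Ob C" "y' \<in> Ob C" and fin: "finite I"
    and F: "\<And>i. i \<in> I \<Longrightarrow> F i \<in> Mor C \<and> Dom C (F i) = x \<and> Cod C (F i) = y"
    and \<phi>: "\<And>f. f \<in> homset C x y \<Longrightarrow> \<phi> f \<in> homset C x' y'"
    and \<phi>_add: "\<And>f g. f \<in> homset C x y \<Longrightarrow> g \<in> homset C x y \<Longrightarrow> \<phi> (Add C f g) = Add C (\<phi> f) (\<phi> g)"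
  shows "\<phi> (hom_sum C x y F I) = hom_sum C x' y' (\<lambda>i. \<phi> (F i)) I"
proof -
  interpret G: abelian_group "homgroup C x y" by (rule hom_abelian_group) (use assms in auto)
  interpret H: abelian_group "homgroup C x' y'" by (rule hom_abelian_group) (use assms in auto)
  have z: "\<phi> (Zero C x y) = Zero C x' y'"
    using idem_zero[of "\<phi> (Zero C x y)"] \<phi>[of "Zero C x y"] \<phi>_add[of "Zero C x y" "Zero C x y"] assms(1-4) by simp
  show ?thesis using fin F
  proof (induction I)
    case empty
    then show ?case using z by simp
  next
    case (insert i I)
    have *: "F \<in> I \<rightarrow> carrier (homgroup C x y)" "F i \<in> carrier (homgroup C x y)"
      "(\<lambda>i. \<phi> (F i)) \<in> I \<rightarrow> carrier (homgroup C x' y')" "\<phi> (F i) \<in> carrier (homgroup C x' y')"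
      using insert.prems \<phi> by (auto simp: Pi_iff)
    show ?case
      using insert assms(1,2) \<phi>_add[of "F i" "hom_sum C x y F I"]
      by (simp add: G.finsum_insert[OF insert.hyps *(1,2)] H.finsum_insert[OF insert.hyps *(3,4)])
  qed
qed

lemma sum_comp:
  assumes "x \<in> Ob C" "y \<in> Ob C" "finite I" "u \<in> Mor C"
    "\<And>i. i \<in> I \<Longrightarrow> F i \<in> Mor C \<and> Dom C (F i) = x \<and> Cod C (F i) = y"
  shows "Cod C u = x \<Longrightarrow> hom_sum C x y F I \<cdot> u = hom_sum C (Dom C u) y (\<lambda>i. F i \<cdot> u) I"
    and "Dom C u = y \<Longrightarrow> u \<cdot> hom_sum C x y F I = hom_sum C x (Cod C u) (\<lambda>i. u \<cdot> F i) I"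
proof -
  assume "Cod C u = x"
  then show "hom_sum C x y F I \<cdot> u = hom_sum C (Dom C u) y (\<lambda>i. F i \<cdot> u) I"
    by (intro sum_additive) (use assms in \<open>auto simp: add_comp\<close>)
next
  assume "Dom C u = y"
  then show "u \<cdot> hom_sum C x y F I = hom_sum C x (Cod C u) (\<lambda>i. u \<cdot> F i) I"
    by (intro sum_additive) (use assms in \<open>auto simp: add_comp\<close>)
qed

lemma sum_delta:
  assumes "x \<in> Ob C" "y \<in> Ob C" "finite I"
    "\<And>i. i \<in> I \<Longrightarrow> F i = (if i = j then v else Zero C x y)" "v \<in> homset C x y"
  shows "hom_sum C x y F I = (if j \<in> I then v else Zero C x y)"
proof -
  interpret abelian_group "homgroup C x y" by (rule hom_abelian_group) (use assms in auto)
  have "hom_sum C x y F I = hom_sum C x y (\<lambda>i. if j = i then v else Zero C x y) I"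
    by (rule sum_cong) (use assms in auto)
  also have "\<dots> = (if j \<in> I then v else Zero C x y)"
  proof (cases "j \<in> I")
    case True
    then show ?thesis using finsum_singleton[OF True assms(3), of "\<lambda>_. v"] assms(5) by (simp add: Pi_iff cong: if_cong)
  next
    case False
    then have "hom_sum C x y (\<lambda>i. if j = i then v else Zero C x y) I = hom_sum C x y (\<lambda>i. Zero C x y) I"
      by (intro sum_cong) (use assms in auto)
    then show ?thesis using False finsum_zero[of I] by simp
  qed
  finally show ?thesis .
qed

text \<open>\<open>resolves\<close> abstracts from the projections of a direct sum decomposition what is needed to check
  an equation of morphisms on the summands.\<close>

definition resolves :: "'o \<Rightarrow> ('i \<Rightarrow> 'm) \<Rightarrow> 'i set \<Rightarrow> bool" where
  "resolves x E I \<longleftrightarrow> x \<in> Ob C \<and> finite I \<and> (\<forall>i \<in> I. E i \<in> homset C x x) \<and> hom_sum C x x E I = Id C x"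

text \<open>Both sides are composed with the identity written as the sum of the
  \<open>E i\<close>.\<close>

lemma resolves_ext:
  assumes r: "resolves x E I" and "f \<in> Mor C" "g \<in> Mor C" "Dom C f = x" "Dom C g = x" "Cod C f = Cod C g"
    and eq: "\<And>i. i \<in> I \<Longrightarrow> f \<cdot> E i = g \<cdot> E i"
  shows "f = g"
proof -
  have "f \<cdot> hom_sum C x x E I = hom_sum C x (Cod C f) (\<lambda>i. f \<cdot> E i) I"
    by (rule sum_comp(2)) (use assms in \<open>auto simp: resolves_def\<close>)
  also have "\<dots> = hom_sum C x (Cod C f) (\<lambda>i. g \<cdot> E i) I"
    by (rule sum_cong) (use assms in \<open>auto simp: resolves_def\<close>)
  also have "\<dots> = g \<cdot> hom_sum C x x E I"
    using sum_comp(2)[of x x I g E] assms by (auto simp: resolves_def)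
  finally show ?thesis using r assms by (simp add: resolves_def)
qed

lemma resolves_ext':
  assumes r: "resolves x E I" and "f \<in> Mor C" "g \<in> Mor C" "Cod C f = x" "Cod C g = x" "Dom C f = Dom C g"
    and eq: "\<And>i. i \<in> I \<Longrightarrow> E i \<cdot> f = E i \<cdot> g"
  shows "f = g"
proof -
  have "hom_sum C x x E I \<cdot> f = hom_sum C (Dom C f) x (\<lambda>i. E i \<cdot> f) I"
    by (rule sum_comp(1)) (use assms in \<open>auto simp: resolves_def\<close>)
  also have "\<dots> = hom_sum C (Dom C f) x (\<lambda>i. E i \<cdot> g) I"
    by (rule sum_cong) (use assms in \<open>auto simp: resolves_def\<close>)
  also have "\<dots> = hom_sum C x x E I \<cdot> g"
    using sum_comp(1)[of x x I g E] assms by (auto simp: resolves_def)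
  finally show ?thesis using r assms by (simp add: resolves_def)
qed

section \<open>Homogeneous projectors of a graded object\<close>

lemma is_biproduct_resolves:
  assumes "is_biproduct C s I X \<iota> p" "finite I"
  shows "resolves s (\<lambda>j. \<iota> j \<cdot> p j) I"
  using assms unfolding is_biproduct_def resolves_def by auto

text \<open>The projection to degree \<open>i\<close>, taken as an idempotent endomorphism of the
  whole object. In this form no composite has to pass through the parts.\<close>

definition hp :: "('o, 'm, 'g) grading \<Rightarrow> 'g \<Rightarrow> 'm" where
  "hp G i = incl G i \<cdot> proj G i"

lemma grading_simps:
  fixes G :: "('o, 'm, 'g::finite) grading"
  assumes "is_grading C x G"
  shows "x \<in> Ob C" "part G i \<in> Ob C"
    "incl G i \<in> Mor C" "Dom C (incl G i) = part G i" "Cod C (incl G i) = x"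
    "proj G i \<in> Mor C" "Dom C (proj G i) = x" "Cod C (proj G i) = part G i"
    "proj G i \<cdot> incl G j = (if i = j then Id C (part G i) else Zero C (part G j) (part G i))"
    "hp G i \<in> Mor C" "Dom C (hp G i) = x" "Cod C (hp G i) = x"
    "hp G i \<cdot> hp G j = (if i = j then hp G i else Zero C x x)"
    "proj G i \<cdot> hp G i = proj G i" "hp G i \<cdot> incl G i = incl G i" "resolves x (hp G) UNIV"
proof -
  show *: "x \<in> Ob C" "part G i \<in> Ob C"
    "incl G i \<in> Mor C" "Dom C (incl G i) = part G i" "Cod C (incl G i) = x"
    "proj G i \<in> Mor C" "Dom C (proj G i) = x" "Cod C (proj G i) = part G i"
    "proj G i \<cdot> incl G j = (if i = j then Id C (part G i) else Zero C (part G j) (part G i))" for i j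
    using assms by (auto simp: is_grading_def is_biproduct_def)
  show "hp G i \<in> Mor C" "Dom C (hp G i) = x" "Cod C (hp G i) = x" for i
    by (simp_all add: hp_def *)
  have **: "proj G i \<cdot> (incl G j \<cdot> u) = (if i = j then u else Zero C (Dom C u) (part G i))"
    if "u \<in> Mor C" "Cod C u = part G j" for u i j
    using that * by (simp flip: assoc_comp)
  show "hp G i \<cdot> hp G j = (if i = j then hp G i else Zero C x x)"
    by (simp add: hp_def * **)
  show "proj G i \<cdot> hp G i = proj G i" "hp G i \<cdot> incl G i = incl G i"
    by (simp_all add: hp_def * **)
  show "resolves x (hp G) UNIV"
    using is_biproduct_resolves[of x UNIV "part G" "incl G" "proj G"] assms
    by (simp add: is_grading_def hp_def[abs_def])
qed

lemma hp_cancel: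
  fixes G :: "('o, 'm, 'g::finite) grading"
  assumes "is_grading C x G" "u \<in> Mor C" "Cod C u = x"
  shows "hp G i \<cdot> (hp G j \<cdot> u) = (if i = j then hp G i \<cdot> u else Zero C (Dom C u) x)"
  using assms grading_simps[OF assms(1)] by (simp flip: assoc_comp)

text \<open>Replaces an existential statement about factorizations by a fixed-point equation;
  \<open>proj G i \<cdot> u\<close> is the factor.\<close>

lemma factors_incl_iff:
  fixes G :: "('o, 'm, 'g::finite) grading"
  assumes "is_grading C x G" "u \<in> Mor C" "Cod C u = x"
  shows "factors_through C u (incl G i) \<longleftrightarrow> hp G i \<cdot> u = u"
proof
  note s = grading_simps[OF assms(1)]
  assume "factors_through C u (incl G i)"
  then obtain g where "g \<in> Mor C" "Cod C g = part G i" "u = incl G i \<cdot> g"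
    by (auto simp: factors_through_def s)
  then show "hp G i \<cdot> u = u" using s by (simp flip: assoc_comp)
next
  note s = grading_simps[OF assms(1)]
  assume "hp G i \<cdot> u = u"
  then show "factors_through C u (incl G i)"
    unfolding factors_through_def using s assms
    by (intro bexI[of _ "proj G i \<cdot> u"]) (auto simp: hp_def)
qed

end

section \<open>Monoidal and braided coherence\<close>

context linear_monoidal_category
begin

abbreviation whisker_left (infixr "\<lhd>" 70) where "x \<lhd> f \<equiv> Id C x \<otimes>\<^sub>m f"
abbreviation whisker_right (infixl "\<rhd>" 70) where "f \<rhd> x \<equiv> f \<otimes>\<^sub>m Id C x"
abbreviation "assoc_inv x y z \<equiv> inv_mor C (Assoc C x y z)"

declare unit_ob [simp] tens_ob [simp] tens_id [simp] assoc_iso [simp] lunit_iso [simp] runit_iso [simp]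

lemma tens_simps [simp]:
  assumes "f \<in> Mor C" "g \<in> Mor C"
  shows "f \<otimes>\<^sub>m g \<in> Mor C" "Dom C (f \<otimes>\<^sub>m g) = Dom C f \<otimes>\<^sub>o Dom C g" "Cod C (f \<otimes>\<^sub>m g) = Cod C f \<otimes>\<^sub>o Cod C g"
  using tens_hom[of f "Dom C f" "Cod C f" g "Dom C g" "Cod C g"] assms by simp_all

lemma tens_merge [simp]:
  assumes "f \<in> Mor C" "g \<in> Mor C" "f' \<in> Mor C" "g' \<in> Mor C" "Cod C f = Dom C g" "Cod C f' = Dom C g'"
  shows "(g \<otimes>\<^sub>m g') \<cdot> (f \<otimes>\<^sub>m f') = (g \<cdot> f) \<otimes>\<^sub>m (g' \<cdot> f')"
  using tens_comp[of f "Dom C f" "Cod C f" g "Cod C g" f' "Dom C f'" "Cod C f'" g' "Cod C g'"] assms by simp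

lemma tens_merge_assoc [simp]:
  assumes "f \<in> Mor C" "g \<in> Mor C" "f' \<in> Mor C" "g' \<in> Mor C" "Cod C f = Dom C g" "Cod C f' = Dom C g'"
    "u \<in> Mor C" "Cod C u = Dom C f \<otimes>\<^sub>o Dom C f'"
  shows "(g \<otimes>\<^sub>m g') \<cdot> ((f \<otimes>\<^sub>m f') \<cdot> u) = ((g \<cdot> f) \<otimes>\<^sub>m (g' \<cdot> f')) \<cdot> u"
  using assms by (simp flip: assoc_comp)

lemma structure_simps [simp]:
  assumes "x \<in> Ob C"
  shows "Lunit C x \<in> Mor C" "Dom C (Lunit C x) = Unit C \<otimes>\<^sub>o x" "Cod C (Lunit C x) = x"
    "Runit C x \<in> Mor C" "Dom C (Runit C x) = x \<otimes>\<^sub>o Unit C" "Cod C (Runit C x) = x"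
  using lunit_hom[OF assms] runit_hom[OF assms] by simp_all

lemma assoc_simps [simp]:
  assumes "x \<in> Ob C" "y \<in> Ob C" "z \<in> Ob C"
  shows "Assoc C x y z \<in> Mor C" "Dom C (Assoc C x y z) = (x \<otimes>\<^sub>o y) \<otimes>\<^sub>o z"
    "Cod C (Assoc C x y z) = x \<otimes>\<^sub>o (y \<otimes>\<^sub>o z)"
  using assoc_hom[OF assms] by simp_all

lemma lunit_nat [simp]:
  assumes "f \<in> Mor C" "Cod C f = y"
  shows "Lunit C y \<cdot> ((Unit C) \<lhd> f) = f \<cdot> Lunit C (Dom C f)"
  using lunit_natural[of f "Dom C f" y] assms by simp

lemma runit_nat [simp]:
  assumes "f \<in> Mor C" "Cod C f = y"
  shows "Runit C y \<cdot> (f \<rhd> (Unit C)) = f \<cdot> Runit C (Dom C f)"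
  using runit_natural[of f "Dom C f" y] assms by simp

lemma assoc_nat [simp]:
  assumes "f \<in> Mor C" "g \<in> Mor C" "h \<in> Mor C" "Cod C f = x" "Cod C g = y" "Cod C h = z"
  shows "Assoc C x y z \<cdot> ((f \<otimes>\<^sub>m g) \<otimes>\<^sub>m h) = (f \<otimes>\<^sub>m (g \<otimes>\<^sub>m h)) \<cdot> Assoc C (Dom C f) (Dom C g) (Dom C h)"
  using assoc_natural[of f "Dom C f" x g "Dom C g" y h "Dom C h" z] assms by simp

text \<open>The simplifier turns a tensor product of identities into one identity, after which
  general naturality no longer applies; this is the instance for the merged form. In all these rules
  associators move to the right, towards the source.\<close>

lemma assoc_nat_id [simp]:
  assumes "x \<in> Ob C" "y \<in> Ob C" "h \<in> Mor C" "Cod C h = z"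
  shows "Assoc C x y z \<cdot> ((x \<otimes>\<^sub>o y) \<lhd> h) = (x \<lhd> (y \<lhd> h)) \<cdot> Assoc C x y (Dom C h)"
  using assoc_nat[of "Id C x" "Id C y" h x y z] assms by simp

lemma assoc_inv_nat [simp]:
  assumes "f \<in> Mor C" "g \<in> Mor C" "h \<in> Mor C" "Cod C f = x" "Cod C g = y" "Cod C h = z"
  shows "assoc_inv x y z \<cdot> (f \<otimes>\<^sub>m (g \<otimes>\<^sub>m h)) =
    ((f \<otimes>\<^sub>m g) \<otimes>\<^sub>m h) \<cdot> assoc_inv (Dom C f) (Dom C g) (Dom C h)"
proof (rule iso_cancel_left)
  show "iso_mor C (Assoc C x y z)" using assms by auto
  show "Assoc C x y z \<cdot> assoc_inv x y z \<cdot> (f \<otimes>\<^sub>m (g \<otimes>\<^sub>m h)) =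
    Assoc C x y z \<cdot> ((f \<otimes>\<^sub>m g) \<otimes>\<^sub>m h) \<cdot> assoc_inv (Dom C f) (Dom C g) (Dom C h)"
    using assms by (subst (2) assoc_comp[symmetric]) (auto simp del: assoc_comp, auto)
qed (use assms in auto)

lemma assoc_inv_nat_id [simp]:
  assumes "f \<in> Mor C" "y \<in> Ob C" "z \<in> Ob C" "Cod C f = x"
  shows "assoc_inv x y z \<cdot> (f \<rhd> (y \<otimes>\<^sub>o z)) =
    ((f \<rhd> y) \<rhd> z) \<cdot> assoc_inv (Dom C f) y z"
  using assoc_inv_nat[of f "Id C y" "Id C z" x y z] assms by simp

text \<open>\<open>tens_merge\<close> collects composites inside a single tensor product, so a
  factor may have the form \<open>(f \<otimes>\<^sub>m g) \<cdot> u\<close>. Naturality is applied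
  to its outer part, and \<open>u\<close> stays behind the associator.\<close>

lemma assoc_nat_comp [simp]:
  assumes "f \<in> Mor C" "g \<in> Mor C" "h \<in> Mor C" "Cod C f = x" "Cod C g = y" "Cod C h = z"
    "u \<in> Mor C" "Cod C u = Dom C f \<otimes>\<^sub>o Dom C g"
  shows "Assoc C x y z \<cdot> (((f \<otimes>\<^sub>m g) \<cdot> u) \<otimes>\<^sub>m h) =
    (f \<otimes>\<^sub>m (g \<otimes>\<^sub>m h)) \<cdot> (Assoc C (Dom C f) (Dom C g) (Dom C h) \<cdot> (u \<rhd> (Dom C h)))"
proof -
  have "Assoc C x y z \<cdot> (((f \<otimes>\<^sub>m g) \<cdot> u) \<otimes>\<^sub>m h) = (Assoc C x y z \<cdot> ((f \<otimes>\<^sub>m g) \<otimes>\<^sub>m h)) \<cdot> (u \<rhd> (Dom C h))"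
    using assms by (auto simp del: assoc_nat)
  then show ?thesis using assms by auto
qed

lemma assoc_inv_nat_comp [simp]:
  assumes "f \<in> Mor C" "g \<in> Mor C" "h \<in> Mor C" "Cod C f = x" "Cod C g = y" "Cod C h = z"
    "u \<in> Mor C" "Cod C u = Dom C g \<otimes>\<^sub>o Dom C h"
  shows "assoc_inv x y z \<cdot> (f \<otimes>\<^sub>m ((g \<otimes>\<^sub>m h) \<cdot> u)) =
    ((f \<otimes>\<^sub>m g) \<otimes>\<^sub>m h) \<cdot> (assoc_inv (Dom C f) (Dom C g) (Dom C h) \<cdot> ((Dom C f) \<lhd> u))"
proof -
  have "assoc_inv x y z \<cdot> (f \<otimes>\<^sub>m ((g \<otimes>\<^sub>m h) \<cdot> u)) =
    (assoc_inv x y z \<cdot> (f \<otimes>\<^sub>m (g \<otimes>\<^sub>m h))) \<cdot> ((Dom C f) \<lhd> u)"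
    using assms by (auto simp del: assoc_inv_nat)
  then show ?thesis using assms by auto
qed

lemmas lunit_nat_assoc [simp] = reassoc[OF lunit_nat]
lemmas runit_nat_assoc [simp] = reassoc[OF runit_nat]
lemmas assoc_nat_assoc [simp] = reassoc[OF assoc_nat]
lemmas assoc_nat_id_assoc [simp] = reassoc[OF assoc_nat_id]
lemmas assoc_inv_nat_assoc [simp] = reassoc[OF assoc_inv_nat]
lemmas assoc_inv_nat_id_assoc [simp] = reassoc[OF assoc_inv_nat_id]

lemma assoc_nat_comp_assoc [simp]:
  assumes "f \<in> Mor C" "g \<in> Mor C" "h \<in> Mor C" "Cod C f = x" "Cod C g = y" "Cod C h = z"
    "u \<in> Mor C" "Cod C u = Dom C f \<otimes>\<^sub>o Dom C g" "v \<in> Mor C" "Cod C v = Dom C u \<otimes>\<^sub>o Dom C h"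
  shows "Assoc C x y z \<cdot> ((((f \<otimes>\<^sub>m g) \<cdot> u) \<otimes>\<^sub>m h) \<cdot> v) =
    (f \<otimes>\<^sub>m (g \<otimes>\<^sub>m h)) \<cdot> (Assoc C (Dom C f) (Dom C g) (Dom C h) \<cdot> ((u \<rhd> (Dom C h)) \<cdot> v))"
  using assms by (subst reassoc[OF assoc_nat_comp]) auto

lemma assoc_inv_nat_comp_assoc [simp]:
  assumes "f \<in> Mor C" "g \<in> Mor C" "h \<in> Mor C" "Cod C f = x" "Cod C g = y" "Cod C h = z"
    "u \<in> Mor C" "Cod C u = Dom C g \<otimes>\<^sub>o Dom C h" "v \<in> Mor C" "Cod C v = Dom C f \<otimes>\<^sub>o Dom C u"
  shows "assoc_inv x y z \<cdot> ((f \<otimes>\<^sub>m ((g \<otimes>\<^sub>m h) \<cdot> u)) \<cdot> v) =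
    ((f \<otimes>\<^sub>m g) \<otimes>\<^sub>m h) \<cdot> (assoc_inv (Dom C f) (Dom C g) (Dom C h) \<cdot> (((Dom C f) \<lhd> u) \<cdot> v))"
  using assms by (subst reassoc[OF assoc_inv_nat_comp]) auto

lemma tens_add:
  assumes "f \<in> Mor C" "g \<in> Mor C" "h \<in> Mor C" "Dom C g = Dom C f" "Cod C g = Cod C f"
  shows "Add C f g \<otimes>\<^sub>m h = Add C (f \<otimes>\<^sub>m h) (g \<otimes>\<^sub>m h)" "h \<otimes>\<^sub>m Add C f g = Add C (h \<otimes>\<^sub>m f) (h \<otimes>\<^sub>m g)"
  using tens_add_left[of f "Dom C f" "Cod C f" g h] tens_add_right[of f "Dom C f" "Cod C f" g h] assms by simp_all

declare tens_scale_left [simp] tens_scale_right [simp]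

lemma tens_zero [simp]:
  assumes "x \<in> Ob C" "y \<in> Ob C" "f \<in> Mor C"
  shows "Zero C x y \<otimes>\<^sub>m f = Zero C (x \<otimes>\<^sub>o Dom C f) (y \<otimes>\<^sub>o Cod C f)"
    "f \<otimes>\<^sub>m Zero C x y = Zero C (Dom C f \<otimes>\<^sub>o x) (Cod C f \<otimes>\<^sub>o y)"
  using idem_zero[of "Zero C x y \<otimes>\<^sub>m f"] tens_add(1)[of "Zero C x y" "Zero C x y" f]
    idem_zero[of "f \<otimes>\<^sub>m Zero C x y"] tens_add(2)[of "Zero C x y" "Zero C x y" f] assms by simp_all

lemma sum_tens:
  assumes "x \<in> Ob C" "y \<in> Ob C" "finite I" "u \<in> Mor C"
    "\<And>i. i \<in> I \<Longrightarrow> F i \<in> Mor C \<and> Dom C (F i) = x \<and> Cod C (F i) = y"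
  shows "hom_sum C x y F I \<otimes>\<^sub>m u = hom_sum C (x \<otimes>\<^sub>o Dom C u) (y \<otimes>\<^sub>o Cod C u) (\<lambda>i. F i \<otimes>\<^sub>m u) I"
    and "u \<otimes>\<^sub>m hom_sum C x y F I = hom_sum C (Dom C u \<otimes>\<^sub>o x) (Cod C u \<otimes>\<^sub>o y) (\<lambda>i. u \<otimes>\<^sub>m F i) I"
  by (intro sum_additive; use assms in \<open>auto simp: tens_add\<close>)+

lemma resolves_tens:
  assumes "resolves x E I" "y \<in> Ob C"
  shows "resolves (x \<otimes>\<^sub>o y) (\<lambda>i. E i \<rhd> y) I" "resolves (y \<otimes>\<^sub>o x) (\<lambda>i. y \<lhd> E i) I"
  using assms sum_tens[of x x I "Id C y" E] by (auto simp: resolves_def)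

text \<open>One factor is resolved at a time: the whiskered projectors again sum to the identity of
  the tensor product. For gradings this is the test on pairs of homogeneous components.\<close>

lemma resolves_ext2:
  assumes X: "resolves x E I" and Y: "resolves y E' J"
    and f: "f \<in> Mor C" "g \<in> Mor C" "Dom C f = x \<otimes>\<^sub>o y" "Dom C g = x \<otimes>\<^sub>o y" "Cod C f = Cod C g"
    and eq: "\<And>i j. i \<in> I \<Longrightarrow> j \<in> J \<Longrightarrow> f \<cdot> (E i \<otimes>\<^sub>m E' j) = g \<cdot> (E i \<otimes>\<^sub>m E' j)"
  shows "f = g"
proof (rule resolves_ext[OF resolves_tens(1)[OF X]])
  have x: "x \<in> Ob C" "y \<in> Ob C" "i \<in> I \<Longrightarrow> E i \<in> homset C x x" "j \<in> J \<Longrightarrow> E' j \<in> homset C y y" for i j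
    using X Y by (auto simp: resolves_def)
  then show "y \<in> Ob C" by simp
  fix i assume i: "i \<in> I"
  show "f \<cdot> (E i \<rhd> y) = g \<cdot> (E i \<rhd> y)"
    by (rule resolves_ext[OF resolves_tens(2)[OF Y x(1)]]) (use f i x eq in auto)
qed (use f in auto)

lemma resolves_ext3:
  assumes X: "resolves x E I" and Y: "resolves y E' J" and Z: "resolves z E'' K"
    and f: "f \<in> Mor C" "g \<in> Mor C" "Dom C f = (x \<otimes>\<^sub>o y) \<otimes>\<^sub>o z" "Dom C g = (x \<otimes>\<^sub>o y) \<otimes>\<^sub>o z" "Cod C f = Cod C g"
    and eq: "\<And>i j k. i \<in> I \<Longrightarrow> j \<in> J \<Longrightarrow> k \<in> K \<Longrightarrow>
      f \<cdot> ((E i \<otimes>\<^sub>m E' j) \<otimes>\<^sub>m E'' k) = g \<cdot> ((E i \<otimes>\<^sub>m E' j) \<otimes>\<^sub>m E'' k)"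
  shows "f = g"
proof (rule resolves_ext[OF resolves_tens(1)[OF resolves_tens(1)[OF X]]])
  have x: "x \<in> Ob C" "y \<in> Ob C" "z \<in> Ob C" "i \<in> I \<Longrightarrow> E i \<in> homset C x x" "j \<in> J \<Longrightarrow> E' j \<in> homset C y y"
     "k \<in> K \<Longrightarrow> E'' k \<in> homset C z z" for i j k
    using X Y Z by (auto simp: resolves_def)
  then show "y \<in> Ob C" "z \<in> Ob C" by simp_all
  fix i assume i: "i \<in> I"
  show "f \<cdot> ((E i \<rhd> y) \<rhd> z) = g \<cdot> ((E i \<rhd> y) \<rhd> z)"
    by (rule resolves_ext2[OF resolves_tens(2)[OF Y x(1)] Z]) (use f i x eq in auto)
qed (use f in auto)

text \<open>By naturality of the unitors, \<open>f\<close> is conjugate to its tensor product with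
  the unit. This allows an equation to be proved after tensoring with the unit, where pentagon and
  triangle apply.\<close>

lemma tens_unit_faithful:
  assumes "f \<in> Mor C" "g \<in> Mor C" "Dom C f = Dom C g" "Cod C f = Cod C g"
  shows "f \<rhd> (Unit C) = g \<rhd> (Unit C) \<Longrightarrow> f = g"
    and "(Unit C) \<lhd> f = (Unit C) \<lhd> g \<Longrightarrow> f = g"
proof -
  assume "f \<rhd> (Unit C) = g \<rhd> (Unit C)"
  then have "f \<cdot> Runit C (Dom C f) = g \<cdot> Runit C (Dom C f)"
    using assms runit_nat[of f "Cod C f"] runit_nat[of g "Cod C g"] by simp
  then show "f = g" by (rule iso_cancel_right[rotated -1]) (use assms in auto)
next
  assume "(Unit C) \<lhd> f = (Unit C) \<lhd> g"
  then have "f \<cdot> Lunit C (Dom C f) = g \<cdot> Lunit C (Dom C f)"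
    using assms lunit_nat[of f "Cod C f"] lunit_nat[of g "Cod C g"] by simp
  then show "f = g" by (rule iso_cancel_right[rotated -1]) (use assms in auto)
qed

lemma iso_tens [simp]: "iso_mor C f \<Longrightarrow> iso_mor C g \<Longrightarrow> iso_mor C (f \<otimes>\<^sub>m g)"
  by (rule iso_morI[of _ "inv_mor C f \<otimes>\<^sub>m inv_mor C g"]) auto

lemma iso_id [simp]: "x \<in> Ob C \<Longrightarrow> iso_mor C (Id C x)"
  by (rule iso_morI[of _ "Id C x"]) auto

section \<open>Unit coherence derived from pentagon and triangle\<close>

lemma triangle' [simp]:
  assumes "x \<in> Ob C" "y \<in> Ob C"
  shows "(x \<lhd> Lunit C y) \<cdot> Assoc C x (Unit C) y = Runit C x \<rhd> y"
  by (rule triangle[OF assms])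

text \<open>Kelly's argument: after tensoring with the unit on the left, the pentagon for I, I, x, y
  and two uses of the triangle give the equation up to an invertible composite of associators, which
  is cancelled.\<close>

lemma lunit_tens:
  assumes [simp]: "x \<in> Ob C" "y \<in> Ob C"
  shows "Lunit C (x \<otimes>\<^sub>o y) \<cdot> Assoc C (Unit C) x y = Lunit C x \<rhd> y"
proof -
  let ?I = "Unit C"
  have "(?I \<lhd> (Lunit C (x \<otimes>\<^sub>o y) \<cdot> Assoc C ?I x y)) \<cdot> (Assoc C ?I (?I \<otimes>\<^sub>o x) y \<cdot> (Assoc C ?I ?I x \<rhd> y))
     = (?I \<lhd> Lunit C (x \<otimes>\<^sub>o y)) \<cdot> ((?I \<lhd> Assoc C ?I x y) \<cdot> Assoc C ?I (?I \<otimes>\<^sub>o x) y \<cdot> (Assoc C ?I ?I x \<rhd> y))"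
    by simp
  also have "\<dots> = (?I \<lhd> Lunit C (x \<otimes>\<^sub>o y)) \<cdot> Assoc C ?I ?I (x \<otimes>\<^sub>o y) \<cdot> Assoc C (?I \<otimes>\<^sub>o ?I) x y"
    by (subst pentagon) simp_all
  also have "\<dots> = (Runit C ?I \<rhd> (x \<otimes>\<^sub>o y)) \<cdot> Assoc C (?I \<otimes>\<^sub>o ?I) x y"
    by (simp add: reassoc1[OF triangle'])
  also have "\<dots> = Assoc C ?I x y \<cdot> ((Runit C ?I \<rhd> x) \<rhd> y)"
    by simp
  also have "\<dots> = Assoc C ?I x y \<cdot> (((?I \<lhd> Lunit C x) \<cdot> Assoc C ?I ?I x) \<rhd> y)"
    by simp
  also have "\<dots> = Assoc C ?I x y \<cdot> ((?I \<lhd> Lunit C x) \<rhd> y) \<cdot> (Assoc C ?I ?I x \<rhd> y)"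
    by (simp del: triangle')
  also have "\<dots> = (?I \<lhd> (Lunit C x \<rhd> y)) \<cdot> (Assoc C ?I (?I \<otimes>\<^sub>o x) y \<cdot> (Assoc C ?I ?I x \<rhd> y))"
    by (subst assoc_nat_assoc) simp_all
  finally have "?I \<lhd> (Lunit C (x \<otimes>\<^sub>o y) \<cdot> Assoc C ?I x y) = ?I \<lhd> (Lunit C x \<rhd> y)"
    by (rule iso_cancel_right[rotated -1, OF _ iso_morI[of _ "(assoc_inv ?I ?I x \<rhd> y) \<cdot> assoc_inv ?I (?I \<otimes>\<^sub>o x) y"]]) simp_all
  then show ?thesis by (rule tens_unit_faithful(2)[rotated -1]) simp_all
qed

text \<open>The mirror image of the preceding argument: the unit is tensored on the right and the
  pentagon is taken for x, y, I, I.\<close>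

lemma runit_tens:
  assumes [simp]: "x \<in> Ob C" "y \<in> Ob C"
  shows "(x \<lhd> Runit C y) \<cdot> Assoc C x y (Unit C) = Runit C (x \<otimes>\<^sub>o y)"
proof -
  let ?I = "Unit C"
  have "Assoc C x y ?I \<cdot> (((x \<lhd> Runit C y) \<cdot> Assoc C x y ?I) \<rhd> ?I)
    = Assoc C x y ?I \<cdot> ((x \<lhd> Runit C y) \<rhd> ?I) \<cdot> (Assoc C x y ?I \<rhd> ?I)"
    by (simp del: assoc_nat assoc_nat_assoc)
  also have "\<dots> = (x \<lhd> (Runit C y \<rhd> ?I)) \<cdot> Assoc C x (y \<otimes>\<^sub>o ?I) ?I \<cdot> (Assoc C x y ?I \<rhd> ?I)"
    by (subst assoc_nat_assoc) simp_all
  also have "\<dots> = (x \<lhd> (y \<lhd> Lunit C ?I)) \<cdot>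
      ((x \<lhd> Assoc C y ?I ?I) \<cdot> Assoc C x (y \<otimes>\<^sub>o ?I) ?I \<cdot> (Assoc C x y ?I \<rhd> ?I))"
    by simp
  also have "\<dots> = (x \<lhd> (y \<lhd> Lunit C ?I)) \<cdot> Assoc C x y (?I \<otimes>\<^sub>o ?I) \<cdot> Assoc C (x \<otimes>\<^sub>o y) ?I ?I"
    by (subst pentagon) simp_all
  also have "\<dots> = Assoc C x y ?I \<cdot> (((x \<otimes>\<^sub>o y) \<lhd> Lunit C ?I) \<cdot> Assoc C (x \<otimes>\<^sub>o y) ?I ?I)"
    by (simp del: triangle')
  also have "\<dots> = Assoc C x y ?I \<cdot> (Runit C (x \<otimes>\<^sub>o y) \<rhd> ?I)"
    by (subst triangle') simp_all
  finally have "((x \<lhd> Runit C y) \<cdot> Assoc C x y ?I) \<rhd> ?I = Runit C (x \<otimes>\<^sub>o y) \<rhd> ?I"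
    by (rule iso_cancel_left[rotated -1]) simp_all
  then show ?thesis by (rule tens_unit_faithful(1)[rotated -1]) simp_all
qed

text \<open>Naturality of the left unitor at itself gives
  \<open>Lunit C (I \<otimes>\<^sub>o I) = I \<lhd> Lunit C I\<close>, where I is the unit. Composed
  with the associator, the left side is \<open>Lunit C I \<rhd> I\<close> by
  \<open>lunit_tens\<close> and the right side is \<open>Runit C I \<rhd> I\<close> by the
  triangle.\<close>

lemma lunit_unit: "Lunit C (Unit C) = Runit C (Unit C)"
proof -
  let ?I = "Unit C"
  have "Lunit C ?I \<cdot> Lunit C (?I \<otimes>\<^sub>o ?I) = Lunit C ?I \<cdot> (?I \<lhd> Lunit C ?I)"
    by simp
  then have "Lunit C (?I \<otimes>\<^sub>o ?I) = ?I \<lhd> Lunit C ?I"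
    by (rule iso_cancel_left[rotated -1]) simp_all
  then have "Lunit C ?I \<rhd> ?I = Runit C ?I \<rhd> ?I"
    using lunit_tens[of ?I ?I] triangle'[of ?I ?I] by simp
  then show ?thesis by (rule tens_unit_faithful(1)[rotated -1]) simp_all
qed

text \<open>The pentagon, in the form in which it lets a morphism act below a head \<open>w \<otimes> x\<close>.\<close>

lemma head_tens:
  assumes [simp]: "w \<in> Ob C" "x \<in> Ob C" "y \<in> Ob C" "z \<in> Ob C"
    and "f \<in> Mor C" "Dom C f = y \<otimes>\<^sub>o z" "g \<in> Mor C" "Dom C g = x \<otimes>\<^sub>o Cod C f"
  shows "(w \<lhd> (g \<cdot> (x \<lhd> f) \<cdot> Assoc C x y z)) \<cdot> Assoc C w (x \<otimes>\<^sub>o y) z \<cdot> (Assoc C w x y \<rhd> z) =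
    (w \<lhd> g) \<cdot> Assoc C w x (Cod C f) \<cdot> ((w \<otimes>\<^sub>o x) \<lhd> f) \<cdot> Assoc C (w \<otimes>\<^sub>o x) y z"
proof -
  have "(w \<lhd> (g \<cdot> (x \<lhd> f) \<cdot> Assoc C x y z)) \<cdot> Assoc C w (x \<otimes>\<^sub>o y) z \<cdot> (Assoc C w x y \<rhd> z)
    = (w \<lhd> (g \<cdot> (x \<lhd> f))) \<cdot> ((w \<lhd> Assoc C x y z) \<cdot> Assoc C w (x \<otimes>\<^sub>o y) z \<cdot> (Assoc C w x y \<rhd> z))"
    using assms(5-) by simp
  also have "\<dots> = (w \<lhd> (g \<cdot> (x \<lhd> f))) \<cdot> Assoc C w x (y \<otimes>\<^sub>o z) \<cdot> Assoc C (w \<otimes>\<^sub>o x) y z"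
    by (subst pentagon) simp_all
  also have "\<dots> = (w \<lhd> g) \<cdot> Assoc C w x (Cod C f) \<cdot> ((w \<otimes>\<^sub>o x) \<lhd> f) \<cdot> Assoc C (w \<otimes>\<^sub>o x) y z"
    using assms(5-) by simp
  finally show ?thesis .
qed

end

section \<open>Consequences of the hexagons\<close>

context linear_braided_category
begin

declare braid_iso [simp]

lemma braid_simps [simp]:
  assumes "x \<in> Ob C" "y \<in> Ob C"
  shows "Braid C x y \<in> Mor C" "Dom C (Braid C x y) = x \<otimes>\<^sub>o y" "Cod C (Braid C x y) = y \<otimes>\<^sub>o x"
  using braid_hom[OF assms] by simp_all

lemma braid_nat [simp]:
  assumes "f \<in> Mor C" "g \<in> Mor C" "Cod C f = x" "Cod C g = y"
  shows "Braid C x y \<cdot> (f \<otimes>\<^sub>m g) = (g \<otimes>\<^sub>m f) \<cdot> Braid C (Dom C f) (Dom C g)"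
  using braid_natural[of f "Dom C f" x g "Dom C g" y] assms by simp

lemmas braid_nat_assoc [simp] = reassoc[OF braid_nat]

lemma braid_tens_right:
  assumes [simp]: "x \<in> Ob C" "y \<in> Ob C" "z \<in> Ob C"
  shows "Braid C x (y \<otimes>\<^sub>o z) \<cdot> Assoc C x y z =
    assoc_inv y z x \<cdot> (y \<lhd> Braid C x z) \<cdot> Assoc C y x z \<cdot> (Braid C x y \<rhd> z)"
  unfolding hexagon1[OF assms, symmetric] by simp

lemma braid_tens_left:
  assumes [simp]: "x \<in> Ob C" "y \<in> Ob C" "z \<in> Ob C"
  shows "Braid C (x \<otimes>\<^sub>o y) z =
    Assoc C z x y \<cdot> (Braid C x z \<rhd> y) \<cdot> assoc_inv x z y \<cdot> (x \<lhd> Braid C y z) \<cdot> Assoc C x y z"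
proof -
  have "Assoc C z x y \<cdot> (Braid C x z \<rhd> y) \<cdot> assoc_inv x z y \<cdot> (x \<lhd> Braid C y z) \<cdot> Assoc C x y z
    = Assoc C z x y \<cdot> ((Braid C x z \<rhd> y) \<cdot> assoc_inv x z y \<cdot> (x \<lhd> Braid C y z)) \<cdot> Assoc C x y z"
    by simp
  also have "\<dots> = Braid C (x \<otimes>\<^sub>o y) z"
    unfolding hexagon2[OF assms, symmetric] by simp
  finally show ?thesis by simp
qed

text \<open>The hexagon for two copies of the unit and \<open>x\<close> contains
  \<open>Braid C (Unit C) x\<close> twice. Naturality in the product of the two units moves a unitor
  through the braiding, and one of the two copies is then cancelled.\<close>

lemma runit_braid:
  assumes [simp]: "x \<in> Ob C"
  shows "Runit C x \<cdot> Braid C (Unit C) x = Lunit C x"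
proof -
  let ?I = "Unit C"
  have *: "Runit C (x \<otimes>\<^sub>o y) \<cdot> assoc_inv x y ?I = x \<lhd> Runit C y" if "x \<in> Ob C" "y \<in> Ob C" for x y
    using that by (simp flip: runit_tens)
  have "Braid C ?I x \<cdot> (?I \<lhd> (Runit C x \<cdot> Braid C ?I x))
     = Runit C (x \<otimes>\<^sub>o ?I) \<cdot> (Braid C ?I x \<rhd> ?I) \<cdot> assoc_inv ?I x ?I \<cdot> (?I \<lhd> Braid C ?I x)"
    by (simp add: reassoc1[OF *])
  also have "\<dots> = (Runit C (x \<otimes>\<^sub>o ?I) \<cdot> assoc_inv x ?I ?I) \<cdot> Braid C (?I \<otimes>\<^sub>o ?I) x \<cdot> assoc_inv ?I ?I x"
    unfolding hexagon2[OF unit_ob unit_ob assms, symmetric] by simp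
  also have "\<dots> = (x \<lhd> Lunit C ?I) \<cdot> Braid C (?I \<otimes>\<^sub>o ?I) x \<cdot> assoc_inv ?I ?I x"
    by (subst *) (simp_all add: lunit_unit)
  also have "\<dots> = Braid C ?I x \<cdot> (Runit C ?I \<rhd> x) \<cdot> assoc_inv ?I ?I x"
    by (simp add: lunit_unit)
  also have "\<dots> = Braid C ?I x \<cdot> (?I \<lhd> Lunit C x)"
    by (simp flip: triangle')
  finally have "?I \<lhd> (Runit C x \<cdot> Braid C ?I x) = ?I \<lhd> Lunit C x"
    by (rule iso_cancel_left[rotated -1]) simp_all
  then show ?thesis by (rule tens_unit_faithful(2)[rotated -1]) simp_all
qed

end

section \<open>The braiding twisted by the bicharacter\<close>

locale graded_commutative_algebra = linear_braided_category C
  for C :: "('o, 'm, 'k :: field, 'x) braided_cat_scheme" (structure) +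
  fixes A :: "('o, 'm, 'g :: {finite, ab_group_add}) gr_alg"
    and \<kappa> :: "'g \<Rightarrow> 'g \<Rightarrow> 'k"
  assumes graded_algebra: "is_graded_algebra C A"
    and tensor_exists: "bimodule_tensor_exists C A"
    and bichar: "bicharacter \<kappa>"
    and graded_comm: "graded_commutative C A \<kappa>"
begin

abbreviation "a \<equiv> aob A"
abbreviation "one_a \<equiv> Id C (aob A)"
abbreviation "gmod m \<equiv> is_graded_module C A m"
abbreviation "la \<equiv> left_action C A \<kappa>"
abbreviation "hm m \<equiv> hp (mgr m)"
abbreviation "ha \<equiv> hp (agr A)"

lemma kappa_simps [simp]: "\<kappa> i j \<noteq> 0" "\<kappa> (i + j) l = \<kappa> i l * \<kappa> j l" "\<kappa> i (j + l) = \<kappa> i j * \<kappa> i l"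
  using bichar by (auto simp: bicharacter_def)

text \<open>\<open>\<kappa> 0 i\<close> is nonzero and equal to its own square.\<close>

lemma kappa_zero [simp]: "\<kappa> 0 i = 1"
  by (metis add_0 kappa_simps(1,2) mult_cancel_right1)

lemma alg_simps [simp]:
  "a \<in> Ob C" "mu A \<in> Mor C" "Dom C (mu A) = a \<otimes>\<^sub>o a" "Cod C (mu A) = a"
  "eta A \<in> Mor C" "Dom C (eta A) = Unit C" "Cod C (eta A) = a"
  "mu A \<cdot> (eta A \<rhd> a) = Lunit C a" "mu A \<cdot> (a \<lhd> eta A) = Runit C a"
  and mu_assoc: "mu A \<cdot> (mu A \<rhd> a) = mu A \<cdot> (a \<lhd> mu A) \<cdot> Assoc C a a a"
  using graded_algebra by (auto simp: is_graded_algebra_def is_algebra_def)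

lemma agr_grading: "is_grading C a (agr A)"
  using graded_algebra by (auto simp: is_graded_algebra_def)

lemmas agr_simps [simp] = grading_simps(3-8,10-12)[OF agr_grading]
lemmas agr_resolves = grading_simps(16)[OF agr_grading]

lemma gmod_simps [simp]:
  assumes "gmod m"
  shows "mob m \<in> Ob C" "act m \<in> Mor C" "Dom C (act m) = mob m \<otimes>\<^sub>o a" "Cod C (act m) = mob m"
    "act m \<cdot> (mob m \<lhd> eta A) = Runit C (mob m)"
  using assms by (auto simp: is_graded_module_def is_right_module_def)

lemma act_assoc:
  assumes "gmod m"
  shows "act m \<cdot> (act m \<rhd> a) = act m \<cdot> (mob m \<lhd> mu A) \<cdot> Assoc C (mob m) a a"
  using assms unfolding is_graded_module_def is_right_module_def by blast

lemma mgr_grading: "gmod m \<Longrightarrow> is_grading C (mob m) (mgr m)"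
  unfolding is_graded_module_def by blast

lemma restricts_act: "gmod m \<Longrightarrow> restricts C (mgr m) (agr A) (mgr m) (act m)"
  unfolding is_graded_module_def by blast

lemma restricts_mu: "restricts C (agr A) (agr A) (agr A) (mu A)"
  using graded_algebra unfolding is_graded_algebra_def by blast

lemmas mgr_simps [simp] = grading_simps(3-8,10-12)[OF mgr_grading]
lemmas mgr_resolves = grading_simps(16)[OF mgr_grading]

text \<open>The inclusions are traded for projectors by composing with the projections, and back by
  composing with the inclusions. Preservation of degree thereby becomes an equation between
  morphisms on the undivided objects.\<close>

lemma restricts_iff:
  fixes X Y Z :: "('o, 'm, 'g) grading"
  assumes X: "is_grading C x X" and Y: "is_grading C y Y" and Z: "is_grading C z Z"
    and f: "f \<in> Mor C" "Dom C f = x \<otimes>\<^sub>o y" "Cod C f = z"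
  shows "restricts C X Y Z f \<longleftrightarrow> (\<forall>i j. hp Z (i + j) \<cdot> f \<cdot> (hp X i \<otimes>\<^sub>m hp Y j) = f \<cdot> (hp X i \<otimes>\<^sub>m hp Y j))"
proof -
  note [simp] = grading_simps(1-8,10-12,14-15)[OF X] grading_simps(1-8,10-12,14-15)[OF Y]
    grading_simps(1-8,10-12,14-15)[OF Z] f
  have "factors_through C (f \<cdot> (incl X i \<otimes>\<^sub>m incl Y j)) (incl Z (i + j)) \<longleftrightarrow>
      hp Z (i + j) \<cdot> f \<cdot> (incl X i \<otimes>\<^sub>m incl Y j) = f \<cdot> (incl X i \<otimes>\<^sub>m incl Y j)" for i j
    by (rule factors_incl_iff[OF Z]) simp_all
  moreover have "hp Z (i + j) \<cdot> f \<cdot> (incl X i \<otimes>\<^sub>m incl Y j) = f \<cdot> (incl X i \<otimes>\<^sub>m incl Y j) \<longleftrightarrow>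
      hp Z (i + j) \<cdot> f \<cdot> (hp X i \<otimes>\<^sub>m hp Y j) = f \<cdot> (hp X i \<otimes>\<^sub>m hp Y j)" (is "?l \<longleftrightarrow> ?r") for i j
  proof
    assume ?l
    from arg_cong[OF this, of "\<lambda>t. t \<cdot> (proj X i \<otimes>\<^sub>m proj Y j)"] show ?r by (simp flip: hp_def)
  next
    assume ?r
    from arg_cong[OF this, of "\<lambda>t. t \<cdot> (incl X i \<otimes>\<^sub>m incl Y j)"] show ?l by simp
  qed
  ultimately show ?thesis by (simp add: restricts_def)
qed

lemma act_hp: "gmod m \<Longrightarrow> hm m (i + j) \<cdot> act m \<cdot> (hm m i \<otimes>\<^sub>m ha j) = act m \<cdot> (hm m i \<otimes>\<^sub>m ha j)"
  using restricts_iff[OF mgr_grading agr_grading mgr_grading, of m m "act m"] restricts_act[of m] by simp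

lemma mu_hp: "ha (i + j) \<cdot> mu A \<cdot> (ha i \<otimes>\<^sub>m ha j) = mu A \<cdot> (ha i \<otimes>\<^sub>m ha j)"
  using restricts_iff[OF agr_grading agr_grading agr_grading, of "mu A"] restricts_mu by simp

text \<open>The braiding of A past a graded object, weighted by the inverse of \<kappa> on each pair
  of degrees. The first object is fixed to A, as only A ever has to be moved; the second is given
  with its grading, so that modules and A itself can both be inserted.\<close>

definition twisted_braid :: "'o \<Rightarrow> ('o, 'm, 'g) grading \<Rightarrow> 'm" where
  "twisted_braid y Y = hom_sum C (a \<otimes>\<^sub>o y) (y \<otimes>\<^sub>o a)
     (\<lambda>(i, j). Scale C (inverse (\<kappa> i j)) (Braid C a y \<cdot> (ha i \<otimes>\<^sub>m hp Y j))) UNIV"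

lemma twisted_braid_simps:
  assumes "is_grading C y Y"
  shows "twisted_braid y Y \<in> Mor C" "Dom C (twisted_braid y Y) = a \<otimes>\<^sub>o y" "Cod C (twisted_braid y Y) = y \<otimes>\<^sub>o a"
  unfolding twisted_braid_def using grading_simps(1-8,10-12)[OF assms]
  by (auto intro!: sum_simps split: prod.splits)

text \<open>Only the summand for the degrees of \<open>u\<close> and \<open>v\<close> survives. The
  sources of \<open>u\<close> and \<open>v\<close> are arbitrary, so that the unit of A, a product
  or an action can take the place of a homogeneous element.\<close>

lemma twisted_braid_homogeneous:
  assumes Y: "is_grading C y Y" and u: "u \<in> Mor C" "ha i \<cdot> u = u" "Cod C u = a"
    and v: "v \<in> Mor C" "hp Y j \<cdot> v = v" "Cod C v = y"
  shows "twisted_braid y Y \<cdot> (u \<otimes>\<^sub>m v) = Scale C (inverse (\<kappa> i j)) ((v \<otimes>\<^sub>m u) \<cdot> Braid C (Dom C u) (Dom C v))"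
proof -
  note [simp] = grading_simps(1-8,10-12)[OF Y] twisted_braid_simps[OF Y]
  let ?w = "Scale C (inverse (\<kappa> i j)) ((v \<otimes>\<^sub>m u) \<cdot> Braid C (Dom C u) (Dom C v))"
  let ?F = "(\<lambda>(i, j). Scale C (inverse (\<kappa> i j)) (Braid C a y \<cdot> (ha i \<otimes>\<^sub>m hp Y j)))"
  have h: "ha i' \<cdot> u = (if i' = i then u else Zero C (Dom C u) a)" for i'
    using u hp_cancel[OF agr_grading u(1,3), of i' i] by auto
  have k: "hp Y i' \<cdot> v = (if i' = j then v else Zero C (Dom C v) y)" for i'
    using v hp_cancel[OF Y v(1,3), of i' j] by auto
  have "twisted_braid y Y \<cdot> (u \<otimes>\<^sub>m v) = hom_sum C (Dom C u \<otimes>\<^sub>o Dom C v) (y \<otimes>\<^sub>o a) (\<lambda>p. ?F p \<cdot> (u \<otimes>\<^sub>m v)) UNIV"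
    unfolding twisted_braid_def by (subst sum_comp(1)) (use u v in auto)
  also have "\<dots> = (if (i, j) \<in> UNIV then ?w else Zero C (Dom C u \<otimes>\<^sub>o Dom C v) (y \<otimes>\<^sub>o a))"
    by (rule sum_delta) (use u v in \<open>auto simp: h k split: if_splits\<close>)
  finally show ?thesis by simp
qed

lemma hp_idem [simp]: "ha i \<cdot> ha i = ha i" "gmod m \<Longrightarrow> hm m i \<cdot> hm m i = hm m i"
  using grading_simps(13)[OF agr_grading] grading_simps(13)[OF mgr_grading] by simp_all

lemma twisted_braid_nat:
  assumes Y: "is_grading C y Y" and Z: "is_grading C z Z" and f: "f \<in> Mor C" "Dom C f = y" "Cod C f = z"
    and eq: "\<And>i. f \<cdot> hp Y i = hp Z i \<cdot> f"
  shows "twisted_braid z Z \<cdot> (a \<lhd> f) = (f \<rhd> a) \<cdot> twisted_braid y Y"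
proof (rule resolves_ext2[OF agr_resolves grading_simps(16)[OF Y]])
  note [simp] = grading_simps(1-8,10-12)[OF Y] grading_simps(1-8,10-12)[OF Z] twisted_braid_simps[OF Y] twisted_braid_simps[OF Z] f
  fix i j
  have "hp Z j \<cdot> hp Z j \<cdot> f = hp Z j \<cdot> f" "hp Y j \<cdot> hp Y j = hp Y j"
    using hp_cancel[OF Z f(1,3), of j j] grading_simps(13)[OF Y, of j j] by auto
  then show "(twisted_braid z Z \<cdot> (a \<lhd> f)) \<cdot> (ha i \<otimes>\<^sub>m hp Y j) = ((f \<rhd> a) \<cdot> twisted_braid y Y) \<cdot> (ha i \<otimes>\<^sub>m hp Y j)"
    using twisted_braid_homogeneous[OF Z, of "ha i" i "f \<cdot> hp Y j" j] twisted_braid_homogeneous[OF Y, of "ha i" i "hp Y j" j]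
    by (simp add: eq)
qed (use f grading_simps(1-8,10-12)[OF Y] twisted_braid_simps[OF Y] twisted_braid_simps[OF Z] in auto)

text \<open>The hexagon of the twisted braiding in its second argument, where \<kappa>(i, j + k)
  splits into \<kappa>(i, j) and \<kappa>(i, k). A degree-preserving \<open>g\<close> is composed
  with it because \<open>y \<otimes>\<^sub>o z\<close> itself carries no \<open>grading\<close>
  record.\<close>

lemma twisted_braid_tens_right:
  assumes Y: "is_grading C y Y" and Z: "is_grading C z Z" and W: "is_grading C w W"
    and g: "g \<in> Mor C" "Dom C g = y \<otimes>\<^sub>o z" "Cod C g = w" and gr: "restricts C Y Z W g"
  shows "twisted_braid w W \<cdot> (a \<lhd> g) \<cdot> Assoc C a y z =
    (g \<rhd> a) \<cdot> assoc_inv y z a \<cdot> (y \<lhd> twisted_braid z Z) \<cdot> Assoc C y a z \<cdot> (twisted_braid y Y \<rhd> z)"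
proof (rule resolves_ext3[OF agr_resolves grading_simps(16)[OF Y] grading_simps(16)[OF Z]])
  note [simp] = grading_simps(1-8,10-12)[OF Y] grading_simps(1-8,10-12)[OF Z] grading_simps(1-8,10-12)[OF W]
    twisted_braid_simps[OF Y] twisted_braid_simps[OF Z] twisted_braid_simps[OF W] g
  fix i j k
  have idem: "hp Y j \<cdot> hp Y j = hp Y j" "hp Z k \<cdot> hp Z k = hp Z k"
    using grading_simps(13)[OF Y, of j j] grading_simps(13)[OF Z, of k k] by auto
  have gjk: "hp W (j + k) \<cdot> g \<cdot> (hp Y j \<otimes>\<^sub>m hp Z k) = g \<cdot> (hp Y j \<otimes>\<^sub>m hp Z k)"
    using gr restricts_iff[OF Y Z W g] by blast
  have "(twisted_braid w W \<cdot> (a \<lhd> g) \<cdot> Assoc C a y z) \<cdot> ((ha i \<otimes>\<^sub>m hp Y j) \<otimes>\<^sub>m hp Z k) =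
      (twisted_braid w W \<cdot> (ha i \<otimes>\<^sub>m (g \<cdot> (hp Y j \<otimes>\<^sub>m hp Z k)))) \<cdot> Assoc C a y z" (is "?lhs = _")
    by simp
  also have "\<dots> = Scale C (inverse (\<kappa> i (j + k))) (((g \<cdot> (hp Y j \<otimes>\<^sub>m hp Z k)) \<otimes>\<^sub>m ha i) \<cdot> Braid C a (y \<otimes>\<^sub>o z)) \<cdot> Assoc C a y z"
    using gjk by (subst twisted_braid_homogeneous[OF W, where i = i and j = "j + k"]) simp_all
  also have "\<dots> = Scale C (inverse (\<kappa> i (j + k))) (((g \<cdot> (hp Y j \<otimes>\<^sub>m hp Z k)) \<otimes>\<^sub>m ha i) \<cdot>
      assoc_inv y z a \<cdot> (y \<lhd> Braid C a z) \<cdot> Assoc C y a z \<cdot> (Braid C a y \<rhd> z))"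
    by (simp flip: braid_tens_right)
  \<comment> \<open>The factor belonging to degrees i and k is absorbed by the twisted braiding past
    \<open>z\<close>; the remaining one is absorbed next by the braiding past
    \<open>y\<close>.\<close>
  also have "\<dots> = Scale C (inverse (\<kappa> i j)) ((g \<rhd> a) \<cdot> assoc_inv y z a \<cdot> (hp Y j \<otimes>\<^sub>m (twisted_braid z Z \<cdot> (ha i \<otimes>\<^sub>m hp Z k))) \<cdot>
       Assoc C y a z \<cdot> (Braid C a y \<rhd> z))"
    by (subst twisted_braid_homogeneous[OF Z, where i = i and j = k]) (simp_all add: idem mult.commute)
  also have "\<dots> = (g \<rhd> a) \<cdot> assoc_inv y z a \<cdot> (y \<lhd> twisted_braid z Z) \<cdot> Assoc C y a z \<cdot> ((twisted_braid y Y \<cdot> (ha i \<otimes>\<^sub>m hp Y j)) \<otimes>\<^sub>m hp Z k)"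
    by (subst twisted_braid_homogeneous[OF Y, where i = i and j = j]) (simp_all add: idem)
  also have "\<dots> = ((g \<rhd> a) \<cdot> assoc_inv y z a \<cdot> (y \<lhd> twisted_braid z Z) \<cdot> Assoc C y a z \<cdot> (twisted_braid y Y \<rhd> z)) \<cdot> ((ha i \<otimes>\<^sub>m hp Y j) \<otimes>\<^sub>m hp Z k)"
    by simp
  finally show "?lhs = \<dots>" .
qed (use grading_simps(1-8,10-12)[OF Y] grading_simps(1-8,10-12)[OF Z] grading_simps(1-8,10-12)[OF W]
    twisted_braid_simps[OF Y] twisted_braid_simps[OF Z] twisted_braid_simps[OF W] g in auto)

text \<open>The other hexagon, from \<kappa>(i + j, k) = \<kappa>(i, k) \<kappa>(j, k). The product
  of A plays the part of the degree-preserving map.\<close>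

lemma twisted_braid_tens_left:
  assumes Z: "is_grading C z Z"
  shows "twisted_braid z Z \<cdot> (mu A \<rhd> z) = (z \<lhd> mu A) \<cdot> Assoc C z a a \<cdot> (twisted_braid z Z \<rhd> a) \<cdot>
    assoc_inv a z a \<cdot> (a \<lhd> twisted_braid z Z) \<cdot> Assoc C a a z"
proof (rule resolves_ext3[OF agr_resolves agr_resolves grading_simps(16)[OF Z]])
  note [simp] = grading_simps(1-8,10-12)[OF Z] twisted_braid_simps[OF Z]
  fix i j k
  have idem: "hp Z k \<cdot> hp Z k = hp Z k"
    using grading_simps(13)[OF Z, of k k] by auto
  have "(twisted_braid z Z \<cdot> (mu A \<rhd> z)) \<cdot> ((ha i \<otimes>\<^sub>m ha j) \<otimes>\<^sub>m hp Z k) = twisted_braid z Z \<cdot> ((mu A \<cdot> (ha i \<otimes>\<^sub>m ha j)) \<otimes>\<^sub>m hp Z k)" (is "?lhs = _")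
    by simp
  also have "\<dots> = Scale C (inverse (\<kappa> (i + j) k)) ((hp Z k \<otimes>\<^sub>m (mu A \<cdot> (ha i \<otimes>\<^sub>m ha j))) \<cdot> Braid C (a \<otimes>\<^sub>o a) z)"
    using mu_hp by (subst twisted_braid_homogeneous[OF Z, where i = "i + j" and j = k]) (simp_all add: idem)
  also have "\<dots> = Scale C (inverse (\<kappa> (i + j) k)) ((hp Z k \<otimes>\<^sub>m (mu A \<cdot> (ha i \<otimes>\<^sub>m ha j))) \<cdot>
     Assoc C z a a \<cdot> (Braid C a z \<rhd> a) \<cdot> assoc_inv a z a \<cdot> (a \<lhd> Braid C a z) \<cdot> Assoc C a a z)"
    by (subst braid_tens_left) simp_all
  also have "\<dots> = Scale C (inverse (\<kappa> j k)) ((z \<lhd> mu A) \<cdot> Assoc C z a a \<cdot> ((twisted_braid z Z \<cdot> (ha i \<otimes>\<^sub>m hp Z k)) \<otimes>\<^sub>m ha j) \<cdot>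
    assoc_inv a z a \<cdot> (a \<lhd> Braid C a z) \<cdot> Assoc C a a z)"
    by (subst twisted_braid_homogeneous[OF Z, where i = i and j = k]) (simp_all add: idem mult.commute)
  also have "\<dots> = (z \<lhd> mu A) \<cdot> Assoc C z a a \<cdot> (twisted_braid z Z \<rhd> a) \<cdot>
    assoc_inv a z a \<cdot> (ha i \<otimes>\<^sub>m (twisted_braid z Z \<cdot> (ha j \<otimes>\<^sub>m hp Z k))) \<cdot> Assoc C a a z"
    by (subst (2) twisted_braid_homogeneous[OF Z, where i = j and j = k]) (simp_all add: idem)
  also have "\<dots> = ((z \<lhd> mu A) \<cdot> Assoc C z a a \<cdot> (twisted_braid z Z \<rhd> a) \<cdot>
    assoc_inv a z a \<cdot> (a \<lhd> twisted_braid z Z) \<cdot> Assoc C a a z) \<cdot> ((ha i \<otimes>\<^sub>m ha j) \<otimes>\<^sub>m hp Z k)"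
    by simp
  finally show "?lhs = \<dots>" .
qed (use grading_simps(1-8,10-12)[OF Z] twisted_braid_simps[OF Z] in auto)

text \<open>On degrees i and j, the scalar in graded commutativity cancels against the inverse
  scalar in the twisted braiding.\<close>

lemma mu_twisted_braid: "mu A \<cdot> twisted_braid a (agr A) = mu A"
proof (rule resolves_ext2[OF agr_resolves agr_resolves])
  note [simp] = twisted_braid_simps[OF agr_grading] grading_simps(2)[OF agr_grading]
  fix i j
  let ?\<iota> = "incl (agr A)" and ?p = "proj (agr A)"
  have "?p (j + i) \<cdot> mu A \<cdot> (?\<iota> j \<otimes>\<^sub>m ?\<iota> i) \<cdot> Braid C (part (agr A) i) (part (agr A) j) =
      Scale C (\<kappa> i j) (?p (i + j) \<cdot> mu A \<cdot> (?\<iota> i \<otimes>\<^sub>m ?\<iota> j))"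
    using graded_comm[unfolded graded_commutative_def graded_component_def, rule_format, of j i] by simp
  \<comment> \<open>Graded commutativity is an equation between maps on the parts; surrounding it
    with inclusion and projections makes it an equation between maps on A \<otimes> A. The outer
    projector to degree i + j then disappears by \<open>mu_hp\<close>.\<close>
  from arg_cong[OF this, of "\<lambda>t. ?\<iota> (i + j) \<cdot> t \<cdot> (?p i \<otimes>\<^sub>m ?p j)"]
  have "ha (j + i) \<cdot> mu A \<cdot> (ha j \<otimes>\<^sub>m ha i) \<cdot> Braid C a a = Scale C (\<kappa> i j) (ha (i + j) \<cdot> mu A \<cdot> (ha i \<otimes>\<^sub>m ha j))"
    by (simp add: hp_def add.commute)
  then have "Scale C (\<kappa> i j) (mu A \<cdot> (ha i \<otimes>\<^sub>m ha j)) = mu A \<cdot> (ha j \<otimes>\<^sub>m ha i) \<cdot> Braid C a a"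
    by (simp add: mu_hp reassoc[OF mu_hp[of j i]] reassoc1 flip: assoc_comp)
  from arg_cong[OF this, of "Scale C (inverse (\<kappa> i j))"]
  show "(mu A \<cdot> twisted_braid a (agr A)) \<cdot> (ha i \<otimes>\<^sub>m ha j) = mu A \<cdot> (ha i \<otimes>\<^sub>m ha j)"
    by (simp add: twisted_braid_homogeneous[OF agr_grading, of "ha i" i "ha j" j])
qed (use twisted_braid_simps[OF agr_grading] in simp_all)

lemma module_twisted_braid_simps [simp]:
  assumes "gmod m"
  shows "twisted_braid (mob m) (mgr m) \<in> Mor C" "Dom C (twisted_braid (mob m) (mgr m)) = a \<otimes>\<^sub>o mob m"
    "Cod C (twisted_braid (mob m) (mgr m)) = mob m \<otimes>\<^sub>o a"
  using twisted_braid_simps[OF mgr_grading[OF assms]] by auto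

text \<open>Inclusion and projection around each component combine to projectors by naturality of
  the braiding, and the projector on the target is absorbed because the action preserves degrees.
  What remains is the sum defining the twisted braiding.\<close>

lemma left_action_eq:
  assumes m: "gmod m"
  shows "la m = act m \<cdot> twisted_braid (mob m) (mgr m)"
proof -
  note [simp] = m grading_simps(2)[OF agr_grading] grading_simps(2)[OF mgr_grading[OF m]]
  have s: "incl (mgr m) (i + j) \<cdot> left_component C A \<kappa> m i j \<cdot> (proj (agr A) i \<otimes>\<^sub>m proj (mgr m) j) =
    Scale C (inverse (\<kappa> i j)) (act m \<cdot> (hm m j \<otimes>\<^sub>m ha i) \<cdot> Braid C a (mob m))" for i j
  proof -
    have "incl (mgr m) (i + j) \<cdot> left_component C A \<kappa> m i j \<cdot> (proj (agr A) i \<otimes>\<^sub>m proj (mgr m) j) =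
      Scale C (inverse (\<kappa> i j)) ((hm m (j + i) \<cdot> act m \<cdot> (hm m j \<otimes>\<^sub>m ha i)) \<cdot> Braid C a (mob m))"
      by (simp add: left_component_def graded_component_def hp_def add.commute)
    also have "\<dots> = Scale C (inverse (\<kappa> i j)) (act m \<cdot> (hm m j \<otimes>\<^sub>m ha i) \<cdot> Braid C a (mob m))"
      by (subst act_hp) simp_all
    finally show ?thesis .
  qed
  show ?thesis
    unfolding left_action_def twisted_braid_def
    by (subst sum_comp(2)) (auto simp: s intro!: sum_cong split: prod.splits)
qed

lemma la_simps [simp]:
  assumes "gmod m"
  shows "la m \<in> Mor C" "Dom C (la m) = a \<otimes>\<^sub>o mob m" "Cod C (la m) = mob m"
  using assms by (simp_all add: left_action_eq)

end

section \<open>Graded modules as bimodules\<close>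

context graded_commutative_algebra
begin

lemma algebra_twisted_braid_simps [simp]:
  "twisted_braid a (agr A) \<in> Mor C" "Dom C (twisted_braid a (agr A)) = a \<otimes>\<^sub>o a" "Cod C (twisted_braid a (agr A)) = a \<otimes>\<^sub>o a"
  using twisted_braid_simps[OF agr_grading] by auto

lemma left_action_restricts:
  assumes m: "gmod m"
  shows "restricts C (agr A) (mgr m) (mgr m) (la m)"
  unfolding restricts_iff[OF agr_grading mgr_grading[OF m] mgr_grading[OF m] la_simps[OF m]]
proof (intro allI)
  note [simp] = m
  fix i j
  have *: "la m \<cdot> (ha i \<otimes>\<^sub>m hm m j) = Scale C (inverse (\<kappa> i j)) (act m \<cdot> (hm m j \<otimes>\<^sub>m ha i) \<cdot> Braid C a (mob m))"
    by (simp add: left_action_eq twisted_braid_homogeneous[OF mgr_grading[OF m], of "ha i" i "hm m j" j])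
  have "hm m (j + i) \<cdot> act m \<cdot> (hm m j \<otimes>\<^sub>m ha i) \<cdot> Braid C a (mob m) =
    (hm m (j + i) \<cdot> act m \<cdot> (hm m j \<otimes>\<^sub>m ha i)) \<cdot> Braid C a (mob m)"
    by simp
  also have "\<dots> = act m \<cdot> (hm m j \<otimes>\<^sub>m ha i) \<cdot> Braid C a (mob m)"
    by (subst act_hp) simp_all
  finally show "hm m (i + j) \<cdot> la m \<cdot> (ha i \<otimes>\<^sub>m hm m j) = la m \<cdot> (ha i \<otimes>\<^sub>m hm m j)"
    by (simp add: * add.commute)
qed

text \<open>To act from the left on the image of \<open>g\<close>, A is carried past both factors
  and then acts from the right. Taking \<open>g\<close> to be the left action, the right action or
  the projection to a tensor product yields associativity, the bimodule law and the left action on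
  that tensor product.\<close>

lemma left_action_tens:
  assumes Y: "is_grading C y Y" and Z: "is_grading C z Z" and m: "gmod m"
    and g: "g \<in> Mor C" "Dom C g = y \<otimes>\<^sub>o z" "Cod C g = mob m" and gr: "restricts C Y Z (mgr m) g"
  shows "la m \<cdot> (a \<lhd> g) \<cdot> Assoc C a y z =
    act m \<cdot> (g \<rhd> a) \<cdot> assoc_inv y z a \<cdot> (y \<lhd> twisted_braid z Z) \<cdot> Assoc C y a z \<cdot> (twisted_braid y Y \<rhd> z)"
proof -
  have "la m \<cdot> (a \<lhd> g) \<cdot> Assoc C a y z = act m \<cdot> (twisted_braid (mob m) (mgr m) \<cdot> (a \<lhd> g) \<cdot> Assoc C a y z)"
    using m g grading_simps(1)[OF Y] grading_simps(1)[OF Z] by (simp add: left_action_eq)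
  then show ?thesis by (subst (asm) twisted_braid_tens_right[OF Y Z mgr_grading[OF m] g gr])
qed

text \<open>A right action read through a braiding would reverse the order of multiplication.
  Inserting the twisted braiding in front of the product, which does not change it by commutativity,
  restores the order.\<close>

lemma left_action_assoc:
  assumes m: "gmod m"
  shows "la m \<cdot> (mu A \<rhd> mob m) = la m \<cdot> (a \<lhd> la m) \<cdot> Assoc C a a (mob m)"
proof -
  let ?m = "mob m" and ?t = "twisted_braid (mob m) (mgr m)" and ?ta = "twisted_braid a (agr A)"
  note [simp] = m
  have "la m \<cdot> (mu A \<rhd> ?m) = la m \<cdot> ((mu A \<cdot> ?ta) \<rhd> ?m)"
    by (subst mu_twisted_braid) simp
  also have "\<dots> = act m \<cdot> (?t \<cdot> (mu A \<rhd> ?m)) \<cdot> (?ta \<rhd> ?m)"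
    by (simp add: left_action_eq)
  also have "\<dots> = (act m \<cdot> (?m \<lhd> mu A) \<cdot> Assoc C ?m a a) \<cdot> (?t \<rhd> a) \<cdot>
    assoc_inv a ?m a \<cdot> (a \<lhd> ?t) \<cdot> Assoc C a a ?m \<cdot> (?ta \<rhd> ?m)"
    by (subst twisted_braid_tens_left[OF mgr_grading[OF m]]) simp
  also have "\<dots> = act m \<cdot> (la m \<rhd> a) \<cdot>
    assoc_inv a ?m a \<cdot> (a \<lhd> ?t) \<cdot> Assoc C a a ?m \<cdot> (?ta \<rhd> ?m)"
    by (subst act_assoc[symmetric]) (simp_all add: left_action_eq)
  also have "\<dots> = la m \<cdot> (a \<lhd> la m) \<cdot> Assoc C a a ?m"
    by (subst left_action_tens[OF agr_grading mgr_grading[OF m] m _ _ _ left_action_restricts]) simp_all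
  finally show ?thesis .
qed

text \<open>Carrying A past the module and past the second copy of A leaves the two copies
  multiplied in exchanged order, which commutativity undoes.\<close>

lemma left_right_action:
  assumes m: "gmod m"
  shows "act m \<cdot> (la m \<rhd> a) = la m \<cdot> (a \<lhd> act m) \<cdot> Assoc C a (mob m) a"
proof -
  let ?m = "mob m" and ?t = "twisted_braid (mob m) (mgr m)" and ?ta = "twisted_braid a (agr A)"
  note [simp] = m
  have "la m \<cdot> (a \<lhd> act m) \<cdot> Assoc C a ?m a = (act m \<cdot> (act m \<rhd> a)) \<cdot> assoc_inv ?m a a \<cdot>
      (?m \<lhd> ?ta) \<cdot> Assoc C ?m a a \<cdot> (?t \<rhd> a)"
    by (subst left_action_tens[OF mgr_grading[OF m] agr_grading m _ _ _ restricts_act]) simp_all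
  also have "\<dots> = act m \<cdot> (?m \<lhd> (mu A \<cdot> ?ta)) \<cdot> Assoc C ?m a a \<cdot> (?t \<rhd> a)"
    by (subst act_assoc) simp_all
  also have "\<dots> = (act m \<cdot> (?m \<lhd> mu A) \<cdot> Assoc C ?m a a) \<cdot> (?t \<rhd> a)"
    by (subst mu_twisted_braid) simp
  also have "\<dots> = act m \<cdot> (la m \<rhd> a)"
    by (subst act_assoc[symmetric]) (simp_all add: left_action_eq)
  finally show ?thesis by simp
qed

text \<open>The homogeneous component of degree \<open>0\<close> of the unit is already a right unit.\<close>

lemma eta_degree_zero: "ha 0 \<cdot> eta A = eta A"
proof -
  let ?e = "ha 0 \<cdot> eta A" and ?I = "Unit C"
  have "mu A \<cdot> (a \<lhd> ?e) = Runit C a"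
  proof (rule resolves_ext[OF resolves_tens(1)[OF agr_resolves]])
    fix j
    have z: "ha j \<cdot> mu A \<cdot> (ha j \<otimes>\<^sub>m ha i) = (if i = 0 then mu A \<cdot> (ha j \<otimes>\<^sub>m ha i) else Zero C (a \<otimes>\<^sub>o a) a)" for i
    proof -
      have "ha j \<cdot> mu A \<cdot> (ha j \<otimes>\<^sub>m ha i) = ha j \<cdot> ha (j + i) \<cdot> mu A \<cdot> (ha j \<otimes>\<^sub>m ha i)"
        using mu_hp[of j i] by simp
      also have "\<dots> = (if i = 0 then ha j \<cdot> mu A \<cdot> (ha j \<otimes>\<^sub>m ha i) else Zero C (a \<otimes>\<^sub>o a) a)"
        by (subst hp_cancel[OF agr_grading]) auto
      finally show ?thesis using mu_hp[of j i] by auto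
    qed
    \<comment> \<open>Multiplying degree j by degree i lands in degree j again only for i =
      0.\<close>
    have "ha j \<cdot> mu A \<cdot> (ha j \<rhd> a) = mu A \<cdot> (ha j \<otimes>\<^sub>m ha 0)"
      by (rule resolves_ext[OF resolves_tens(2)[OF agr_resolves]]) (auto simp: z grading_simps(13)[OF agr_grading])
    from arg_cong[OF this, of "\<lambda>t. t \<cdot> (a \<lhd> eta A)"]
    have "mu A \<cdot> (ha j \<otimes>\<^sub>m ?e) = ha j \<cdot> (mu A \<cdot> (a \<lhd> eta A)) \<cdot> (ha j \<rhd> ?I)"
      by (simp del: alg_simps(9))
    then show "(mu A \<cdot> (a \<lhd> ?e)) \<cdot> (ha j \<rhd> ?I) = Runit C a \<cdot> (ha j \<rhd> ?I)"
      by (simp add: hp_cancel[OF agr_grading])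
  qed simp_all
  \<comment> \<open>The usual comparison of a left with a right unit: the product of
    \<open>eta A\<close> and \<open>?e\<close> equals both of them.\<close>
  then have "(mu A \<cdot> (a \<lhd> ?e)) \<cdot> (eta A \<rhd> ?I) = Runit C a \<cdot> (eta A \<rhd> ?I)"
    by simp
  then have "eta A \<cdot> Runit C ?I = (mu A \<cdot> (eta A \<rhd> a)) \<cdot> (?I \<lhd> ?e)"
    by (simp del: alg_simps(8))
  also have "\<dots> = ?e \<cdot> Runit C ?I"
    by (simp add: lunit_unit)
  finally show ?thesis
    by (intro iso_cancel_right[of "Runit C ?I" ?e "eta A"]) simp_all
qed

text \<open>The unit of A has degree 0, where \<kappa> is 1, so the twist is invisible and the
  ordinary braiding with the monoidal unit remains.\<close>

lemma left_action_unit: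
  assumes m: "gmod m"
  shows "la m \<cdot> (eta A \<rhd> mob m) = Lunit C (mob m)"
proof (rule resolves_ext[OF resolves_tens(2)[OF mgr_resolves[OF m]]])
  note [simp] = m
  fix j
  have "(la m \<cdot> (eta A \<rhd> mob m)) \<cdot> ((Unit C) \<lhd> hm m j) = act m \<cdot> (hm m j \<otimes>\<^sub>m eta A) \<cdot> Braid C (Unit C) (mob m)" (is "?lhs = _")
    by (simp add: left_action_eq twisted_braid_homogeneous[OF mgr_grading[OF m], of "eta A" 0 "hm m j" j] eta_degree_zero)
  also have "\<dots> = (act m \<cdot> (mob m \<lhd> eta A)) \<cdot> (hm m j \<rhd> (Unit C)) \<cdot> Braid C (Unit C) (mob m)"
    by (simp del: gmod_simps(5))
  also have "\<dots> = hm m j \<cdot> Runit C (mob m) \<cdot> Braid C (Unit C) (mob m)"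
    by simp
  also have "\<dots> = Lunit C (mob m) \<cdot> ((Unit C) \<lhd> hm m j)"
    by (simp add: runit_braid)
  finally show "?lhs = \<dots>" .
qed (use m in simp_all)

lemma bimodule: "gmod m \<Longrightarrow> is_bimodule C A (mob m) (la m) (act m)"
  unfolding is_bimodule_def is_left_module_def is_right_module_def
  using left_action_assoc[of m] left_action_unit[of m] left_right_action[of m] act_assoc[of m] by simp

text \<open>Gradedness lets \<open>f\<close> pass through the twisted braiding, and linearity lets
  it pass through the right action.\<close>

lemma left_action_natural:
  assumes m: "gmod m" and n: "gmod n" and f: "f \<in> Mor C" "Dom C f = mob m" "Cod C f = mob n"
    "f \<cdot> act m = act n \<cdot> (f \<rhd> a)" "\<And>i. f \<cdot> hm m i = hm n i \<cdot> f"
  shows "f \<cdot> la m = la n \<cdot> (a \<lhd> f)"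
proof -
  note [simp] = m n f(1-3)
  have "f \<cdot> la m = (f \<cdot> act m) \<cdot> twisted_braid (mob m) (mgr m)"
    by (simp add: left_action_eq)
  also have "\<dots> = act n \<cdot> ((f \<rhd> a) \<cdot> twisted_braid (mob m) (mgr m))"
    unfolding f(4) by simp
  also have "\<dots> = la n \<cdot> (a \<lhd> f)"
    by (subst twisted_braid_nat[OF mgr_grading[OF m] mgr_grading[OF n] f(1,2,3,5), symmetric]) (simp add: left_action_eq)
  finally show ?thesis .
qed

text \<open>Mapping each part into the part of the same degree amounts to commuting with the
  projectors, an equational form that is stable under sums, composition and inverses.\<close>

lemma is_graded_hom_iff:
  assumes m: "gmod m" and n: "gmod n"
  shows "is_graded_hom C A m n f \<longleftrightarrow> f \<in> Mor C \<and> Dom C f = mob m \<and> Cod C f = mob n \<and>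
    f \<cdot> act m = act n \<cdot> (f \<rhd> a) \<and> (\<forall>i. f \<cdot> hm m i = hm n i \<cdot> f)"
proof -
  have "(\<forall>i. factors_through C (f \<cdot> incl (mgr m) i) (incl (mgr n) i)) \<longleftrightarrow> (\<forall>i. f \<cdot> hm m i = hm n i \<cdot> f)"
    if f: "f \<in> Mor C" "Dom C f = mob m" "Cod C f = mob n"
  proof -
    note [simp] = m n f grading_simps(1-8,10-12,14-15)[OF mgr_grading[OF m]]
      grading_simps(1-8,10-12,14-15)[OF mgr_grading[OF n]]
    have "factors_through C (f \<cdot> incl (mgr m) i) (incl (mgr n) i) \<longleftrightarrow> hm n i \<cdot> f \<cdot> incl (mgr m) i = f \<cdot> incl (mgr m) i" for i
      by (rule factors_incl_iff[OF mgr_grading[OF n]]) simp_all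
    also have "hm n i \<cdot> f \<cdot> incl (mgr m) i = f \<cdot> incl (mgr m) i \<longleftrightarrow> hm n i \<cdot> f \<cdot> hm m i = f \<cdot> hm m i" for i
    proof
      assume "hm n i \<cdot> f \<cdot> incl (mgr m) i = f \<cdot> incl (mgr m) i"
      from arg_cong[OF this, of "\<lambda>t. t \<cdot> proj (mgr m) i"] show "hm n i \<cdot> f \<cdot> hm m i = f \<cdot> hm m i"
        by (simp flip: hp_def)
    next
      assume "hm n i \<cdot> f \<cdot> hm m i = f \<cdot> hm m i"
      from arg_cong[OF this, of "\<lambda>t. t \<cdot> incl (mgr m) i"]
      show "hm n i \<cdot> f \<cdot> incl (mgr m) i = f \<cdot> incl (mgr m) i" by simp
    qed
    finally have 1: "factors_through C (f \<cdot> incl (mgr m) i) (incl (mgr n) i) \<longleftrightarrow> hm n i \<cdot> f \<cdot> hm m i = f \<cdot> hm m i" for i .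
    show ?thesis unfolding 1
    proof (intro iffI allI)
      fix i
      assume *: "\<forall>i. hm n i \<cdot> f \<cdot> hm m i = f \<cdot> hm m i"
      show "f \<cdot> hm m i = hm n i \<cdot> f"
      proof (rule resolves_ext[OF mgr_resolves[OF m]])
        fix j
        \<comment> \<open>The component from degree j is already in degree j, so the projector to
          degree i keeps it or kills it; the other side of the equation behaves in the same
          way.\<close>
        have "hm n i \<cdot> f \<cdot> hm m j = hm n i \<cdot> hm n j \<cdot> f \<cdot> hm m j"
          using * by simp
        also have "\<dots> = (if i = j then f \<cdot> hm m j else Zero C (mob m) (mob n))"
          using * by (subst hp_cancel[OF mgr_grading[OF n]]) auto
        finally show "(f \<cdot> hm m i) \<cdot> hm m j = (hm n i \<cdot> f) \<cdot> hm m j"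
          using grading_simps(13)[OF mgr_grading[OF m], of i j] by simp
      qed simp_all
    next
      fix i
      assume *: "\<forall>i. f \<cdot> hm m i = hm n i \<cdot> f"
      then show "hm n i \<cdot> f \<cdot> hm m i = f \<cdot> hm m i"
        using hp_cancel[OF mgr_grading[OF n], of f i i] by simp
    qed
  qed
  then show ?thesis by (auto simp: is_graded_hom_def)
qed

lemma gmod_regular [simp]: "gmod (regular_module A)"
  using graded_algebra
  unfolding is_graded_module_def is_graded_algebra_def is_algebra_def is_right_module_def regular_module_def
  by auto

lemma regular_simps [simp]:
  "mob (regular_module A) = a" "act (regular_module A) = mu A" "mgr (regular_module A) = agr A"
  by (simp_all add: regular_module_def)

lemma la_regular [simp]: "la (regular_module A) = mu A"
  by (simp add: left_action_eq mu_twisted_braid)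

end

section \<open>Tensor products over the algebra\<close>

context category
begin

lemma coequalizer_epi:
  assumes "is_coequalizer C f g q \<pi>" "f \<in> Mor C" "u \<in> Mor C" "v \<in> Mor C" "Dom C u = q" "Dom C v = q" "Cod C u = Cod C v"
    and g: "g \<in> Mor C" "Dom C g = Dom C f" "Cod C g = Cod C f"
    and "u \<cdot> \<pi> = v \<cdot> \<pi>"
  shows "u = v"
proof -
  have *: "\<pi> \<in> Mor C" "Dom C \<pi> = Cod C f" "Cod C \<pi> = q" "\<pi> \<cdot> f = \<pi> \<cdot> g"
    and ex1: "\<And>z h. z \<in> Ob C \<Longrightarrow> h \<in> homset C (Cod C f) z \<Longrightarrow> h \<cdot> f = h \<cdot> g \<Longrightarrow>
        (\<exists>!u. u \<in> homset C q z \<and> u \<cdot> \<pi> = h)"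
    using assms(1) unfolding is_coequalizer_def by auto
  have "(u \<cdot> \<pi>) \<cdot> f = (u \<cdot> \<pi>) \<cdot> g"
    using assms * by simp
  then have "\<exists>!w. w \<in> homset C q (Cod C u) \<and> w \<cdot> \<pi> = u \<cdot> \<pi>"
    by (intro ex1) (use assms * in simp_all)
  moreover have "u \<in> homset C q (Cod C u)" "v \<in> homset C q (Cod C u)"
    using assms(3-7) by simp_all
  ultimately show ?thesis using assms(11) by metis
qed

lemma coequalizer_descend:
  assumes "is_coequalizer C f g q \<pi>" "h \<in> Mor C" "Dom C h = Cod C f" "h \<cdot> f = h \<cdot> g"
  obtains u where "u \<in> Mor C" "Dom C u = q" "Cod C u = Cod C h" "u \<cdot> \<pi> = h"
proof -
  have "\<exists>!u. u \<in> homset C q (Cod C h) \<and> u \<cdot> \<pi> = h"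
    using assms unfolding is_coequalizer_def by auto
  then show ?thesis using that by auto
qed

end

locale module_tensor = graded_commutative_algebra +
  fixes m n :: "('a, 'b, 'e) gr_mod" and q \<pi>
  assumes left_gmod [simp]: "gmod m" and right_gmod [simp]: "gmod n"
    and is_tensor: "is_tensor_over C A (mob m) (act m) (mob n) (la n) q \<pi>"
begin

abbreviation "m' \<equiv> mob m"
abbreviation "n' \<equiv> mob n"

lemma tensor_simps [simp]:
  "q \<in> Ob C" "\<pi> \<in> Mor C" "Dom C \<pi> = m' \<otimes>\<^sub>o n'" "Cod C \<pi> = q"
  using is_tensor by (auto simp: is_tensor_over_def is_coequalizer_def tens_pair1_def)

lemma balanced: "\<pi> \<cdot> (act m \<rhd> n') = \<pi> \<cdot> (m' \<lhd> la n) \<cdot> Assoc C m' a n'"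
  using is_tensor unfolding is_tensor_over_def is_coequalizer_def tens_pair1_def tens_pair2_def by blast

text \<open>Preservation is assumed for every coequalizer of the two actions, so it covers the
  arbitrary pair \<open>q\<close>, \<open>\<pi>\<close> of this locale.\<close>

lemma preserved:
  assumes "z \<in> Ob C"
  shows "is_coequalizer C ((act m \<rhd> n') \<rhd> z)
      (((m' \<lhd> la n) \<cdot> Assoc C m' a n') \<rhd> z) (q \<otimes>\<^sub>o z) (\<pi> \<rhd> z)"
    and "is_coequalizer C (z \<lhd> (act m \<rhd> n'))
      (z \<lhd> ((m' \<lhd> la n) \<cdot> Assoc C m' a n')) (z \<otimes>\<^sub>o q) (z \<lhd> \<pi>)"
proof -
  have "tensor_over_preserved C A m' (act m) n' (la n) q \<pi>"
    using tensor_exists bimodule[OF left_gmod] bimodule[OF right_gmod] is_tensor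
    unfolding bimodule_tensor_exists_def by blast
  then show "is_coequalizer C ((act m \<rhd> n') \<rhd> z)
      (((m' \<lhd> la n) \<cdot> Assoc C m' a n') \<rhd> z) (q \<otimes>\<^sub>o z) (\<pi> \<rhd> z)"
    "is_coequalizer C (z \<lhd> (act m \<rhd> n'))
      (z \<lhd> ((m' \<lhd> la n) \<cdot> Assoc C m' a n')) (z \<otimes>\<^sub>o q) (z \<lhd> \<pi>)"
    using assms unfolding tensor_over_preserved_def tens_pair1_def tens_pair2_def by blast+
qed

lemma tensor_epi:
  assumes "u \<in> Mor C" "v \<in> Mor C" "Dom C u = q" "Dom C v = q" "Cod C u = Cod C v" "u \<cdot> \<pi> = v \<cdot> \<pi>"
  shows "u = v"
  by (rule coequalizer_epi[OF is_tensor[unfolded is_tensor_over_def]])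
    (use assms in \<open>simp_all add: tens_pair1_def tens_pair2_def\<close>)

lemma tensor_epi_right:
  assumes "u \<in> Mor C" "v \<in> Mor C" "z \<in> Ob C" "Dom C u = q \<otimes>\<^sub>o z" "Dom C v = q \<otimes>\<^sub>o z" "Cod C u = Cod C v"
    "u \<cdot> (\<pi> \<rhd> z) = v \<cdot> (\<pi> \<rhd> z)"
  shows "u = v"
  by (rule coequalizer_epi[OF preserved(1)[of z]]) (use assms in simp_all)

lemma tensor_epi_left:
  assumes "u \<in> Mor C" "v \<in> Mor C" "z \<in> Ob C" "Dom C u = z \<otimes>\<^sub>o q" "Dom C v = z \<otimes>\<^sub>o q" "Cod C u = Cod C v"
    "u \<cdot> (z \<lhd> \<pi>) = v \<cdot> (z \<lhd> \<pi>)"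
  shows "u = v"
  by (rule coequalizer_epi[OF preserved(2)[of z]]) (use assms in simp_all)

text \<open>Naturality of the inverse associator turns two whiskerings into a single one by
  \<open>z \<otimes>\<^sub>o w\<close>.\<close>

lemma tensor_epi_right2:
  assumes "u \<in> Mor C" "v \<in> Mor C" "z \<in> Ob C" "w \<in> Ob C" "Dom C u = (q \<otimes>\<^sub>o z) \<otimes>\<^sub>o w" "Dom C v = (q \<otimes>\<^sub>o z) \<otimes>\<^sub>o w"
    "Cod C u = Cod C v"
    "u \<cdot> ((\<pi> \<rhd> z) \<rhd> w) = v \<cdot> ((\<pi> \<rhd> z) \<rhd> w)"
  shows "u = v"
proof -
  have "u \<cdot> assoc_inv q z w = v \<cdot> assoc_inv q z w"
  proof (rule tensor_epi_right)
    show "(u \<cdot> assoc_inv q z w) \<cdot> (\<pi> \<rhd> (z \<otimes>\<^sub>o w)) = (v \<cdot> assoc_inv q z w) \<cdot> (\<pi> \<rhd> (z \<otimes>\<^sub>o w))"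
      using assms(1-7) arg_cong[OF assms(8), of "\<lambda>t. t \<cdot> assoc_inv (m' \<otimes>\<^sub>o n') z w"] by simp
  qed (use assms in simp_all)
  from arg_cong[OF this, of "\<lambda>t. t \<cdot> Assoc C q z w"] show ?thesis using assms by simp
qed

lemma tensor_descend:
  assumes "h \<in> Mor C" "Dom C h = m' \<otimes>\<^sub>o n'" "h \<cdot> (act m \<rhd> n') = h \<cdot> (m' \<lhd> la n) \<cdot> Assoc C m' a n'"
  obtains u where "u \<in> Mor C" "Dom C u = q" "Cod C u = Cod C h" "u \<cdot> \<pi> = h"
proof (rule coequalizer_descend[OF is_tensor[unfolded is_tensor_over_def tens_pair1_def tens_pair2_def] assms(1) _ assms(3)])
  show "Dom C h = Cod C (act m \<rhd> n')" using assms(2) by simp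
qed (erule (3) that)

lemma tensor_descend_right:
  assumes "h \<in> Mor C" "z \<in> Ob C" "Dom C h = (m' \<otimes>\<^sub>o n') \<otimes>\<^sub>o z"
    "h \<cdot> ((act m \<rhd> n') \<rhd> z) = h \<cdot> (((m' \<lhd> la n) \<cdot> Assoc C m' a n') \<rhd> z)"
  obtains u where "u \<in> Mor C" "Dom C u = q \<otimes>\<^sub>o z" "Cod C u = Cod C h" "u \<cdot> (\<pi> \<rhd> z) = h"
proof (rule coequalizer_descend[OF preserved(1)[OF assms(2)] assms(1) _ assms(4)])
  show "Dom C h = Cod C ((act m \<rhd> n') \<rhd> z)" using assms(2,3) by simp
qed (erule (3) that)

lemma tensor_descend_left:
  assumes "h \<in> Mor C" "z \<in> Ob C" "Dom C h = z \<otimes>\<^sub>o (m' \<otimes>\<^sub>o n')"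
    "h \<cdot> (z \<lhd> (act m \<rhd> n')) = h \<cdot> (z \<lhd> ((m' \<lhd> la n) \<cdot> Assoc C m' a n'))"
  obtains u where "u \<in> Mor C" "Dom C u = z \<otimes>\<^sub>o q" "Cod C u = Cod C h" "u \<cdot> (z \<lhd> \<pi>) = h"
proof (rule coequalizer_descend[OF preserved(2)[OF assms(2)] assms(1) _ assms(4)])
  show "Dom C h = Cod C (z \<lhd> (act m \<rhd> n'))" using assms(2,3) by simp
qed (erule (3) that)

text \<open>The right action of n respects balancing because it commutes with the left action of n.
  As it has to descend along \<open>\<pi> \<rhd> a\<close>, preservation of the coequalizer
  enters.\<close>

lemma tensor_act_ex:
  obtains r where "r \<in> Mor C" "Dom C r = q \<otimes>\<^sub>o a" "Cod C r = q"
    "r \<cdot> (\<pi> \<rhd> a) = \<pi> \<cdot> (m' \<lhd> act n) \<cdot> Assoc C m' n' a"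
proof -
  let ?h = "\<pi> \<cdot> (m' \<lhd> act n) \<cdot> Assoc C m' n' a"
  have "?h \<cdot> (((m' \<lhd> la n) \<cdot> Assoc C m' a n') \<rhd> a) =
    \<pi> \<cdot> (m' \<lhd> (act n \<cdot> (la n \<rhd> a))) \<cdot> Assoc C m' (a \<otimes>\<^sub>o n') a \<cdot> (Assoc C m' a n' \<rhd> a)"
    by simp
  also have "\<dots> = \<pi> \<cdot> (m' \<lhd> la n) \<cdot> Assoc C m' a n' \<cdot> ((m' \<otimes>\<^sub>o a) \<lhd> act n) \<cdot> Assoc C (m' \<otimes>\<^sub>o a) n' a"
    unfolding left_right_action[OF right_gmod] by (subst head_tens) simp_all
  also have "\<dots> = (\<pi> \<cdot> (act m \<rhd> n')) \<cdot> ((m' \<otimes>\<^sub>o a) \<lhd> act n) \<cdot> Assoc C (m' \<otimes>\<^sub>o a) n' a"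
    by (subst balanced) simp
  also have "\<dots> = ?h \<cdot> ((act m \<rhd> n') \<rhd> a)"
    by simp
  finally have eq: "?h \<cdot> ((act m \<rhd> n') \<rhd> a) = ?h \<cdot> (((m' \<lhd> la n) \<cdot> Assoc C m' a n') \<rhd> a)"
    by (rule sym)
  show ?thesis
    by (rule tensor_descend_right[OF _ _ _ eq]) (simp, simp, simp, rule that, simp_all)
qed

section \<open>Degree projections and the grading of the coequalizer\<close>

lemma degree_projection_simps [simp]:
  "degree_projection C m n k \<in> Mor C" "Dom C (degree_projection C m n k) = m' \<otimes>\<^sub>o n'"
  "Cod C (degree_projection C m n k) = m' \<otimes>\<^sub>o n'"
  unfolding degree_projection_def hp_def[symmetric] by (auto intro!: sum_simps)

lemma degree_projection_homogeneous:
  assumes u: "u \<in> Mor C" "hm m i \<cdot> u = u" "Cod C u = m'"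
    and v: "v \<in> Mor C" "hm n j \<cdot> v = v" "Cod C v = n'"
  shows "degree_projection C m n k \<cdot> (u \<otimes>\<^sub>m v) =
    (if i + j = k then u \<otimes>\<^sub>m v else Zero C (Dom C u \<otimes>\<^sub>o Dom C v) (m' \<otimes>\<^sub>o n'))"
proof -
  have h: "hm m i' \<cdot> u = (if i' = i then u else Zero C (Dom C u) m')" for i'
    using u hp_cancel[OF mgr_grading[OF left_gmod] u(1,3), of i' i] by auto
  have k: "hm n i' \<cdot> v = (if i' = j then v else Zero C (Dom C v) n')" for i'
    using v hp_cancel[OF mgr_grading[OF right_gmod] v(1,3), of i' j] by auto
  have "degree_projection C m n k \<cdot> (u \<otimes>\<^sub>m v) = hom_sum C (Dom C u \<otimes>\<^sub>o Dom C v) (m' \<otimes>\<^sub>o n')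
      (\<lambda>p. (case p of (i, j) \<Rightarrow> hm m i \<otimes>\<^sub>m hm n j) \<cdot> (u \<otimes>\<^sub>m v)) {(i, j). i + j = k}"
    unfolding degree_projection_def hp_def[symmetric] by (subst sum_comp(1)) (use u v in auto)
  also have "\<dots> = (if (i, j) \<in> {(i, j). i + j = k} then u \<otimes>\<^sub>m v else Zero C (Dom C u \<otimes>\<^sub>o Dom C v) (m' \<otimes>\<^sub>o n'))"
    by (rule sum_delta) (use u v in \<open>auto simp: h k split: if_splits\<close>)
  finally show ?thesis by simp
qed

lemma degree_projection_hp:
  "degree_projection C m n k \<cdot> (hm m i \<otimes>\<^sub>m hm n j) =
    (if i + j = k then hm m i \<otimes>\<^sub>m hm n j else Zero C (m' \<otimes>\<^sub>o n') (m' \<otimes>\<^sub>o n'))"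
  using degree_projection_homogeneous[of "hm m i" i "hm n j" j k] by simp

text \<open>The balancing relation is homogeneous: for x, b, y of degrees i, b, j, both x b
  \<otimes> y and x \<otimes> b y have total degree i + b + j. A degree projection thus keeps both
  sides or kills both.\<close>

lemma degree_projection_ex:
  obtains e where "e \<in> Mor C" "Dom C e = q" "Cod C e = q" "e \<cdot> \<pi> = \<pi> \<cdot> degree_projection C m n k"
proof -
  let ?d = "degree_projection C m n k"
  have "(\<pi> \<cdot> ?d) \<cdot> (act m \<rhd> n') = (\<pi> \<cdot> ?d) \<cdot> (m' \<lhd> la n) \<cdot> Assoc C m' a n'"
  proof (rule resolves_ext3[OF mgr_resolves[OF left_gmod] agr_resolves mgr_resolves[OF right_gmod]])
    fix i b j
    let ?u = "(hm m i \<otimes>\<^sub>m ha b) \<otimes>\<^sub>m hm n j"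
    have bal: "\<pi> \<cdot> ((act m \<cdot> (hm m i \<otimes>\<^sub>m ha b)) \<otimes>\<^sub>m hm n j) = \<pi> \<cdot> (hm m i \<otimes>\<^sub>m (la n \<cdot> (ha b \<otimes>\<^sub>m hm n j))) \<cdot> Assoc C m' a n'"
      using arg_cong[OF balanced, of "\<lambda>t. t \<cdot> ?u"] by simp
    have 1: "hm m (i + b) \<cdot> act m \<cdot> (hm m i \<otimes>\<^sub>m ha b) = act m \<cdot> (hm m i \<otimes>\<^sub>m ha b)"
      by (rule act_hp) simp
    have 2: "hm n (b + j) \<cdot> la n \<cdot> (ha b \<otimes>\<^sub>m hm n j) = la n \<cdot> (ha b \<otimes>\<^sub>m hm n j)"
      using left_action_restricts[OF right_gmod]
        restricts_iff[OF agr_grading mgr_grading[OF right_gmod] mgr_grading[OF right_gmod] la_simps[OF right_gmod]] by blast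
    have "((\<pi> \<cdot> ?d) \<cdot> (act m \<rhd> n')) \<cdot> ?u = \<pi> \<cdot> ?d \<cdot> ((act m \<cdot> (hm m i \<otimes>\<^sub>m ha b)) \<otimes>\<^sub>m hm n j)"
      by simp
    also have "\<dots> = (if i + b + j = k then \<pi> \<cdot> ((act m \<cdot> (hm m i \<otimes>\<^sub>m ha b)) \<otimes>\<^sub>m hm n j) else Zero C ((m' \<otimes>\<^sub>o a) \<otimes>\<^sub>o n') q)"
      using degree_projection_homogeneous[of "act m \<cdot> (hm m i \<otimes>\<^sub>m ha b)" "i + b" "hm n j" j k] 1 by simp
    also have "\<dots> = \<pi> \<cdot> (?d \<cdot> (hm m i \<otimes>\<^sub>m (la n \<cdot> (ha b \<otimes>\<^sub>m hm n j)))) \<cdot> Assoc C m' a n'"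
      using degree_projection_homogeneous[of "hm m i" i "la n \<cdot> (ha b \<otimes>\<^sub>m hm n j)" "b + j" k] 2 bal by (simp add: add.assoc)
    finally show "((\<pi> \<cdot> ?d) \<cdot> (act m \<rhd> n')) \<cdot> ?u = ((\<pi> \<cdot> ?d) \<cdot> (m' \<lhd> la n) \<cdot> Assoc C m' a n') \<cdot> ?u"
      by simp
  qed simp_all
  then show ?thesis
    by (rule tensor_descend[rotated 2]) (rule that, simp_all)
qed

lemma degree_projection_mult:
  "degree_projection C m n k \<cdot> degree_projection C m n l =
    (if k = l then degree_projection C m n k else Zero C (m' \<otimes>\<^sub>o n') (m' \<otimes>\<^sub>o n'))"
  by (rule resolves_ext2[OF mgr_resolves[OF left_gmod] mgr_resolves[OF right_gmod]])
    (auto simp: degree_projection_hp)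

lemma degree_projection_sum:
  "hom_sum C (m' \<otimes>\<^sub>o n') (m' \<otimes>\<^sub>o n') (degree_projection C m n) UNIV = Id C (m' \<otimes>\<^sub>o n')"
proof (rule resolves_ext2[OF mgr_resolves[OF left_gmod] mgr_resolves[OF right_gmod]])
  fix i j
  have "hom_sum C (m' \<otimes>\<^sub>o n') (m' \<otimes>\<^sub>o n') (degree_projection C m n) UNIV \<cdot> (hm m i \<otimes>\<^sub>m hm n j) =
    hom_sum C (m' \<otimes>\<^sub>o n') (m' \<otimes>\<^sub>o n') (\<lambda>k. degree_projection C m n k \<cdot> (hm m i \<otimes>\<^sub>m hm n j)) UNIV"
    by (subst sum_comp(1)) simp_all
  also have "\<dots> = (if i + j \<in> UNIV then hm m i \<otimes>\<^sub>m hm n j else Zero C (m' \<otimes>\<^sub>o n') (m' \<otimes>\<^sub>o n'))"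
    by (rule sum_delta) (auto simp: degree_projection_hp)
  finally show "hom_sum C (m' \<otimes>\<^sub>o n') (m' \<otimes>\<^sub>o n') (degree_projection C m n) UNIV \<cdot> (hm m i \<otimes>\<^sub>m hm n j) =
    Id C (m' \<otimes>\<^sub>o n') \<cdot> (hm m i \<otimes>\<^sub>m hm n j)" by simp
qed (auto intro!: sum_simps)

text \<open>The idempotents \<open>e k\<close> inherit orthogonality and completeness from the
  degree projections, by cancelling \<open>\<pi>\<close>. Their splittings form the direct sum
  decomposition of \<open>q\<close>.\<close>

lemma graded_tensor_ex:
  assumes parts: "homogeneous_parts_exist C A \<kappa>"
  shows "\<exists>T. is_graded_tensor C A \<kappa> m n T \<pi>"
proof -
  let ?d = "degree_projection C m n"
  have "\<exists>e. e \<in> Mor C \<and> Dom C e = q \<and> Cod C e = q \<and> e \<cdot> \<pi> = \<pi> \<cdot> ?d k" for k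
    using degree_projection_ex[of k] by metis
  then obtain e where e [simp]: "\<And>k. e k \<in> Mor C" "\<And>k. Dom C (e k) = q" "\<And>k. Cod C (e k) = q"
    and e_\<pi>: "\<And>k. e k \<cdot> \<pi> = \<pi> \<cdot> ?d k"
    by metis
  \<comment> \<open>The existence of homogeneous parts supplies the objects that become the parts of
    \<open>q\<close>.\<close>
  have "splits C (e k)" for k
    using parts is_tensor e_\<pi>[of k] e[of k] left_gmod right_gmod unfolding homogeneous_parts_exist_def in_homset by blast
  then have "\<exists>z r s. z \<in> Ob C \<and> r \<in> homset C q z \<and> s \<in> homset C z q \<and> s \<cdot> r = e k \<and> r \<cdot> s = Id C z" for k
    unfolding splits_def e by blast
  then obtain Z R S where [simp]: "\<And>k. Z k \<in> Ob C" "\<And>k. R k \<in> Mor C" "\<And>k. Dom C (R k) = q" "\<And>k. Cod C (R k) = Z k"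
    "\<And>k. S k \<in> Mor C" "\<And>k. Dom C (S k) = Z k" "\<And>k. Cod C (S k) = q"
    and SR: "\<And>k. S k \<cdot> R k = e k" and RS: "\<And>k. R k \<cdot> S k = Id C (Z k)"
    unfolding in_homset by metis
  obtain r where [simp]: "r \<in> Mor C" "Dom C r = q \<otimes>\<^sub>o a" "Cod C r = q"
    and r: "r \<cdot> (\<pi> \<rhd> a) = \<pi> \<cdot> (m' \<lhd> act n) \<cdot> Assoc C m' n' a"
    by (rule tensor_act_ex)
  have ee: "e k \<cdot> e l = (if k = l then e k else Zero C q q)" for k l
  proof (rule tensor_epi)
    have "(e k \<cdot> e l) \<cdot> \<pi> = (e k \<cdot> \<pi>) \<cdot> ?d l"
      by (simp add: e_\<pi> reassoc1[OF e_\<pi>])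
    also have "\<dots> = (if k = l then e k else Zero C q q) \<cdot> \<pi>"
      unfolding e_\<pi> by (simp add: degree_projection_mult e_\<pi>)
    finally show "(e k \<cdot> e l) \<cdot> \<pi> = (if k = l then e k else Zero C q q) \<cdot> \<pi>" .
  qed simp_all
  have "hom_sum C q q e UNIV = Id C q"
  proof (rule tensor_epi)
    have "hom_sum C q q e UNIV \<cdot> \<pi> = hom_sum C (m' \<otimes>\<^sub>o n') q (\<lambda>k. \<pi> \<cdot> ?d k) UNIV"
      by (subst sum_comp(1)) (simp_all add: e_\<pi>)
    also have "\<dots> = \<pi> \<cdot> hom_sum C (m' \<otimes>\<^sub>o n') (m' \<otimes>\<^sub>o n') ?d UNIV"
      by (subst sum_comp(2)) simp_all
    finally show "hom_sum C q q e UNIV \<cdot> \<pi> = Id C q \<cdot> \<pi>"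
      by (simp add: degree_projection_sum)
  qed simp_all
  moreover have "R k \<cdot> S l = Zero C (Z l) (Z k)" if "k \<noteq> l" for k l
  proof -
    \<comment> \<open>Identities of the parts are inserted on both sides so that the product
      \<open>e k \<cdot> e l\<close> of two different idempotents appears in the middle.\<close>
    have "R k \<cdot> S l = (R k \<cdot> S k) \<cdot> (R k \<cdot> S l) \<cdot> (R l \<cdot> S l)"
      by (simp only: RS) simp
    also have "\<dots> = R k \<cdot> ((S k \<cdot> R k) \<cdot> (S l \<cdot> R l)) \<cdot> S l"
      by simp
    also have "\<dots> = Zero C (Z l) (Z k)"
      unfolding SR ee using that by simp
    finally show ?thesis .
  qed
  ultimately have G: "is_grading C q \<lparr>part = Z, incl = S, proj = R\<rparr>" (is "is_grading C q ?G")
    by (simp add: is_grading_def is_biproduct_def SR RS)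
  have hpG [simp]: "hp ?G k = e k" for k
    by (simp add: hp_def SR)
  let ?T = "\<lparr>mob = q, act = r, mgr = ?G\<rparr>"
  have "r \<cdot> (r \<rhd> a) = r \<cdot> (q \<lhd> mu A) \<cdot> Assoc C q a a"
  proof (rule tensor_epi_right2[of _ _ a a])
    have "(r \<cdot> (r \<rhd> a)) \<cdot> ((\<pi> \<rhd> a) \<rhd> a) = r \<cdot> ((r \<cdot> (\<pi> \<rhd> a)) \<rhd> a)" (is "?lhs = _")
      by simp
    also have "\<dots> = r \<cdot> ((\<pi> \<cdot> (m' \<lhd> act n) \<cdot> Assoc C m' n' a) \<rhd> a)"
      unfolding r ..
    also have "\<dots> = (r \<cdot> (\<pi> \<rhd> a)) \<cdot> (((m' \<lhd> act n) \<cdot> Assoc C m' n' a) \<rhd> a)"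
      by simp
    also have "\<dots> = \<pi> \<cdot> (m' \<lhd> (act n \<cdot> (act n \<rhd> a))) \<cdot> Assoc C m' (n' \<otimes>\<^sub>o a) a \<cdot> (Assoc C m' n' a \<rhd> a)"
      unfolding r by simp
    also have "\<dots> = \<pi> \<cdot> (m' \<lhd> act n) \<cdot> Assoc C m' n' a \<cdot> ((m' \<otimes>\<^sub>o n') \<lhd> mu A) \<cdot> Assoc C (m' \<otimes>\<^sub>o n') a a"
      unfolding act_assoc[OF right_gmod] by (subst head_tens) simp_all
    also have "\<dots> = (r \<cdot> (\<pi> \<rhd> a)) \<cdot> ((m' \<otimes>\<^sub>o n') \<lhd> mu A) \<cdot> Assoc C (m' \<otimes>\<^sub>o n') a a"
      unfolding r by simp
    also have "\<dots> = (r \<cdot> (q \<lhd> mu A) \<cdot> Assoc C q a a) \<cdot> ((\<pi> \<rhd> a) \<rhd> a)"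
      by simp
    finally show "?lhs = \<dots>" .
  qed simp_all
  moreover have "r \<cdot> (q \<lhd> eta A) = Runit C q"
  proof (rule tensor_epi_right[of _ _ "Unit C"])
    have "(r \<cdot> (q \<lhd> eta A)) \<cdot> (\<pi> \<rhd> (Unit C)) = (r \<cdot> (\<pi> \<rhd> a)) \<cdot> ((m' \<otimes>\<^sub>o n') \<lhd> eta A)" (is "?lhs = _")
      by simp
    also have "\<dots> = \<pi> \<cdot> (m' \<lhd> Runit C n') \<cdot> Assoc C m' n' (Unit C)"
      unfolding r by simp
    also have "\<dots> = Runit C q \<cdot> (\<pi> \<rhd> (Unit C))"
      by (subst runit_tens) simp_all
    finally show "?lhs = \<dots>" .
  qed simp_all
  ultimately have rm: "is_right_module C A q r"
    by (simp add: is_right_module_def)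
  have r_gr: "restricts C ?G (agr A) ?G r"
    unfolding restricts_iff[OF G agr_grading G \<open>r \<in> Mor C\<close> \<open>Dom C r = q \<otimes>\<^sub>o a\<close> \<open>Cod C r = q\<close>] hpG
  proof (intro allI)
    fix i j
    show "e (i + j) \<cdot> r \<cdot> (e i \<otimes>\<^sub>m ha j) = r \<cdot> (e i \<otimes>\<^sub>m ha j)"
    proof (rule tensor_epi_right[of _ _ a])
      have s: "r \<cdot> (e i \<otimes>\<^sub>m ha j) \<cdot> (\<pi> \<rhd> a) = \<pi> \<cdot> (m' \<lhd> act n) \<cdot> Assoc C m' n' a \<cdot> (?d i \<otimes>\<^sub>m ha j)"
      proof -
        have "r \<cdot> (e i \<otimes>\<^sub>m ha j) \<cdot> (\<pi> \<rhd> a) = (r \<cdot> (\<pi> \<rhd> a)) \<cdot> (?d i \<otimes>\<^sub>m ha j)"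
          by (simp add: e_\<pi>)
        then show ?thesis unfolding r by simp
      qed
      \<comment> \<open>After moving to m \<otimes> n \<otimes> A the claim concerns degrees only:
        if x + y = i, acting with degree j on the second factor gives total degree i + j; otherwise
        both sides vanish.\<close>
      have t: "?d (i + j) \<cdot> (m' \<lhd> act n) \<cdot> Assoc C m' n' a \<cdot> (?d i \<otimes>\<^sub>m ha j) =
          (m' \<lhd> act n) \<cdot> Assoc C m' n' a \<cdot> (?d i \<otimes>\<^sub>m ha j)"
      proof (rule resolves_ext3[OF mgr_resolves[OF left_gmod] mgr_resolves[OF right_gmod] agr_resolves])
        fix x y z
        have *: "?d (x + y + j) \<cdot> (hm m x \<otimes>\<^sub>m (act n \<cdot> (hm n y \<otimes>\<^sub>m ha j))) = hm m x \<otimes>\<^sub>m (act n \<cdot> (hm n y \<otimes>\<^sub>m ha j))"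
          using degree_projection_homogeneous[of "hm m x" x "act n \<cdot> (hm n y \<otimes>\<^sub>m ha j)" "y + j" "x + y + j"]
            act_hp[OF right_gmod, of y j] by (simp add: add.assoc)
        have "?d (x + y + j) \<cdot> (hm m x \<otimes>\<^sub>m (act n \<cdot> (hm n y \<otimes>\<^sub>m ha j))) \<cdot> Assoc C m' n' a =
            (hm m x \<otimes>\<^sub>m (act n \<cdot> (hm n y \<otimes>\<^sub>m ha j))) \<cdot> Assoc C m' n' a"
          by (rule reassoc1[OF *]) simp_all
        then show "(?d (i + j) \<cdot> (m' \<lhd> act n) \<cdot> Assoc C m' n' a \<cdot> (?d i \<otimes>\<^sub>m ha j)) \<cdot> ((hm m x \<otimes>\<^sub>m hm n y) \<otimes>\<^sub>m ha z) =
          ((m' \<lhd> act n) \<cdot> Assoc C m' n' a \<cdot> (?d i \<otimes>\<^sub>m ha j)) \<cdot> ((hm m x \<otimes>\<^sub>m hm n y) \<otimes>\<^sub>m ha z)"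
          by (auto simp: degree_projection_hp grading_simps(13)[OF agr_grading])
      qed simp_all
      have "(e (i + j) \<cdot> r \<cdot> (e i \<otimes>\<^sub>m ha j)) \<cdot> (\<pi> \<rhd> a) = e (i + j) \<cdot> (r \<cdot> (e i \<otimes>\<^sub>m ha j) \<cdot> (\<pi> \<rhd> a))" (is "?lhs = _")
        by simp
      also have "\<dots> = (e (i + j) \<cdot> \<pi>) \<cdot> (m' \<lhd> act n) \<cdot> Assoc C m' n' a \<cdot> (?d i \<otimes>\<^sub>m ha j)"
        unfolding s by simp
      also have "\<dots> = \<pi> \<cdot> (?d (i + j) \<cdot> (m' \<lhd> act n) \<cdot> Assoc C m' n' a \<cdot> (?d i \<otimes>\<^sub>m ha j))"
        unfolding e_\<pi> by simp
      also have "\<dots> = (r \<cdot> (e i \<otimes>\<^sub>m ha j)) \<cdot> (\<pi> \<rhd> a)"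
        unfolding t using s by simp
      finally show "?lhs = \<dots>" .
    qed simp_all
  qed
  have "e (i + j) \<cdot> \<pi> \<cdot> (hm m i \<otimes>\<^sub>m hm n j) = \<pi> \<cdot> (hm m i \<otimes>\<^sub>m hm n j)" for i j
  proof -
    have "e (i + j) \<cdot> \<pi> \<cdot> (hm m i \<otimes>\<^sub>m hm n j) = (e (i + j) \<cdot> \<pi>) \<cdot> (hm m i \<otimes>\<^sub>m hm n j)" by simp
    then show ?thesis unfolding e_\<pi> by (simp add: degree_projection_hp)
  qed
  then have \<pi>_gr: "restricts C (mgr m) (mgr n) ?G \<pi>"
    using restricts_iff[OF mgr_grading[OF left_gmod] mgr_grading[OF right_gmod] G, of \<pi>] by simp
  have "is_graded_tensor C A \<kappa> m n ?T \<pi>"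
    unfolding is_graded_tensor_def is_graded_module_def using rm G r_gr r \<pi>_gr is_tensor by simp
  then show ?thesis ..
qed

end

section \<open>The idempotent of a separable Frobenius algebra\<close>

context module_tensor
begin

text \<open>p coequalizes the two actions, so it equals \<open>s \<cdot> \<pi>\<close> for some
  \<open>s\<close>. Together with \<open>\<pi> \<cdot> p = \<pi>\<close> this makes \<open>s\<close>
  a section of \<open>\<pi>\<close>, which yields both idempotence and the image.\<close>

lemma p_mor_image:
  assumes fr: "is_frobenius C A \<Delta> \<epsilon>" and sep: "coproduct_separable C A \<Delta>"
  defines "p \<equiv> p_mor C A \<kappa> \<Delta> m n"
  shows "p \<in> homset C (m' \<otimes>\<^sub>o n') (m' \<otimes>\<^sub>o n')" "p \<cdot> p = p" "\<exists>s. is_image C p q s \<and> s \<cdot> \<pi> = p"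
proof -
  have [simp]: "\<Delta> \<in> Mor C" "Dom C \<Delta> = a" "Cod C \<Delta> = a \<otimes>\<^sub>o a"
    and fr1: "(mu A \<rhd> a) \<cdot> assoc_inv a a a \<cdot> (a \<lhd> \<Delta>) = \<Delta> \<cdot> mu A"
    and fr2: "(a \<lhd> mu A) \<cdot> Assoc C a a a \<cdot> (\<Delta> \<rhd> a) = \<Delta> \<cdot> mu A"
    using fr unfolding is_frobenius_def by auto
  have sep: "mu A \<cdot> \<Delta> = one_a"
    using sep by (simp add: coproduct_separable_def)
  let ?I = "Unit C" and ?e = "((m' \<otimes>\<^sub>o a) \<lhd> (\<Delta> \<cdot> eta A)) \<cdot> inv_mor C (Runit C (m' \<otimes>\<^sub>o a))"
  \<comment> \<open>\<open>c\<close> inserts \<Delta>(1) to the right of m, while \<open>d\<close>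
    comultiplies the factor A of m \<otimes> A. Multiplying a further factor A into \<open>c\<close>
    will produce \<open>d\<close>, whichever leg is used.\<close>
  define c where "c = assoc_inv m' a a \<cdot> (m' \<lhd> (\<Delta> \<cdot> eta A)) \<cdot> inv_mor C (Runit C m')"
  define d where "d = assoc_inv m' a a \<cdot> (m' \<lhd> \<Delta>)"
  have [simp]: "c \<in> Mor C" "Dom C c = m'" "Cod C c = (m' \<otimes>\<^sub>o a) \<otimes>\<^sub>o a"
    "d \<in> Mor C" "Dom C d = m' \<otimes>\<^sub>o a" "Cod C d = (m' \<otimes>\<^sub>o a) \<otimes>\<^sub>o a"
    by (simp_all add: c_def d_def)
  have p: "p = (act m \<otimes>\<^sub>m la n) \<cdot> Assoc C (m' \<otimes>\<^sub>o a) a n' \<cdot> (c \<rhd> n')"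
    by (simp add: p_def p_mor_def c_def)
  then show p_hom: "p \<in> homset C (m' \<otimes>\<^sub>o n') (m' \<otimes>\<^sub>o n')"
    by simp
  then have [simp]: "p \<in> Mor C" "Dom C p = m' \<otimes>\<^sub>o n'" "Cod C p = m' \<otimes>\<^sub>o n'"
    by simp_all
  \<comment> \<open>Acting with both legs of \<Delta>(1) is acting with their product, which is 1 by
    separability.\<close>
  have "act m \<cdot> (act m \<rhd> a) \<cdot> c = (act m \<cdot> (act m \<rhd> a)) \<cdot> c"
    by simp
  also have "\<dots> = act m \<cdot> (m' \<lhd> ((mu A \<cdot> \<Delta>) \<cdot> eta A)) \<cdot> inv_mor C (Runit C m')"
    unfolding act_assoc[OF left_gmod] by (simp add: c_def)
  also have "\<dots> = (act m \<cdot> (m' \<lhd> eta A)) \<cdot> inv_mor C (Runit C m')"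
    unfolding sep by (simp del: gmod_simps(5))
  finally have actc: "act m \<cdot> (act m \<rhd> a) \<cdot> c = Id C m'"
    by simp
  \<comment> \<open>Under \<pi>, the leg that acts on n may act on m instead.\<close>
  have "\<pi> \<cdot> p = (\<pi> \<cdot> (m' \<lhd> la n) \<cdot> Assoc C m' a n') \<cdot> (((act m \<rhd> a) \<cdot> c) \<rhd> n')"
    by (simp add: p)
  also have "\<dots> = \<pi> \<cdot> ((act m \<cdot> (act m \<rhd> a) \<cdot> c) \<rhd> n')"
    unfolding balanced[symmetric] by simp
  finally have \<pi>p: "\<pi> \<cdot> p = \<pi>"
    unfolding actc by simp

  \<comment> \<open>x \<Delta>(1) = \<Delta>(x), from the Frobenius law \<open>fr1\<close> and the
    right unit law. The pentagon is rearranged as \<open>penta\<close> to bring the inner brackets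
    into the form of \<open>fr1\<close>.\<close>
  have d1: "(((m' \<lhd> mu A) \<cdot> Assoc C m' a a) \<rhd> a) \<cdot>
      assoc_inv (m' \<otimes>\<^sub>o a) a a \<cdot> ?e = d"
  proof -
    let ?x = "((m' \<lhd> mu A) \<cdot> Assoc C m' a a) \<rhd> a"
    have penta: "Assoc C m' (a \<otimes>\<^sub>o a) a \<cdot> (Assoc C m' a a \<rhd> a) \<cdot> assoc_inv (m' \<otimes>\<^sub>o a) a a =
        (m' \<lhd> assoc_inv a a a) \<cdot> Assoc C m' a (a \<otimes>\<^sub>o a)"
    proof -
      have "(m' \<lhd> Assoc C a a a) \<cdot> (Assoc C m' (a \<otimes>\<^sub>o a) a \<cdot> (Assoc C m' a a \<rhd> a) \<cdot> assoc_inv (m' \<otimes>\<^sub>o a) a a)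
        = ((m' \<lhd> Assoc C a a a) \<cdot> Assoc C m' (a \<otimes>\<^sub>o a) a \<cdot> (Assoc C m' a a \<rhd> a)) \<cdot> assoc_inv (m' \<otimes>\<^sub>o a) a a"
        by simp
      also have "\<dots> = (m' \<lhd> Assoc C a a a) \<cdot> (m' \<lhd> assoc_inv a a a) \<cdot> Assoc C m' a (a \<otimes>\<^sub>o a)"
        by (subst pentagon) simp_all
      finally show ?thesis by (rule iso_cancel_left[rotated -1]) simp_all
    qed
    have "Assoc C m' a a \<cdot> ?x \<cdot> assoc_inv (m' \<otimes>\<^sub>o a) a a \<cdot> ?e =
      (m' \<lhd> (mu A \<rhd> a)) \<cdot> (Assoc C m' (a \<otimes>\<^sub>o a) a \<cdot> (Assoc C m' a a \<rhd> a) \<cdot> assoc_inv (m' \<otimes>\<^sub>o a) a a) \<cdot> ?e"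
      by simp
    also have "\<dots> = (m' \<lhd> (mu A \<rhd> a)) \<cdot> (m' \<lhd> assoc_inv a a a) \<cdot> Assoc C m' a (a \<otimes>\<^sub>o a) \<cdot> ?e"
      unfolding penta by simp
    also have "\<dots> = (m' \<lhd> (((mu A \<rhd> a) \<cdot> assoc_inv a a a \<cdot> (a \<lhd> \<Delta>)) \<cdot> (a \<lhd> eta A))) \<cdot>
       Assoc C m' a ?I \<cdot> inv_mor C (Runit C (m' \<otimes>\<^sub>o a))"
      by simp
    also have "\<dots> = (m' \<lhd> \<Delta>) \<cdot> ((m' \<lhd> Runit C a) \<cdot> Assoc C m' a ?I) \<cdot> inv_mor C (Runit C (m' \<otimes>\<^sub>o a))"
      unfolding fr1 by simp
    also have "\<dots> = m' \<lhd> \<Delta>"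
      by (subst runit_tens) simp_all
    finally have "Assoc C m' a a \<cdot> (?x \<cdot> assoc_inv (m' \<otimes>\<^sub>o a) a a \<cdot> ?e) = Assoc C m' a a \<cdot> d"
      by (simp add: d_def)
    then show ?thesis by (rule iso_cancel_left[rotated -1]) simp_all
  qed
  \<comment> \<open>\<Delta>(1) x = \<Delta>(x), from \<open>fr2\<close>; \<open>tri\<close> moves
    the inserted unit from the right of m to the left of A.\<close>
  have d2: "((m' \<otimes>\<^sub>o a) \<lhd> mu A) \<cdot> Assoc C (m' \<otimes>\<^sub>o a) a a \<cdot> (c \<rhd> a) = d"
  proof -
    let ?y = "((m' \<lhd> (\<Delta> \<cdot> eta A)) \<rhd> a) \<cdot> (inv_mor C (Runit C m') \<rhd> a)"
    have penta: "Assoc C m' a (a \<otimes>\<^sub>o a) \<cdot> Assoc C (m' \<otimes>\<^sub>o a) a a \<cdot> (assoc_inv m' a a \<rhd> a) =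
        (m' \<lhd> Assoc C a a a) \<cdot> Assoc C m' (a \<otimes>\<^sub>o a) a"
      using arg_cong[OF pentagon[of m' a a a], of "\<lambda>t. t \<cdot> (assoc_inv m' a a \<rhd> a)"] by simp
    have tri: "Assoc C m' ?I a \<cdot> (inv_mor C (Runit C m') \<rhd> a) = m' \<lhd> inv_mor C (Lunit C a)"
    proof -
      have "(m' \<lhd> Lunit C a) \<cdot> (Assoc C m' ?I a \<cdot> (inv_mor C (Runit C m') \<rhd> a)) =
         (m' \<lhd> Lunit C a) \<cdot> (m' \<lhd> inv_mor C (Lunit C a))"
        by (simp add: reassoc1[OF triangle'])
      then show ?thesis by (rule iso_cancel_left[rotated -1]) simp_all
    qed
    have "Assoc C m' a a \<cdot> (((m' \<otimes>\<^sub>o a) \<lhd> mu A) \<cdot> Assoc C (m' \<otimes>\<^sub>o a) a a \<cdot> (c \<rhd> a)) =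
      (m' \<lhd> (a \<lhd> mu A)) \<cdot> (Assoc C m' a (a \<otimes>\<^sub>o a) \<cdot> Assoc C (m' \<otimes>\<^sub>o a) a a \<cdot> (assoc_inv m' a a \<rhd> a)) \<cdot> ?y"
      by (simp add: c_def)
    also have "\<dots> = (m' \<lhd> (((a \<lhd> mu A) \<cdot> Assoc C a a a \<cdot> (\<Delta> \<rhd> a)) \<cdot> (eta A \<rhd> a))) \<cdot>
        (Assoc C m' ?I a \<cdot> (inv_mor C (Runit C m') \<rhd> a))"
      unfolding penta by simp
    also have "\<dots> = Assoc C m' a a \<cdot> d"
      unfolding fr2 tri by (simp add: d_def)
    finally show ?thesis by (rule iso_cancel_left[rotated -1]) simp_all
  qed

  \<comment> \<open>Both sides of the balancing equation are reduced to the same morphism built from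
    \<open>d\<close>: this one with \<open>d1\<close> and associativity of the right action, the
    other with \<open>d2\<close> and associativity of the left action.\<close>
  have "p \<cdot> (act m \<rhd> n') = (act m \<otimes>\<^sub>m la n) \<cdot> Assoc C (m' \<otimes>\<^sub>o a) a n' \<cdot> (d \<rhd> n')"
  proof -
    have "c \<cdot> act m = ((act m \<rhd> a) \<rhd> a) \<cdot>
       assoc_inv (m' \<otimes>\<^sub>o a) a a \<cdot> ?e" (is "_ = ?r")
    proof -
      have "inv_mor C (Runit C m') \<cdot> act m = (act m \<rhd> ?I) \<cdot> inv_mor C (Runit C (m' \<otimes>\<^sub>o a))"
        by (rule iso_cancel_left[of "Runit C m'"]) simp_all
      then have "c \<cdot> act m = (assoc_inv m' a a \<cdot> (act m \<rhd> (a \<otimes>\<^sub>o a))) \<cdot>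
          ?e"
        by (simp add: c_def del: assoc_inv_nat_id assoc_inv_nat_id_assoc)
      also have "\<dots> = ?r"
        by (subst assoc_inv_nat_id) simp_all
      finally show ?thesis .
    qed
    then have "p \<cdot> (act m \<rhd> n') = (act m \<otimes>\<^sub>m la n) \<cdot> Assoc C (m' \<otimes>\<^sub>o a) a n' \<cdot> (?r \<rhd> n')"
      by (simp add: p)
    also have "\<dots> = ((act m \<cdot> (act m \<rhd> a)) \<otimes>\<^sub>m la n) \<cdot> Assoc C ((m' \<otimes>\<^sub>o a) \<otimes>\<^sub>o a) a n' \<cdot>
       ((assoc_inv (m' \<otimes>\<^sub>o a) a a \<cdot> ?e) \<rhd> n')"
      by simp
    also have "\<dots> = (act m \<otimes>\<^sub>m la n) \<cdot> Assoc C (m' \<otimes>\<^sub>o a) a n' \<cdot> (((((m' \<lhd> mu A) \<cdot> Assoc C m' a a) \<rhd> a) \<cdot>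
      assoc_inv (m' \<otimes>\<^sub>o a) a a \<cdot> ?e) \<rhd> n')"
      unfolding act_assoc[OF left_gmod] by simp
    finally show ?thesis unfolding d1 .
  qed
  also have "\<dots> = p \<cdot> (m' \<lhd> la n) \<cdot> Assoc C m' a n'"
  proof -
    have "p \<cdot> (m' \<lhd> la n) \<cdot> Assoc C m' a n' =
      (act m \<otimes>\<^sub>m la n) \<cdot> (Assoc C (m' \<otimes>\<^sub>o a) a n' \<cdot> (((m' \<otimes>\<^sub>o a) \<otimes>\<^sub>o a) \<lhd> la n)) \<cdot> ((c \<rhd> (a \<otimes>\<^sub>o n')) \<cdot> Assoc C m' a n')"
      by (simp add: p del: assoc_nat_id assoc_nat_id_assoc)
    also have "\<dots> = (act m \<otimes>\<^sub>m (la n \<cdot> (a \<lhd> la n))) \<cdot> Assoc C (m' \<otimes>\<^sub>o a) a (a \<otimes>\<^sub>o n') \<cdot>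
        (Assoc C ((m' \<otimes>\<^sub>o a) \<otimes>\<^sub>o a) a n' \<cdot> ((c \<rhd> a) \<rhd> n'))"
      by simp
    also have "\<dots> = (act m \<otimes>\<^sub>m (la n \<cdot> (a \<lhd> la n))) \<cdot> (Assoc C (m' \<otimes>\<^sub>o a) a (a \<otimes>\<^sub>o n') \<cdot> Assoc C ((m' \<otimes>\<^sub>o a) \<otimes>\<^sub>o a) a n') \<cdot> ((c \<rhd> a) \<rhd> n')"
      by simp
    also have "\<dots> = (act m \<otimes>\<^sub>m (la n \<cdot> (a \<lhd> la n) \<cdot> Assoc C a a n')) \<cdot> Assoc C (m' \<otimes>\<^sub>o a) (a \<otimes>\<^sub>o a) n' \<cdot>
        ((Assoc C (m' \<otimes>\<^sub>o a) a a \<cdot> (c \<rhd> a)) \<rhd> n')"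
      by (subst pentagon[symmetric]) simp_all
    also have "\<dots> = (act m \<otimes>\<^sub>m la n) \<cdot> Assoc C (m' \<otimes>\<^sub>o a) a n' \<cdot>
        ((((m' \<otimes>\<^sub>o a) \<lhd> mu A) \<cdot> Assoc C (m' \<otimes>\<^sub>o a) a a \<cdot> (c \<rhd> a)) \<rhd> n')"
      unfolding left_action_assoc[OF right_gmod, symmetric] by simp
    finally show ?thesis unfolding d2 by (rule sym)
  qed
  finally have p_bal: "p \<cdot> (act m \<rhd> n') = p \<cdot> (m' \<lhd> la n) \<cdot> Assoc C m' a n'" .
  obtain s where s [simp]: "s \<in> Mor C" "Dom C s = q" "Cod C s = m' \<otimes>\<^sub>o n'" and s\<pi>: "s \<cdot> \<pi> = p"
    by (rule tensor_descend[OF _ _ p_bal]) auto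
  have \<pi>s: "\<pi> \<cdot> s = Id C q"
    by (rule tensor_epi) (simp_all add: s\<pi> \<pi>p)
  have "p \<cdot> p = s \<cdot> (\<pi> \<cdot> p)"
    by (simp flip: s\<pi>)
  then show "p \<cdot> p = p"
    by (simp add: \<pi>p s\<pi>)
  have "is_image C p q s"
    unfolding is_image_def
  proof (intro conjI allI impI)
    show "mono_mor C s"
      unfolding mono_mor_def
    proof (intro conjI ballI impI)
      fix x f g
      assume f: "f \<in> homset C x (Dom C s)" and g: "g \<in> homset C x (Dom C s)" and eq: "s \<cdot> f = s \<cdot> g"
      have "f = (\<pi> \<cdot> s) \<cdot> f" unfolding \<pi>s using f by simp
      also have "\<dots> = \<pi> \<cdot> (s \<cdot> g)" unfolding eq[symmetric] using f by simp
      also have "\<dots> = (\<pi> \<cdot> s) \<cdot> g" using g by simp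
      also have "\<dots> = g" unfolding \<pi>s using g by simp
      finally show "f = g" .
    qed simp
    show "factors_through C p s"
      unfolding factors_through_def by (rule bexI[of _ \<pi>]) (simp_all add: s\<pi>)
    fix s'
    assume "mono_mor C s' \<and> Cod C s' = Cod C p \<and> factors_through C p s'"
    then obtain g where g: "g \<in> Mor C" "Dom C g = m' \<otimes>\<^sub>o n'" "Cod C g = Dom C s'" "p = s' \<cdot> g" and s': "s' \<in> Mor C"
      by (auto simp: factors_through_def mono_mor_def)
    \<comment> \<open>As p = \<open>s' \<cdot> g\<close> fixes \<open>s\<close>, the factorization
      of p through \<open>s'\<close> restricts along \<open>s\<close>.\<close>
    have "s = (s \<cdot> \<pi>) \<cdot> s" by (simp add: \<pi>s)
    also have "\<dots> = s' \<cdot> (g \<cdot> s)" unfolding s\<pi> g(4) using g(1-3) s' by simp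
    finally show "factors_through C s s'"
      unfolding factors_through_def using g(1-3) by (intro bexI[of _ "g \<cdot> s"]) simp_all
  qed simp
  then show "\<exists>s. is_image C p q s \<and> s \<cdot> \<pi> = p" using s\<pi> by blast
qed

end

section \<open>The additive category of graded modules\<close>

context additive_linear_category
begin

lemma hom_add_assoc:
  assumes "f \<in> homset C x y" "g \<in> homset C x y" "h \<in> homset C x y"
  shows "Add C (Add C f g) h = Add C f (Add C g h)"
proof -
  interpret abelian_group "homgroup C x y" by (rule hom_abelian_group) (use assms in auto)
  show ?thesis using a_assoc[of f g h] assms by simp
qed

lemma hom_add_commute:
  assumes "f \<in> homset C x y" "g \<in> homset C x y"
  shows "Add C f g = Add C g f"
proof -
  interpret abelian_group "homgroup C x y" by (rule hom_abelian_group) (use assms in auto)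
  show ?thesis using a_comm[of f g] assms by simp
qed

text \<open>Names the additive inverse as a scalar multiple, so that graded morphisms are seen to be
  closed under it.\<close>

lemma hom_add_uminus:
  assumes "f \<in> homset C x y"
  shows "Add C (Scale C (- 1) f) f = Zero C x y"
proof -
  have "Scale C 0 f = Zero C x y"
    using idem_zero[of "Scale C 0 f"] scale_add_left[of f 0 0] assms by simp
  then show ?thesis using scale_add_left[of f "-1" 1] assms by simp
qed

lemma biproduct_simps:
  assumes "is_biproduct C s I X \<iota> p"
  shows "s \<in> Ob C" "j \<in> I \<Longrightarrow> \<iota> j \<in> Mor C" "j \<in> I \<Longrightarrow> Dom C (\<iota> j) = X j" "j \<in> I \<Longrightarrow> Cod C (\<iota> j) = s"
    "j \<in> I \<Longrightarrow> p j \<in> Mor C" "j \<in> I \<Longrightarrow> Dom C (p j) = s" "j \<in> I \<Longrightarrow> Cod C (p j) = X j" "j \<in> I \<Longrightarrow> X j \<in> Ob C"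
    "j \<in> I \<Longrightarrow> l \<in> I \<Longrightarrow> p j \<cdot> \<iota> l = (if j = l then Id C (X j) else Zero C (X l) (X j))"
    "j \<in> I \<Longrightarrow> l \<in> I \<Longrightarrow> u \<in> Mor C \<Longrightarrow> Cod C u = X l \<Longrightarrow> p j \<cdot> (\<iota> l \<cdot> u) = (if j = l then u else Zero C (Dom C u) (X j))"
proof -
  show *: "s \<in> Ob C" "j \<in> I \<Longrightarrow> \<iota> j \<in> Mor C" "j \<in> I \<Longrightarrow> Dom C (\<iota> j) = X j" "j \<in> I \<Longrightarrow> Cod C (\<iota> j) = s"
    "j \<in> I \<Longrightarrow> p j \<in> Mor C" "j \<in> I \<Longrightarrow> Dom C (p j) = s" "j \<in> I \<Longrightarrow> Cod C (p j) = X j" "j \<in> I \<Longrightarrow> X j \<in> Ob C"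
    "j \<in> I \<Longrightarrow> l \<in> I \<Longrightarrow> p j \<cdot> \<iota> l = (if j = l then Id C (X j) else Zero C (X l) (X j))" for j l
    using assms by (auto simp: is_biproduct_def)
  assume "j \<in> I" "l \<in> I" "u \<in> Mor C" "Cod C u = X l"
  then show "p j \<cdot> (\<iota> l \<cdot> u) = (if j = l then u else Zero C (Dom C u) (X j))"
    using * by (subst assoc_comp[symmetric]) (simp_all del: assoc_comp)
qed

lemma biproduct_ext:
  assumes "is_biproduct C s I X \<iota> p" "finite I" "f \<in> Mor C" "g \<in> Mor C" "Dom C f = s" "Dom C g = s" "Cod C f = Cod C g"
    "\<And>j. j \<in> I \<Longrightarrow> f \<cdot> \<iota> j = g \<cdot> \<iota> j"
  shows "f = g"
proof (rule resolves_ext[OF is_biproduct_resolves[OF assms(1,2)]])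
  fix j assume j: "j \<in> I"
  then have "f \<cdot> \<iota> j \<cdot> p j = (f \<cdot> \<iota> j) \<cdot> p j" "g \<cdot> \<iota> j \<cdot> p j = (g \<cdot> \<iota> j) \<cdot> p j"
    using biproduct_simps[OF assms(1)] assms(3-7) by simp_all
  then show "f \<cdot> \<iota> j \<cdot> p j = g \<cdot> \<iota> j \<cdot> p j" using assms(8)[OF j] by simp
qed (use assms in auto)

lemma biproduct_ext':
  assumes "is_biproduct C s I X \<iota> p" "finite I" "f \<in> Mor C" "g \<in> Mor C" "Cod C f = s" "Cod C g = s" "Dom C f = Dom C g"
    "\<And>j. j \<in> I \<Longrightarrow> p j \<cdot> f = p j \<cdot> g"
  shows "f = g"
proof (rule resolves_ext'[OF is_biproduct_resolves[OF assms(1,2)]])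
  fix j assume j: "j \<in> I"
  then show "(\<iota> j \<cdot> p j) \<cdot> f = (\<iota> j \<cdot> p j) \<cdot> g"
    using biproduct_simps[OF assms(1)] assms(3-8) by simp
qed (use assms in auto)

lemma biproduct_map:
  assumes S: "is_biproduct C s I X \<iota> p" and T: "is_biproduct C t I Y \<iota>' p'" and fin: "finite I"
    and f: "\<And>j. j \<in> I \<Longrightarrow> f j \<in> homset C (X j) (Y j)"
  obtains F where "F \<in> Mor C" "Dom C F = s" "Cod C F = t"
    "\<And>j. j \<in> I \<Longrightarrow> F \<cdot> \<iota> j = \<iota>' j \<cdot> f j" "\<And>j. j \<in> I \<Longrightarrow> p' j \<cdot> F = f j \<cdot> p j"
proof
  note s = biproduct_simps[OF S] biproduct_simps[OF T]
  note f' = f[unfolded in_homset]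
  let ?F = "hom_sum C s t (\<lambda>j. \<iota>' j \<cdot> f j \<cdot> p j) I"
  show "?F \<in> Mor C" "Dom C ?F = s" "Cod C ?F = t"
    using s f' by (auto intro!: sum_simps)
  fix j assume j: "j \<in> I"
  have "?F \<cdot> \<iota> j = hom_sum C (X j) t (\<lambda>l. (\<iota>' l \<cdot> f l \<cdot> p l) \<cdot> \<iota> j) I"
    using s f' fin j by (subst sum_comp(1)) auto
  also have "\<dots> = (if j \<in> I then \<iota>' j \<cdot> f j else Zero C (X j) t)"
    by (rule sum_delta) (use s f' fin j in auto)
  finally show "?F \<cdot> \<iota> j = \<iota>' j \<cdot> f j" using j by simp
  have "p' j \<cdot> ?F = hom_sum C s (Y j) (\<lambda>l. p' j \<cdot> (\<iota>' l \<cdot> f l \<cdot> p l)) I"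
    using s f' fin j by (subst sum_comp(2)) auto
  also have "\<dots> = (if j \<in> I then f j \<cdot> p j else Zero C s (Y j))"
    by (rule sum_delta) (use s f' fin j in auto)
  finally show "p' j \<cdot> ?F = f j \<cdot> p j" using j by simp
qed

end

context linear_monoidal_category
begin

text \<open>Additivity of the tensor product preserves the biproduct equations. This makes it
  possible to define, and to compare, actions on a direct sum summand by summand.\<close>

lemma biproduct_tens:
  assumes S: "is_biproduct C s I X \<iota> p" and fin: "finite I" and y: "y \<in> Ob C"
  shows "is_biproduct C (s \<otimes>\<^sub>o y) I (\<lambda>j. X j \<otimes>\<^sub>o y) (\<lambda>j. \<iota> j \<rhd> y) (\<lambda>j. p j \<rhd> y)"
proof -
  note s = biproduct_simps[OF S]
  have "hom_sum C (s \<otimes>\<^sub>o y) (s \<otimes>\<^sub>o y) (\<lambda>j. (\<iota> j \<rhd> y) \<cdot> (p j \<rhd> y)) I =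
    hom_sum C (s \<otimes>\<^sub>o y) (s \<otimes>\<^sub>o y) (\<lambda>j. (\<iota> j \<cdot> p j) \<rhd> y) I"
    by (rule sum_cong) (use s y in auto)
  also have "\<dots> = Id C (s \<otimes>\<^sub>o y)"
    using resolves_tens(1)[OF is_biproduct_resolves[OF S fin] y] by (simp add: resolves_def)
  finally show ?thesis
    unfolding is_biproduct_def using s y by simp
qed

end

section \<open>Graded morphisms as a linear category with direct sums\<close>

context graded_commutative_algebra
begin

abbreviation "ghom m n f \<equiv> is_graded_hom C A m n f"

lemma ghom_simps:
  assumes "ghom m n f"
  shows "f \<in> Mor C" "Dom C f = mob m" "Cod C f = mob n" "f \<cdot> act m = act n \<cdot> (f \<rhd> a)"
    and "gmod m \<Longrightarrow> gmod n \<Longrightarrow> f \<cdot> hm m i = hm n i \<cdot> f"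
    and "gmod m \<Longrightarrow> gmod n \<Longrightarrow> f \<cdot> la m = la n \<cdot> (a \<lhd> f)"
proof -
  show *: "f \<in> Mor C" "Dom C f = mob m" "Cod C f = mob n" "f \<cdot> act m = act n \<cdot> (f \<rhd> a)"
    using assms by (auto simp: is_graded_hom_def)
  show **: "f \<cdot> hm m i = hm n i \<cdot> f" if "gmod m" "gmod n" for i
    using assms that is_graded_hom_iff by blast
  show "gmod m \<Longrightarrow> gmod n \<Longrightarrow> f \<cdot> la m = la n \<cdot> (a \<lhd> f)"
    by (rule left_action_natural[OF _ _ * **])
qed

lemma ghomI:
  assumes "gmod m" "gmod n" "f \<in> Mor C" "Dom C f = mob m" "Cod C f = mob n" "f \<cdot> act m = act n \<cdot> (f \<rhd> a)"
    "\<And>i. f \<cdot> hm m i = hm n i \<cdot> f"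
  shows "ghom m n f"
  using assms is_graded_hom_iff by blast

lemma ghom_id: "gmod m \<Longrightarrow> ghom m m (Id C (mob m))"
  by (rule ghomI) simp_all

lemma ghom_comp:
  assumes "gmod m" "gmod n" "gmod p" "ghom m n f" "ghom n p g"
  shows "ghom m p (g \<cdot> f)"
proof (rule ghomI)
  note [simp] = assms(1-3) ghom_simps(1-3)[OF assms(4)] ghom_simps(1-3)[OF assms(5)]
  have "(g \<cdot> f) \<cdot> act m = (g \<cdot> act n) \<cdot> (f \<rhd> a)"
    using ghom_simps(4)[OF assms(4)] by simp
  also have "\<dots> = act p \<cdot> ((g \<cdot> f) \<rhd> a)"
    unfolding ghom_simps(4)[OF assms(5)] by simp
  finally show "(g \<cdot> f) \<cdot> act m = \<dots>" .
  fix i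
  have "(g \<cdot> f) \<cdot> hm m i = (g \<cdot> hm n i) \<cdot> f"
    using ghom_simps(5)[OF assms(4,1,2)] by simp
  also have "\<dots> = hm p i \<cdot> g \<cdot> f"
    unfolding ghom_simps(5)[OF assms(5,2,3)] by simp
  finally show "(g \<cdot> f) \<cdot> hm m i = \<dots>" .
qed (use assms ghom_simps in auto)

lemma ghom_add:
  assumes "gmod m" "gmod n" "ghom m n f" "ghom m n g"
  shows "ghom m n (Add C f g)"
  by (rule ghomI) (use assms ghom_simps[OF assms(3)] ghom_simps[OF assms(4)] in \<open>simp_all add: add_comp tens_add\<close>)

lemma ghom_zero: "gmod m \<Longrightarrow> gmod n \<Longrightarrow> ghom m n (Zero C (mob m) (mob n))"
  by (rule ghomI) simp_all

lemma ghom_scale: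
  assumes "gmod m" "gmod n" "ghom m n f"
  shows "ghom m n (Scale C c f)"
  by (rule ghomI) (use assms ghom_simps[OF assms(3)] in simp_all)

abbreviation (input) "GM \<equiv> graded_module_category C A"

lemma gm_simps [simp]:
  "Ob GM = {m. gmod m}" "Dom GM (m, f, n) = m" "Cod GM (m, f, n) = n"
  "Comp GM (n', g, p) (m, f, n) = (m, g \<cdot> f, p)" "lin_cat.Id GM m = (m, Id C (mob m), m)"
  "Add GM (m, f, n) (m', g, n') = (m, Add C f g, n)" "Zero GM m n = (m, Zero C (mob m) (mob n), n)"
  "Scale GM c (m, f, n) = (m, Scale C c f, n)"
  "(m, f, n) \<in> Mor GM \<longleftrightarrow> gmod m \<and> gmod n \<and> ghom m n f"
  by (simp_all add: graded_module_category_def)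

lemma gm_mor_cases:
  assumes "F \<in> Mor GM"
  obtains m f n where "F = (m, f, n)" "gmod m" "gmod n" "ghom m n f" "f \<in> Mor C" "Dom C f = mob m" "Cod C f = mob n"
  using assms ghom_simps(1-3) by (cases F) auto

lemma gm_hom_cases:
  assumes "F \<in> homset GM m n"
  obtains f where "F = (m, f, n)" "gmod m" "gmod n" "ghom m n f" "f \<in> Mor C" "Dom C f = mob m" "Cod C f = mob n"
  using assms ghom_simps(1-3) by (cases F) (auto simp: homset_def)

lemma gm_hom [simp]: "(m', f, n') \<in> homset GM m n \<longleftrightarrow> m' = m \<and> n' = n \<and> gmod m \<and> gmod n \<and> ghom m n f"
  by (auto simp: homset_def)

lemma gm_category: "category GM"
proof
  fix F G H and w x y z :: "('o, 'm, 'g) gr_mod"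
  show "F \<in> Mor GM \<Longrightarrow> Dom GM F \<in> Ob GM" "F \<in> Mor GM \<Longrightarrow> Cod GM F \<in> Ob GM"
    by (erule gm_mor_cases; simp)+
  show "x \<in> Ob GM \<Longrightarrow> lin_cat.Id GM x \<in> homset GM x x"
    by (simp add: ghom_id)
  show "F \<in> homset GM x y \<Longrightarrow> G \<in> homset GM y z \<Longrightarrow> Comp GM G F \<in> homset GM x z"
    by (elim gm_hom_cases) (auto intro: ghom_comp)
  show "F \<in> homset GM x y \<Longrightarrow> Comp GM (lin_cat.Id GM y) F = F"
    "F \<in> homset GM x y \<Longrightarrow> Comp GM F (lin_cat.Id GM x) = F"
    by (elim gm_hom_cases, simp)+
  show "F \<in> homset GM w x \<Longrightarrow> G \<in> homset GM x y \<Longrightarrow> H \<in> homset GM y z \<Longrightarrow>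
      Comp GM (Comp GM H G) F = Comp GM H (Comp GM G F)"
    by (elim gm_hom_cases) simp
qed

lemma gm_abelian_group:
  assumes "gmod m" "gmod n"
  shows "abelian_group (homgroup GM m n)"
proof (rule abelian_groupI)
  let ?H = "homgroup GM m n"
  have s: "carrier ?H = homset GM m n" "add ?H = Add GM" "zero ?H = Zero GM m n"
    by (simp_all add: homgroup_def)
  show "zero ?H \<in> carrier ?H" using assms by (simp add: s ghom_zero)
  fix F G H assume "F \<in> carrier ?H" "G \<in> carrier ?H" "H \<in> carrier ?H"
  then obtain f g h where F: "F = (m, f, n)" "G = (m, g, n)" "H = (m, h, n)"
    and gh: "ghom m n f" "ghom m n g" "ghom m n h"
    and h: "f \<in> homset C (mob m) (mob n)" "g \<in> homset C (mob m) (mob n)" "h \<in> homset C (mob m) (mob n)"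
    unfolding s in_homset by (elim gm_hom_cases) blast
  show "add ?H F G \<in> carrier ?H" "add ?H (add ?H F G) H = add ?H F (add ?H G H)"
      "add ?H F G = add ?H G F"
    unfolding s F using assms ghom_add[OF assms gh(1,2)] hom_add_assoc[OF h] hom_add_commute[OF h(1,2)] by simp_all
next
  let ?H = "homgroup GM m n"
  have s: "carrier ?H = homset GM m n" "add ?H = Add GM" "zero ?H = Zero GM m n"
    by (simp_all add: homgroup_def)
  fix F assume "F \<in> carrier ?H"
  then obtain f where f: "F = (m, f, n)" "ghom m n f" "f \<in> Mor C" "Dom C f = mob m" "Cod C f = mob n"
    unfolding s by (elim gm_hom_cases)
  then show "add ?H (zero ?H) F = F"
    unfolding s by simp
  show "\<exists>G \<in> carrier ?H. add ?H G F = zero ?H"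
    unfolding s using assms f
    by (intro bexI[of _ "(m, Scale C (- 1) f, n)"]) (auto intro: ghom_scale hom_add_uminus)
qed

text \<open>The two sums live in different groups, one of triples and one of morphisms. The
  comparison transfers the completeness equation of a biproduct to graded modules.\<close>

lemma gm_sum:
  assumes "gmod m" "gmod n" "finite I" "\<And>i. i \<in> I \<Longrightarrow> ghom m n (f i)"
  shows "hom_sum GM m n (\<lambda>i. (m, f i, n)) I = (m, hom_sum C (mob m) (mob n) f I, n)"
proof -
  interpret G: abelian_group "homgroup GM m n" by (rule gm_abelian_group) fact+
  interpret H: abelian_group "homgroup C (mob m) (mob n)" by (rule hom_abelian_group) (use assms in auto)
  have s: "carrier (homgroup GM m n) = homset GM m n" "add (homgroup GM m n) = Add GM"
    "zero (homgroup GM m n) = Zero GM m n"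
    by (simp_all add: homgroup_def)
  show ?thesis using assms(3,4)
  proof (induction I)
    case empty
    then show ?case by (simp add: s)
  next
    case (insert i I)
    have "hom_sum GM m n (\<lambda>i. (m, f i, n)) (insert i I) = Add GM (m, f i, n) (hom_sum GM m n (\<lambda>i. (m, f i, n)) I)"
      by (subst G.finsum_insert) (use insert assms(1,2) in \<open>auto simp: s\<close>)
    moreover have "hom_sum C (mob m) (mob n) f (insert i I) = Add C (f i) (hom_sum C (mob m) (mob n) f I)"
      by (subst H.finsum_insert) (use insert ghom_simps(1-3)[OF insert.prems] in auto)
    ultimately show ?case using insert by simp
  qed
qed

text \<open>The underlying objects and, for each degree, the parts are summed separately. Diagonal
  maps between these sums provide the grading and the action, and all laws are checked on the
  summands.\<close>

lemma gm_biproducts: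
  assumes X: "\<And>j. j \<in> I \<Longrightarrow> gmod (X j)" and fin: "finite I"
    and bip: "\<And>Y :: 'i \<Rightarrow> 'o. (\<And>j. j \<in> I \<Longrightarrow> Y j \<in> Ob C) \<Longrightarrow> \<exists>s \<iota> p. is_biproduct C s I Y \<iota> p"
  shows "\<exists>S \<iota> p. is_biproduct GM S (I :: 'i set) X \<iota> p"
proof -
  obtain s \<iota> p where S: "is_biproduct C s I (\<lambda>j. mob (X j)) \<iota> p"
    using bip[of "\<lambda>j. mob (X j)"] X by auto
  have "\<exists>t \<iota>' p'. is_biproduct C t I (\<lambda>j. part (mgr (X j)) i) \<iota>' p'" for i
    using bip[of "\<lambda>j. part (mgr (X j)) i"] grading_simps(2)[OF mgr_grading[OF X]] by auto
  then obtain t \<iota>' p' where T: "\<And>i. is_biproduct C (t i) I (\<lambda>j. part (mgr (X j)) i) (\<iota>' i) (p' i)"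
    by metis
  note gs = grading_simps(1-8,10-12)[OF mgr_grading[OF X]]
  have "\<exists>F. F \<in> Mor C \<and> Dom C F = t i \<and> Cod C F = s \<and> (\<forall>j \<in> I. F \<cdot> \<iota>' i j = \<iota> j \<cdot> incl (mgr (X j)) i) \<and>
      (\<forall>j \<in> I. p j \<cdot> F = incl (mgr (X j)) i \<cdot> p' i j)" for i
    by (rule biproduct_map[OF T[of i] S fin, of "\<lambda>j. incl (mgr (X j)) i"]) (use gs in auto)
  \<comment> \<open>The inclusion of the sum of the degree i parts into the sum of the modules acts
    on each summand as the inclusion of its degree i part; \<open>prj\<close> below arises in the
    same way.\<close>
  then obtain inc where inc [simp]: "\<And>i. inc i \<in> Mor C" "\<And>i. Dom C (inc i) = t i" "\<And>i. Cod C (inc i) = s"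
    and inc_\<iota>: "\<And>i j. j \<in> I \<Longrightarrow> inc i \<cdot> \<iota>' i j = \<iota> j \<cdot> incl (mgr (X j)) i"
    and p_inc: "\<And>i j. j \<in> I \<Longrightarrow> p j \<cdot> inc i = incl (mgr (X j)) i \<cdot> p' i j"
    by metis
  have "\<exists>F. F \<in> Mor C \<and> Dom C F = s \<and> Cod C F = t i \<and> (\<forall>j \<in> I. F \<cdot> \<iota> j = \<iota>' i j \<cdot> proj (mgr (X j)) i) \<and>
      (\<forall>j \<in> I. p' i j \<cdot> F = proj (mgr (X j)) i \<cdot> p j)" for i
    by (rule biproduct_map[OF S T[of i] fin, of "\<lambda>j. proj (mgr (X j)) i"]) (use gs in auto)
  then obtain prj where prj [simp]: "\<And>i. prj i \<in> Mor C" "\<And>i. Dom C (prj i) = s" "\<And>i. Cod C (prj i) = t i"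
    and prj_\<iota>: "\<And>i j. j \<in> I \<Longrightarrow> prj i \<cdot> \<iota> j = \<iota>' i j \<cdot> proj (mgr (X j)) i"
    and p_prj: "\<And>i j. j \<in> I \<Longrightarrow> p' i j \<cdot> prj i = proj (mgr (X j)) i \<cdot> p j"
    by metis
  note SA = biproduct_tens[OF S fin alg_simps(1)]
  \<comment> \<open>The source is decomposed by tensoring the biproduct with A, which turns the
    family of actions into one diagonal map.\<close>
  obtain r where r [simp]: "r \<in> Mor C" "Dom C r = s \<otimes>\<^sub>o a" "Cod C r = s"
    and r_\<iota>: "\<And>j. j \<in> I \<Longrightarrow> r \<cdot> (\<iota> j \<rhd> a) = \<iota> j \<cdot> act (X j)"
    and p_r: "\<And>j. j \<in> I \<Longrightarrow> p j \<cdot> r = act (X j) \<cdot> (p j \<rhd> a)"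
    by (rule biproduct_map[OF SA S fin, of "\<lambda>j. act (X j)"]) (use X in auto)
  note S_simps [simp] = biproduct_simps(1-8)[OF S]
  note T_simps [simp] = biproduct_simps(1-8)[OF T]
  note [simp] = gs X
  let ?G = "\<lparr>part = t, incl = inc, proj = prj\<rparr>"
  have "prj i \<cdot> inc l = (if i = l then Id C (t i) else Zero C (t l) (t i))" for i l
  proof (rule biproduct_ext'[OF T fin])
    fix j assume j: "j \<in> I"
    have "p' i j \<cdot> prj i \<cdot> inc l = proj (mgr (X j)) i \<cdot> p j \<cdot> inc l"
      using j p_prj[OF j, of i] by (subst reassoc[OF p_prj[OF j]]) auto
    also have "\<dots> = (proj (mgr (X j)) i \<cdot> incl (mgr (X j)) l) \<cdot> p' l j"
      using j p_inc[OF j, of l] by simp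
    also have "\<dots> = p' i j \<cdot> (if i = l then Id C (t i) else Zero C (t l) (t i))"
      using j by (simp add: grading_simps(9)[OF mgr_grading[OF X[OF j]]])
    finally show "p' i j \<cdot> prj i \<cdot> inc l = \<dots>" .
  qed simp_all
  moreover have hp_\<iota>: "(inc i \<cdot> prj i) \<cdot> \<iota> j = \<iota> j \<cdot> hm (X j) i" if j: "j \<in> I" for i j
  proof -
    have "(inc i \<cdot> prj i) \<cdot> \<iota> j = (inc i \<cdot> \<iota>' i j) \<cdot> proj (mgr (X j)) i"
      using j prj_\<iota>[OF j, of i] by simp
    then show ?thesis using j by (simp add: inc_\<iota> hp_def)
  qed
  moreover have "hom_sum C s s (\<lambda>i. inc i \<cdot> prj i) UNIV = Id C s"
  proof (rule biproduct_ext[OF S fin])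
    fix j assume j: "j \<in> I"
    have "hom_sum C s s (\<lambda>i. inc i \<cdot> prj i) UNIV \<cdot> \<iota> j = hom_sum C (mob (X j)) s (\<lambda>i. (inc i \<cdot> prj i) \<cdot> \<iota> j) UNIV" (is "?lhs = _")
      using j by (subst sum_comp(1)) auto
    also have "\<dots> = hom_sum C (mob (X j)) s (\<lambda>i. \<iota> j \<cdot> hm (X j) i) UNIV"
      unfolding hp_\<iota>[OF j] ..
    also have "\<dots> = \<iota> j \<cdot> hom_sum C (mob (X j)) (mob (X j)) (hm (X j)) UNIV"
      using j by (subst sum_comp(2)) auto
    also have "\<dots> = Id C s \<cdot> \<iota> j"
      using j mgr_resolves[OF X[OF j]] by (simp add: resolves_def)
    finally show "?lhs = \<dots>" .
  qed (auto intro!: sum_simps)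
  ultimately have G: "is_grading C s ?G"
    by (simp add: is_grading_def is_biproduct_def)
  let ?S = "\<lparr>mob = s, act = r, mgr = ?G\<rparr>"
  have hpG: "hp ?G i = inc i \<cdot> prj i" for i
    by (simp add: hp_def)
  have "r \<cdot> (r \<rhd> a) = r \<cdot> (s \<lhd> mu A) \<cdot> Assoc C s a a"
  proof (rule biproduct_ext[OF biproduct_tens[OF SA fin alg_simps(1)] fin])
    fix j assume j: "j \<in> I"
    have "(r \<cdot> (r \<rhd> a)) \<cdot> ((\<iota> j \<rhd> a) \<rhd> a) = r \<cdot> ((r \<cdot> (\<iota> j \<rhd> a)) \<rhd> a)" (is "?lhs = _")
      using j by simp
    also have "\<dots> = (r \<cdot> (\<iota> j \<rhd> a)) \<cdot> (act (X j) \<rhd> a)"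
      by (subst r_\<iota>[OF j]) (use j in simp)
    also have "\<dots> = \<iota> j \<cdot> (act (X j) \<cdot> (act (X j) \<rhd> a))"
      using j by (simp add: r_\<iota>)
    also have "\<dots> = (\<iota> j \<cdot> act (X j)) \<cdot> (mob (X j) \<lhd> mu A) \<cdot> Assoc C (mob (X j)) a a"
      using j by (simp add: act_assoc)
    also have "\<dots> = (r \<cdot> (s \<lhd> mu A) \<cdot> Assoc C s a a) \<cdot> ((\<iota> j \<rhd> a) \<rhd> a)"
      unfolding r_\<iota>[OF j, symmetric] using j by simp
    finally show "?lhs = \<dots>" .
  qed simp_all
  moreover have "r \<cdot> (s \<lhd> eta A) = Runit C s"
  proof (rule biproduct_ext[OF biproduct_tens[OF S fin unit_ob] fin])
    fix j assume j: "j \<in> I"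
    have "(r \<cdot> (s \<lhd> eta A)) \<cdot> (\<iota> j \<rhd> (Unit C)) = (r \<cdot> (\<iota> j \<rhd> a)) \<cdot> (mob (X j) \<lhd> eta A)" (is "?lhs = _")
      using j by simp
    also have "\<dots> = Runit C s \<cdot> (\<iota> j \<rhd> (Unit C))"
      unfolding r_\<iota>[OF j] using j by simp
    finally show "?lhs = \<dots>" .
  qed simp_all
  ultimately have rm: "is_right_module C A s r"
    by (simp add: is_right_module_def)
  have r_gr: "restricts C ?G (agr A) ?G r"
    unfolding restricts_iff[OF G agr_grading G r]
  proof (intro allI)
    fix i k
    show "hp ?G (i + k) \<cdot> r \<cdot> (hp ?G i \<otimes>\<^sub>m ha k) = r \<cdot> (hp ?G i \<otimes>\<^sub>m ha k)"
    proof (rule biproduct_ext[OF SA fin])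
      fix j assume j: "j \<in> I"
      have e [simp]: "hp ?G l \<in> Mor C" "Dom C (hp ?G l) = s" "Cod C (hp ?G l) = s" for l
        by (simp_all add: hpG)
      have 1: "r \<cdot> ((hp ?G i \<cdot> \<iota> j) \<otimes>\<^sub>m ha k) = \<iota> j \<cdot> (act (X j) \<cdot> (hm (X j) i \<otimes>\<^sub>m ha k))"
      proof -
        have "r \<cdot> ((hp ?G i \<cdot> \<iota> j) \<otimes>\<^sub>m ha k) = (r \<cdot> (\<iota> j \<rhd> a)) \<cdot> (hm (X j) i \<otimes>\<^sub>m ha k)"
          unfolding hpG hp_\<iota>[OF j] using j by simp
        then show ?thesis unfolding r_\<iota>[OF j] using j by simp
      qed
      have "(hp ?G (i + k) \<cdot> r \<cdot> (hp ?G i \<otimes>\<^sub>m ha k)) \<cdot> (\<iota> j \<rhd> a) = (hp ?G (i + k) \<cdot> \<iota> j) \<cdot> (act (X j) \<cdot> (hm (X j) i \<otimes>\<^sub>m ha k))" (is "?lhs = _")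
        using j 1 by simp
      also have "\<dots> = \<iota> j \<cdot> (hm (X j) (i + k) \<cdot> (act (X j) \<cdot> (hm (X j) i \<otimes>\<^sub>m ha k)))"
        unfolding hpG hp_\<iota>[OF j] using j by simp
      also have "\<dots> = (r \<cdot> (hp ?G i \<otimes>\<^sub>m ha k)) \<cdot> (\<iota> j \<rhd> a)"
        unfolding act_hp[OF X[OF j]] using j 1 by simp
      finally show "?lhs = \<dots>" .
    qed (simp_all add: hpG)
  qed
  have gS: "gmod ?S"
    unfolding is_graded_module_def using rm G r_gr by simp
  have gi: "ghom (X j) ?S (\<iota> j)" if j: "j \<in> I" for j
    by (rule ghomI[OF X[OF j] gS]) (use j r_\<iota>[OF j] hp_\<iota>[OF j] hpG in simp_all)
  have gp: "ghom ?S (X j) (p j)" if j: "j \<in> I" for j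
  proof (rule ghomI[OF gS X[OF j]])
    fix i
    have "p j \<cdot> inc i \<cdot> prj i = incl (mgr (X j)) i \<cdot> p' i j \<cdot> prj i"
      using j by (subst reassoc[OF p_inc[OF j]]) auto
    then show "p j \<cdot> hm ?S i = hm (X j) i \<cdot> p j"
      using j p_prj[OF j, of i] by (simp add: hp_def)
  qed (use j p_r[OF j] in simp_all)
  have "hom_sum GM ?S ?S (\<lambda>j. (?S, \<iota> j \<cdot> p j, ?S)) I = (?S, Id C s, ?S)"
    by (subst gm_sum[OF gS gS fin ghom_comp[OF gS X gS gp gi]]) (use S in \<open>simp_all add: is_biproduct_def\<close>)
  then have "is_biproduct GM ?S I X (\<lambda>j. (X j, \<iota> j, ?S)) (\<lambda>j. (?S, p j, X j))"
    using gS gi gp biproduct_simps(9)[OF S] by (simp add: is_biproduct_def)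
  then show ?thesis by blast
qed

lemma gm_additive: "additive_linear_category GM"
proof (intro additive_linear_category.intro gm_category additive_linear_category_axioms.intro)
  fix F G H and x y z :: "('o, 'm, 'g) gr_mod" and c d :: 'k
  show "x \<in> Ob GM \<Longrightarrow> y \<in> Ob GM \<Longrightarrow> abelian_group (homgroup GM x y)"
    by (simp add: gm_abelian_group)
  show "F \<in> homset GM x y \<Longrightarrow> Scale GM c F \<in> homset GM x y"
    by (elim gm_hom_cases) (simp add: ghom_scale)
  show "F \<in> Mor GM \<Longrightarrow> Scale GM 1 F = F" "F \<in> Mor GM \<Longrightarrow> Scale GM c (Scale GM d F) = Scale GM (c * d) F"
    "F \<in> Mor GM \<Longrightarrow> Scale GM (c + d) F = Add GM (Scale GM c F) (Scale GM d F)"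
    by (elim gm_mor_cases, simp add: scale_add_left)+
  show "F \<in> homset GM x y \<Longrightarrow> G \<in> homset GM x y \<Longrightarrow> Scale GM c (Add GM F G) = Add GM (Scale GM c F) (Scale GM c G)"
    by (elim gm_hom_cases) (simp add: scale_add_right[of _ "mob x" "mob y"])
  show "F \<in> homset GM x y \<Longrightarrow> G \<in> homset GM y z \<Longrightarrow> H \<in> homset GM y z \<Longrightarrow>
      Comp GM (Add GM G H) F = Add GM (Comp GM G F) (Comp GM H F)"
    by (elim gm_hom_cases) (simp add: add_comp)
  show "F \<in> homset GM x y \<Longrightarrow> G \<in> homset GM x y \<Longrightarrow> H \<in> homset GM y z \<Longrightarrow>
      Comp GM H (Add GM F G) = Add GM (Comp GM H F) (Comp GM H G)"
    by (elim gm_hom_cases) (simp add: add_comp)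
  show "F \<in> homset GM x y \<Longrightarrow> G \<in> homset GM y z \<Longrightarrow> Comp GM (Scale GM c G) F = Scale GM c (Comp GM G F)"
    "F \<in> homset GM x y \<Longrightarrow> G \<in> homset GM y z \<Longrightarrow> Comp GM G (Scale GM c F) = Scale GM c (Comp GM G F)"
    by (elim gm_hom_cases, simp)+
next
  fix n :: nat and X
  assume "\<And>j. j < n \<Longrightarrow> X j \<in> Ob GM"
  then show "\<exists>S \<iota> p. is_biproduct GM S {..<n} X \<iota> p"
    by (intro gm_biproducts) (auto intro: biproducts)
qed

end

section \<open>The monoidal category of graded modules\<close>

text \<open>Coequalizers and their gradings are not unique on the nose, so the monoidal structure is
  built for an arbitrary choice of objects \<open>T\<close> and projections
  \<open>P\<close>.\<close>

locale graded_tensor_choice = graded_commutative_algebra +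
  fixes T :: "('a, 'b, 'e) gr_mod \<Rightarrow> ('a, 'b, 'e) gr_mod \<Rightarrow> ('a, 'b, 'e) gr_mod"
    and P :: "('a, 'b, 'e) gr_mod \<Rightarrow> ('a, 'b, 'e) gr_mod \<Rightarrow> 'b"
  assumes choice: "is_graded_tensor_choice C A \<kappa> T P"
begin

lemma graded_tensor: "gmod m \<Longrightarrow> gmod n \<Longrightarrow> is_graded_tensor C A \<kappa> m n (T m n) (P m n)"
  using choice unfolding is_graded_tensor_choice_def by blast

lemma T_gmod [simp]: "gmod m \<Longrightarrow> gmod n \<Longrightarrow> gmod (T m n)"
  using graded_tensor unfolding is_graded_tensor_def by blast

lemma module_tensor: "gmod m \<Longrightarrow> gmod n \<Longrightarrow> module_tensor C A \<kappa> m n (mob (T m n)) (P m n)"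
  using graded_tensor unfolding is_graded_tensor_def
  by (intro module_tensor.intro module_tensor_axioms.intro graded_commutative_algebra_axioms) blast+

lemmas P_simps [simp] = module_tensor.tensor_simps(2-4)[OF module_tensor]
lemmas P_balanced = module_tensor.balanced[OF module_tensor]
lemmas P_epi = module_tensor.tensor_epi[OF module_tensor]
lemmas P_epi_right = module_tensor.tensor_epi_right[OF module_tensor]
lemmas P_epi_right2 = module_tensor.tensor_epi_right2[OF module_tensor]
lemmas P_epi_left = module_tensor.tensor_epi_left[OF module_tensor]

lemma T_act: "gmod m \<Longrightarrow> gmod n \<Longrightarrow>
    act (T m n) \<cdot> (P m n \<rhd> a) = P m n \<cdot> (mob m \<lhd> act n) \<cdot> Assoc C (mob m) (mob n) a"
  using graded_tensor unfolding is_graded_tensor_def by blast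

lemma P_restricts: "gmod m \<Longrightarrow> gmod n \<Longrightarrow> restricts C (mgr m) (mgr n) (mgr (T m n)) (P m n)"
  using graded_tensor unfolding is_graded_tensor_def by blast

lemma P_hp: "gmod m \<Longrightarrow> gmod n \<Longrightarrow>
    hm (T m n) (i + j) \<cdot> P m n \<cdot> (hm m i \<otimes>\<^sub>m hm n j) = P m n \<cdot> (hm m i \<otimes>\<^sub>m hm n j)"
  using restricts_iff[OF mgr_grading mgr_grading mgr_grading, of m n "T m n" "P m n"] P_restricts by simp

text \<open>The projectors of the grading on \<open>T m n\<close> are thereby determined through
  \<open>P\<close>, which is how gradedness of maps out of \<open>T m n\<close> is verified.\<close>

lemma T_hp:
  assumes m: "gmod m" and n: "gmod n"
  shows "hm (T m n) k \<cdot> P m n \<cdot> (hm m i \<otimes>\<^sub>m hm n j) =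
    (if k = i + j then P m n \<cdot> (hm m i \<otimes>\<^sub>m hm n j) else Zero C (mob m \<otimes>\<^sub>o mob n) (mob (T m n)))"
proof -
  note [simp] = m n
  have "hm (T m n) k \<cdot> P m n \<cdot> (hm m i \<otimes>\<^sub>m hm n j) = hm (T m n) k \<cdot> hm (T m n) (i + j) \<cdot> P m n \<cdot> (hm m i \<otimes>\<^sub>m hm n j)"
    by (simp add: P_hp)
  also have "\<dots> = (if k = i + j then hm (T m n) k \<cdot> P m n \<cdot> (hm m i \<otimes>\<^sub>m hm n j) else Zero C (mob m \<otimes>\<^sub>o mob n) (mob (T m n)))"
    by (subst hp_cancel[OF mgr_grading[OF T_gmod[OF m n]]]) simp_all
  finally show ?thesis by (cases "k = i + j") (simp_all add: P_hp)
qed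

text \<open>A is carried past m and past n and then acts on n from the right, which amounts to
  acting on n from the left after passing m alone. Balancing moves this action over to m, where it
  is the left action of m.\<close>

lemma T_left_action:
  assumes m: "gmod m" and n: "gmod n"
  shows "la (T m n) \<cdot> (a \<lhd> P m n) \<cdot> Assoc C a (mob m) (mob n) = P m n \<cdot> (la m \<rhd> mob n)"
proof -
  let ?m = "mob m" and ?n = "mob n"
  note [simp] = m n
  have "la (T m n) \<cdot> (a \<lhd> P m n) \<cdot> Assoc C a ?m ?n = (act (T m n) \<cdot> (P m n \<rhd> a)) \<cdot>
    assoc_inv ?m ?n a \<cdot> (?m \<lhd> twisted_braid ?n (mgr n)) \<cdot> Assoc C ?m a ?n \<cdot> (twisted_braid ?m (mgr m) \<rhd> ?n)"
    by (subst left_action_tens[OF mgr_grading[OF m] mgr_grading[OF n] T_gmod[OF m n] _ _ _ P_restricts]) simp_all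
  also have "\<dots> = (P m n \<cdot> (?m \<lhd> la n) \<cdot> Assoc C ?m a ?n) \<cdot> (twisted_braid ?m (mgr m) \<rhd> ?n)"
    unfolding T_act[OF m n] by (simp add: left_action_eq)
  also have "\<dots> = P m n \<cdot> (la m \<rhd> ?n)"
    unfolding P_balanced[OF m n, symmetric] by (simp add: left_action_eq)
  finally show ?thesis .
qed

text \<open>The universal property of \<open>T m n\<close> among graded modules. Linearity of the
  induced map is checked after the cancellable \<open>P m n \<rhd> a\<close>, and gradedness on
  pairs of homogeneous projectors after \<open>P m n\<close>.\<close>

lemma induced:
  assumes m: "gmod m" and n: "gmod n" and z: "gmod z"
    and h: "h \<in> Mor C" "Dom C h = mob m \<otimes>\<^sub>o mob n" "Cod C h = mob z"
    and bal: "h \<cdot> (act m \<rhd> mob n) = h \<cdot> (mob m \<lhd> la n) \<cdot> Assoc C (mob m) a (mob n)"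
    and lin: "h \<cdot> (mob m \<lhd> act n) \<cdot> Assoc C (mob m) (mob n) a = act z \<cdot> (h \<rhd> a)"
    and gr: "\<And>i j. hm z (i + j) \<cdot> h \<cdot> (hm m i \<otimes>\<^sub>m hm n j) = h \<cdot> (hm m i \<otimes>\<^sub>m hm n j)"
  obtains u where "ghom (T m n) z u" "u \<cdot> P m n = h"
proof (rule module_tensor.tensor_descend[OF module_tensor[OF m n] h(1,2) bal])
  note [simp] = m n z h
  fix u
  assume u [simp]: "u \<in> Mor C" "Dom C u = mob (T m n)" "Cod C u = Cod C h" and uP: "u \<cdot> P m n = h"
  have "ghom (T m n) z u"
  proof (rule ghomI)
    show "u \<cdot> act (T m n) = act z \<cdot> (u \<rhd> a)"
    proof (rule P_epi_right[OF m n, where z = a])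
      have "(u \<cdot> act (T m n)) \<cdot> (P m n \<rhd> a) = u \<cdot> (act (T m n) \<cdot> (P m n \<rhd> a))" by simp
      also have "\<dots> = (u \<cdot> P m n) \<cdot> (mob m \<lhd> act n) \<cdot> Assoc C (mob m) (mob n) a"
        unfolding T_act[OF m n] by simp
      also have "\<dots> = act z \<cdot> ((u \<cdot> P m n) \<rhd> a)"
        unfolding uP lin ..
      finally show "(u \<cdot> act (T m n)) \<cdot> (P m n \<rhd> a) = (act z \<cdot> (u \<rhd> a)) \<cdot> (P m n \<rhd> a)" by simp
    qed simp_all
    fix k
    show "u \<cdot> hm (T m n) k = hm z k \<cdot> u"
    proof (rule P_epi[OF m n])
      show "(u \<cdot> hm (T m n) k) \<cdot> P m n = (hm z k \<cdot> u) \<cdot> P m n"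
      proof (rule resolves_ext2[OF mgr_resolves[OF m] mgr_resolves[OF n]])
        fix i j
        have "((u \<cdot> hm (T m n) k) \<cdot> P m n) \<cdot> (hm m i \<otimes>\<^sub>m hm n j) = u \<cdot> (hm (T m n) k \<cdot> P m n \<cdot> (hm m i \<otimes>\<^sub>m hm n j))"
          by simp
        also have "\<dots> = (if k = i + j then (u \<cdot> P m n) \<cdot> (hm m i \<otimes>\<^sub>m hm n j) else Zero C (mob m \<otimes>\<^sub>o mob n) (mob z))"
          unfolding T_hp[OF m n] by simp
        also have "\<dots> = hm z k \<cdot> (hm z (i + j) \<cdot> (h \<cdot> (hm m i \<otimes>\<^sub>m hm n j)))"
          unfolding uP by (subst hp_cancel[OF mgr_grading[OF z]]) (simp_all add: gr)
        also have "\<dots> = hm z k \<cdot> (u \<cdot> P m n) \<cdot> (hm m i \<otimes>\<^sub>m hm n j)"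
          unfolding uP by (simp add: gr)
        finally show "((u \<cdot> hm (T m n) k) \<cdot> P m n) \<cdot> (hm m i \<otimes>\<^sub>m hm n j) = ((hm z k \<cdot> u) \<cdot> P m n) \<cdot> (hm m i \<otimes>\<^sub>m hm n j)"
          by simp
      qed simp_all
    qed simp_all
  qed simp_all
  then show thesis using that uP by blast
qed

text \<open>Structure morphisms may thus be inverted in the underlying category without examining
  the grading or the action of the inverse.\<close>

lemma ghom_inverse:
  assumes "gmod m" "gmod n" "ghom m n f" and g: "g \<in> Mor C" "Dom C g = mob n" "Cod C g = mob m"
    "g \<cdot> f = Id C (mob m)" "f \<cdot> g = Id C (mob n)"
  shows "ghom n m g"
proof (rule ghomI)
  note f [simp] = ghom_simps(1-3)[OF assms(3)] assms(1,2) g(1-3)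
  have "g \<cdot> act n = g \<cdot> act n \<cdot> ((f \<cdot> g) \<rhd> a)" unfolding g by simp
  also have "\<dots> = g \<cdot> (act n \<cdot> (f \<rhd> a)) \<cdot> (g \<rhd> a)" by simp
  also have "\<dots> = (g \<cdot> f) \<cdot> act m \<cdot> (g \<rhd> a)"
    unfolding ghom_simps(4)[OF assms(3), symmetric] by simp
  finally show "g \<cdot> act n = act m \<cdot> (g \<rhd> a)" unfolding g(4) by simp
  fix i
  have "g \<cdot> hm n i = g \<cdot> (hm n i \<cdot> f) \<cdot> g" using g(5) by simp
  also have "\<dots> = (g \<cdot> f) \<cdot> hm m i \<cdot> g"
    unfolding ghom_simps(5)[OF assms(3,1,2), symmetric] by simp
  finally show "g \<cdot> hm n i = hm m i \<cdot> g" unfolding g(4) by simp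
qed (use assms in simp_all)

text \<open>f \<otimes> g is compatible with balancing because \<open>f\<close> respects right
  actions and \<open>g\<close>, being graded, also respects left actions.\<close>

lemma tens_map_ex:
  assumes "gmod m" "gmod n" "gmod m'" "gmod n'" "ghom m n f" "ghom m' n' g"
  shows "\<exists>u. ghom (T m m') (T n n') u \<and> u \<cdot> P m m' = P n n' \<cdot> (f \<otimes>\<^sub>m g)"
proof -
  note [simp] = assms(1-4) ghom_simps(1-3)[OF assms(5)] ghom_simps(1-3)[OF assms(6)]
  note f = ghom_simps(4-6)[OF assms(5)] note g = ghom_simps(4-6)[OF assms(6)]
  let ?h = "P n n' \<cdot> (f \<otimes>\<^sub>m g)"
  have 1: "?h \<cdot> (act m \<rhd> mob m') = ?h \<cdot> (mob m \<lhd> la m') \<cdot> Assoc C (mob m) a (mob m')"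
  proof -
    have "?h \<cdot> (act m \<rhd> mob m') = (P n n' \<cdot> (act n \<rhd> mob n')) \<cdot> ((f \<rhd> a) \<otimes>\<^sub>m g)"
      by (simp add: f)
    also have "\<dots> = P n n' \<cdot> (f \<otimes>\<^sub>m (la n' \<cdot> (a \<lhd> g))) \<cdot> Assoc C (mob m) a (mob m')"
      by (subst P_balanced) simp_all
    also have "\<dots> = P n n' \<cdot> (f \<otimes>\<^sub>m (g \<cdot> la m')) \<cdot> Assoc C (mob m) a (mob m')"
      by (simp add: g)
    finally show ?thesis by simp
  qed
  have 2: "?h \<cdot> (mob m \<lhd> act m') \<cdot> Assoc C (mob m) (mob m') a = act (T n n') \<cdot> (?h \<rhd> a)"
  proof -
    have "act (T n n') \<cdot> (?h \<rhd> a) = (act (T n n') \<cdot> (P n n' \<rhd> a)) \<cdot> ((f \<otimes>\<^sub>m g) \<rhd> a)"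
      by simp
    also have "\<dots> = P n n' \<cdot> (f \<otimes>\<^sub>m (act n' \<cdot> (g \<rhd> a))) \<cdot> Assoc C (mob m) (mob m') a"
      by (subst T_act) simp_all
    finally show ?thesis by (simp flip: g(1))
  qed
  have 3: "hm (T n n') (i + j) \<cdot> ?h \<cdot> (hm m i \<otimes>\<^sub>m hm m' j) = ?h \<cdot> (hm m i \<otimes>\<^sub>m hm m' j)" for i j
  proof -
    have *: "?h \<cdot> (hm m i \<otimes>\<^sub>m hm m' j) = P n n' \<cdot> (hm n i \<otimes>\<^sub>m hm n' j) \<cdot> (f \<otimes>\<^sub>m g)"
      by (simp add: f g)
    have "hm (T n n') (i + j) \<cdot> P n n' \<cdot> (hm n i \<otimes>\<^sub>m hm n' j) \<cdot> (f \<otimes>\<^sub>m g) =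
      (hm (T n n') (i + j) \<cdot> P n n' \<cdot> (hm n i \<otimes>\<^sub>m hm n' j)) \<cdot> (f \<otimes>\<^sub>m g)" by simp
    then show ?thesis unfolding * P_hp[OF assms(2,4)] by simp
  qed
  obtain u where "ghom (T m m') (T n n') u" "u \<cdot> P m m' = ?h"
    by (rule induced[OF assms(1,3) T_gmod[OF assms(2,4)] _ _ _ 1 2 3]) auto
  then show ?thesis by blast
qed

lemma lunit_map_ex:
  assumes m: "gmod m"
  shows "\<exists>u v. ghom (T (regular_module A) m) m u \<and> u \<cdot> P (regular_module A) m = la m \<and>
    v \<in> Mor C \<and> Dom C v = mob m \<and> Cod C v = mob (T (regular_module A) m) \<and>
    v \<cdot> u = Id C (mob (T (regular_module A) m)) \<and> u \<cdot> v = Id C (mob m)"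
proof -
  let ?R = "regular_module A" and ?m = "mob m"
  note [simp] = m P_simps[OF gmod_regular m, simplified]
  obtain u where u: "ghom (T ?R m) m u" and uP: "u \<cdot> P ?R m = la m"
  proof (rule induced[OF gmod_regular m m, of "la m"])
    show "hm m (i + j) \<cdot> la m \<cdot> (hm ?R i \<otimes>\<^sub>m hm m j) = la m \<cdot> (hm ?R i \<otimes>\<^sub>m hm m j)" for i j
      using left_action_restricts[OF m] restricts_iff[OF agr_grading mgr_grading[OF m] mgr_grading[OF m] la_simps[OF m]] by simp
  qed (simp_all add: left_action_assoc left_right_action)
  note [simp] = ghom_simps(1-3)[OF u]
  \<comment> \<open>The inverse of the unitor sends x to 1 \<otimes> x.\<close>
  let ?v = "P ?R m \<cdot> (eta A \<rhd> ?m) \<cdot> inv_mor C (Lunit C ?m)"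
  have "u \<cdot> ?v = la m \<cdot> (eta A \<rhd> ?m) \<cdot> inv_mor C (Lunit C ?m)"
    by (simp add: reassoc1[OF uP])
  then have uv: "u \<cdot> ?v = Id C ?m"
    by (simp add: left_action_unit reassoc1[OF left_action_unit])
  \<comment> \<open>In elements: b \<otimes> x is sent to 1 \<otimes> b x, which balancing
    identifies with 1 b \<otimes> x.\<close>
  have "?v \<cdot> u = Id C (mob (T ?R m))"
  proof (rule P_epi[OF gmod_regular m])
    have nat: "inv_mor C (Lunit C ?m) \<cdot> la m = ((Unit C) \<lhd> la m) \<cdot> inv_mor C (Lunit C (a \<otimes>\<^sub>o ?m))"
      by (rule iso_cancel_left[of "Lunit C ?m"]) simp_all
    have bal: "P ?R m \<cdot> (a \<lhd> la m) = P ?R m \<cdot> (mu A \<rhd> ?m) \<cdot> assoc_inv a a ?m"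
      using arg_cong[OF P_balanced[OF gmod_regular m], of "\<lambda>t. t \<cdot> assoc_inv a a ?m"] by simp
    have "(?v \<cdot> u) \<cdot> P ?R m = P ?R m \<cdot> (eta A \<rhd> ?m) \<cdot> (inv_mor C (Lunit C ?m) \<cdot> la m)"
      using uP by simp
    also have "\<dots> = (P ?R m \<cdot> (a \<lhd> la m)) \<cdot> (eta A \<rhd> (a \<otimes>\<^sub>o ?m)) \<cdot> inv_mor C (Lunit C (a \<otimes>\<^sub>o ?m))"
      unfolding nat by simp
    also have "\<dots> = P ?R m \<cdot> (Lunit C a \<rhd> ?m) \<cdot> assoc_inv (Unit C) a ?m \<cdot> inv_mor C (Lunit C (a \<otimes>\<^sub>o ?m))"
      unfolding bal by simp
    also have "\<dots> = Id C (mob (T ?R m)) \<cdot> P ?R m"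
      by (simp flip: lunit_tens)
    finally show "(?v \<cdot> u) \<cdot> P ?R m = \<dots>" .
  qed simp_all
  then show ?thesis using u uP uv by (intro exI[of _ u] exI[of _ ?v]) simp
qed

text \<open>The inverse sends x to x \<otimes> 1; balancing identifies x b \<otimes> 1 with x
  \<otimes> b.\<close>

lemma runit_map_ex:
  assumes m: "gmod m"
  shows "\<exists>u v. ghom (T m (regular_module A)) m u \<and> u \<cdot> P m (regular_module A) = act m \<and>
    v \<in> Mor C \<and> Dom C v = mob m \<and> Cod C v = mob (T m (regular_module A)) \<and>
    v \<cdot> u = Id C (mob (T m (regular_module A))) \<and> u \<cdot> v = Id C (mob m)"
proof -
  let ?R = "regular_module A" and ?m = "mob m"
  note [simp] = m P_simps[OF m gmod_regular, simplified]
  obtain u where u: "ghom (T m ?R) m u" and uP: "u \<cdot> P m ?R = act m"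
  proof (rule induced[OF m gmod_regular m, of "act m"])
    show "hm m (i + j) \<cdot> act m \<cdot> (hm m i \<otimes>\<^sub>m hm ?R j) = act m \<cdot> (hm m i \<otimes>\<^sub>m hm ?R j)" for i j
      using act_hp[OF m] by simp
  qed (simp_all add: act_assoc)
  note [simp] = ghom_simps(1-3)[OF u]
  let ?v = "P m ?R \<cdot> (?m \<lhd> eta A) \<cdot> inv_mor C (Runit C ?m)"
  have "u \<cdot> ?v = act m \<cdot> (?m \<lhd> eta A) \<cdot> inv_mor C (Runit C ?m)"
    by (simp add: reassoc1[OF uP])
  then have uv: "u \<cdot> ?v = Id C ?m"
    by (simp add: reassoc1[OF gmod_simps(5)])
  have "?v \<cdot> u = Id C (mob (T m ?R))"
  proof (rule P_epi[OF m gmod_regular])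
    have nat: "inv_mor C (Runit C ?m) \<cdot> act m = (act m \<rhd> (Unit C)) \<cdot> inv_mor C (Runit C (?m \<otimes>\<^sub>o a))"
      by (rule iso_cancel_left[of "Runit C ?m"]) simp_all
    have bal: "P m ?R \<cdot> (act m \<rhd> a) = P m ?R \<cdot> (?m \<lhd> mu A) \<cdot> Assoc C ?m a a"
      using P_balanced[OF m gmod_regular] by simp
    have "(?v \<cdot> u) \<cdot> P m ?R = P m ?R \<cdot> (?m \<lhd> eta A) \<cdot> (inv_mor C (Runit C ?m) \<cdot> act m)"
      using uP by simp
    also have "\<dots> = (P m ?R \<cdot> (act m \<rhd> a)) \<cdot> ((?m \<otimes>\<^sub>o a) \<lhd> eta A) \<cdot> inv_mor C (Runit C (?m \<otimes>\<^sub>o a))"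
      unfolding nat by simp
    also have "\<dots> = P m ?R \<cdot> ((?m \<lhd> Runit C a) \<cdot> Assoc C ?m a (Unit C)) \<cdot> inv_mor C (Runit C (?m \<otimes>\<^sub>o a))"
      unfolding bal by simp
    also have "\<dots> = Id C (mob (T m ?R)) \<cdot> P m ?R"
      by (subst runit_tens) simp_all
    finally show "(?v \<cdot> u) \<cdot> P m ?R = \<dots>" .
  qed simp_all
  then show ?thesis using u uP uv by (intro exI[of _ u] exI[of _ ?v]) simp
qed

text \<open>The associator descends first along \<open>P m n \<rhd> mob p\<close> and then along
  \<open>P (T m n) p\<close>. Its inverse descends first along \<open>mob m \<lhd> P n p\<close> and
  then along \<open>P m (T n p)\<close>. Both composites are identities because the projections can
  be cancelled.\<close>

lemma assoc_map_ex:
  assumes m: "gmod m" and n: "gmod n" and p: "gmod p"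
  shows "\<exists>u v. ghom (T (T m n) p) (T m (T n p)) u \<and>
    u \<cdot> P (T m n) p \<cdot> (P m n \<rhd> mob p) =
      P m (T n p) \<cdot> (mob m \<lhd> P n p) \<cdot> Assoc C (mob m) (mob n) (mob p) \<and>
    v \<in> Mor C \<and> Dom C v = mob (T m (T n p)) \<and> Cod C v = mob (T (T m n) p) \<and>
    v \<cdot> u = Id C (mob (T (T m n) p)) \<and> u \<cdot> v = Id C (mob (T m (T n p)))"
proof -
  let ?m = "mob m" and ?n = "mob n" and ?p = "mob p" and ?T = "T m n" and ?S = "T n p" and ?z = "T m (T n p)"
    and ?y = "T (T m n) p"
  note [simp] = m n p
  let ?h = "P m ?S \<cdot> (?m \<lhd> P n p) \<cdot> Assoc C ?m ?n ?p"
  have "?h \<cdot> ((act m \<rhd> ?n) \<rhd> ?p) = (P m ?S \<cdot> (act m \<rhd> mob ?S)) \<cdot> ((?m \<otimes>\<^sub>o a) \<lhd> P n p) \<cdot> Assoc C (?m \<otimes>\<^sub>o a) ?n ?p"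
    by simp
  also have "\<dots> = P m ?S \<cdot> (?m \<lhd> la ?S) \<cdot> Assoc C ?m a (mob ?S) \<cdot> ((?m \<otimes>\<^sub>o a) \<lhd> P n p) \<cdot> Assoc C (?m \<otimes>\<^sub>o a) ?n ?p"
    by (subst P_balanced) simp_all
  also have "\<dots> = P m ?S \<cdot> (?m \<lhd> (la ?S \<cdot> (a \<lhd> P n p) \<cdot> Assoc C a ?n ?p)) \<cdot> Assoc C ?m (a \<otimes>\<^sub>o ?n) ?p \<cdot> (Assoc C ?m a ?n \<rhd> ?p)"
    by (subst head_tens) simp_all
  \<comment> \<open>Balancing over m and \<open>T n p\<close> produces the left action on
    \<open>T n p\<close>, which is the one induced from n.\<close>
  also have "\<dots> = ?h \<cdot> (((?m \<lhd> la n) \<cdot> Assoc C ?m a ?n) \<rhd> ?p)"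
    unfolding T_left_action[OF n p] by simp
  finally have h_bal: "?h \<cdot> ((act m \<rhd> ?n) \<rhd> ?p) = ?h \<cdot> (((?m \<lhd> la n) \<cdot> Assoc C ?m a ?n) \<rhd> ?p)" .
  obtain h where h [simp]: "h \<in> Mor C" "Dom C h = mob ?T \<otimes>\<^sub>o ?p" "Cod C h = mob ?z" and hP: "h \<cdot> (P m n \<rhd> ?p) = ?h"
    by (rule module_tensor.tensor_descend_right[OF module_tensor[OF m n] _ _ _ h_bal]) auto
  have h1: "h \<cdot> (act ?T \<rhd> ?p) = h \<cdot> (mob ?T \<lhd> la p) \<cdot> Assoc C (mob ?T) a ?p"
  proof (rule P_epi_right2[OF m n, of _ _ a ?p])
    have "(h \<cdot> (act ?T \<rhd> ?p)) \<cdot> ((P m n \<rhd> a) \<rhd> ?p) = h \<cdot> ((act ?T \<cdot> (P m n \<rhd> a)) \<rhd> ?p)" (is "?lhs = _")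
      by simp
    also have "\<dots> = (h \<cdot> (P m n \<rhd> ?p)) \<cdot> (((?m \<lhd> act n) \<cdot> Assoc C ?m ?n a) \<rhd> ?p)"
      unfolding T_act[OF m n] by simp
    also have "\<dots> = P m ?S \<cdot> (?m \<lhd> (P n p \<cdot> (act n \<rhd> ?p))) \<cdot> Assoc C ?m (?n \<otimes>\<^sub>o a) ?p \<cdot> (Assoc C ?m ?n a \<rhd> ?p)"
      unfolding hP by simp
    also have "\<dots> = P m ?S \<cdot> (?m \<lhd> P n p) \<cdot> Assoc C ?m ?n ?p \<cdot> ((?m \<otimes>\<^sub>o ?n) \<lhd> la p) \<cdot> Assoc C (?m \<otimes>\<^sub>o ?n) a ?p"
      unfolding P_balanced[OF n p] by (subst head_tens) simp_all
    also have "\<dots> = (h \<cdot> (P m n \<rhd> ?p)) \<cdot> ((?m \<otimes>\<^sub>o ?n) \<lhd> la p) \<cdot> Assoc C (?m \<otimes>\<^sub>o ?n) a ?p"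
      unfolding hP by simp
    also have "\<dots> = (h \<cdot> (mob ?T \<lhd> la p) \<cdot> Assoc C (mob ?T) a ?p) \<cdot> ((P m n \<rhd> a) \<rhd> ?p)"
      by simp
    finally show "?lhs = \<dots>" .
  qed simp_all
  have h2: "h \<cdot> (mob ?T \<lhd> act p) \<cdot> Assoc C (mob ?T) ?p a = act ?z \<cdot> (h \<rhd> a)"
  proof (rule P_epi_right2[OF m n, of _ _ ?p a])
    have "(act ?z \<cdot> (h \<rhd> a)) \<cdot> ((P m n \<rhd> ?p) \<rhd> a) = act ?z \<cdot> ((h \<cdot> (P m n \<rhd> ?p)) \<rhd> a)"
      by simp
    also have "\<dots> = (act ?z \<cdot> (P m ?S \<rhd> a)) \<cdot> (((?m \<lhd> P n p) \<cdot> Assoc C ?m ?n ?p) \<rhd> a)"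
      unfolding hP by simp
    also have "\<dots> = P m ?S \<cdot> (?m \<lhd> (act ?S \<cdot> (P n p \<rhd> a))) \<cdot> Assoc C ?m (?n \<otimes>\<^sub>o ?p) a \<cdot> (Assoc C ?m ?n ?p \<rhd> a)"
      by (subst T_act) simp_all
    also have "\<dots> = P m ?S \<cdot> (?m \<lhd> P n p) \<cdot> Assoc C ?m ?n ?p \<cdot> ((?m \<otimes>\<^sub>o ?n) \<lhd> act p) \<cdot> Assoc C (?m \<otimes>\<^sub>o ?n) ?p a"
      unfolding T_act[OF n p] by (subst head_tens) simp_all
    also have "\<dots> = (h \<cdot> (P m n \<rhd> ?p)) \<cdot> ((?m \<otimes>\<^sub>o ?n) \<lhd> act p) \<cdot> Assoc C (?m \<otimes>\<^sub>o ?n) ?p a"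
      unfolding hP by simp
    also have "\<dots> = (h \<cdot> (mob ?T \<lhd> act p) \<cdot> Assoc C (mob ?T) ?p a) \<cdot> ((P m n \<rhd> ?p) \<rhd> a)"
      by simp
    finally show "(h \<cdot> (mob ?T \<lhd> act p) \<cdot> Assoc C (mob ?T) ?p a) \<cdot> ((P m n \<rhd> ?p) \<rhd> a) =
       (act ?z \<cdot> (h \<rhd> a)) \<cdot> ((P m n \<rhd> ?p) \<rhd> a)" by (rule sym)
  qed simp_all
  have h3: "hm ?z (i + j) \<cdot> h \<cdot> (hm ?T i \<otimes>\<^sub>m hm p j) = h \<cdot> (hm ?T i \<otimes>\<^sub>m hm p j)" for i j
  proof (rule P_epi_right[OF m n, of _ _ ?p])
    show "(hm ?z (i + j) \<cdot> h \<cdot> (hm ?T i \<otimes>\<^sub>m hm p j)) \<cdot> (P m n \<rhd> ?p) = (h \<cdot> (hm ?T i \<otimes>\<^sub>m hm p j)) \<cdot> (P m n \<rhd> ?p)"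
    proof (rule resolves_ext3[OF mgr_resolves[OF m] mgr_resolves[OF n] mgr_resolves[OF p]])
      fix x y z
      let ?e = "(hm m x \<otimes>\<^sub>m hm n y) \<otimes>\<^sub>m hm p z"
      have 1: "h \<cdot> (hm ?T i \<otimes>\<^sub>m hm p j) \<cdot> (P m n \<rhd> ?p) \<cdot> ?e =
        (if i = x + y \<and> j = z then ?h \<cdot> ?e else Zero C ((?m \<otimes>\<^sub>o ?n) \<otimes>\<^sub>o ?p) (mob ?z))"
      proof -
        have "h \<cdot> (hm ?T i \<otimes>\<^sub>m hm p j) \<cdot> (P m n \<rhd> ?p) \<cdot> ?e =
          h \<cdot> ((hm ?T i \<cdot> P m n \<cdot> (hm m x \<otimes>\<^sub>m hm n y)) \<otimes>\<^sub>m (hm p j \<cdot> hm p z))"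
          by simp
        also have "\<dots> = (if i = x + y \<and> j = z then (h \<cdot> (P m n \<rhd> ?p)) \<cdot> ?e else Zero C ((?m \<otimes>\<^sub>o ?n) \<otimes>\<^sub>o ?p) (mob ?z))"
          unfolding T_hp[OF m n] grading_simps(13)[OF mgr_grading[OF p]] by simp
        finally show ?thesis unfolding hP .
      qed
      have 2: "hm ?z (x + y + z) \<cdot> ?h \<cdot> ?e = ?h \<cdot> ?e"
      proof -
        have "?h \<cdot> ?e = P m ?S \<cdot> (hm m x \<otimes>\<^sub>m (P n p \<cdot> (hm n y \<otimes>\<^sub>m hm p z))) \<cdot> Assoc C ?m ?n ?p"
          by simp
        also have "\<dots> = P m ?S \<cdot> (hm m x \<otimes>\<^sub>m (hm ?S (y + z) \<cdot> P n p \<cdot> (hm n y \<otimes>\<^sub>m hm p z))) \<cdot> Assoc C ?m ?n ?p"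
          unfolding P_hp[OF n p] ..
        also have "\<dots> = (P m ?S \<cdot> (hm m x \<otimes>\<^sub>m hm ?S (y + z))) \<cdot> (?m \<lhd> (P n p \<cdot> (hm n y \<otimes>\<^sub>m hm p z))) \<cdot> Assoc C ?m ?n ?p"
          by simp
        finally have *: "?h \<cdot> ?e = \<dots>" .
        have "hm ?z (x + (y + z)) \<cdot> (?h \<cdot> ?e) = (hm ?z (x + (y + z)) \<cdot> P m ?S \<cdot> (hm m x \<otimes>\<^sub>m hm ?S (y + z))) \<cdot> (?m \<lhd> (P n p \<cdot> (hm n y \<otimes>\<^sub>m hm p z))) \<cdot> Assoc C ?m ?n ?p"
          unfolding * by simp
        also have "\<dots> = ?h \<cdot> ?e"
          unfolding P_hp[OF m T_gmod[OF n p]] * ..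
        finally show ?thesis by (simp add: add.assoc)
      qed
      have "((hm ?z (i + j) \<cdot> h \<cdot> (hm ?T i \<otimes>\<^sub>m hm p j)) \<cdot> (P m n \<rhd> ?p)) \<cdot> ?e =
        hm ?z (i + j) \<cdot> (h \<cdot> (hm ?T i \<otimes>\<^sub>m hm p j) \<cdot> (P m n \<rhd> ?p) \<cdot> ?e)" by simp
      also have "\<dots> = h \<cdot> (hm ?T i \<otimes>\<^sub>m hm p j) \<cdot> (P m n \<rhd> ?p) \<cdot> ?e"
        unfolding 1 using 2 by simp
      finally show "((hm ?z (i + j) \<cdot> h \<cdot> (hm ?T i \<otimes>\<^sub>m hm p j)) \<cdot> (P m n \<rhd> ?p)) \<cdot> ?e =
        ((h \<cdot> (hm ?T i \<otimes>\<^sub>m hm p j)) \<cdot> (P m n \<rhd> ?p)) \<cdot> ?e" by simp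
    qed simp_all
  qed simp_all
  obtain u where u: "ghom ?y ?z u" and uP: "u \<cdot> P ?T p = h"
    by (rule induced[OF T_gmod[OF m n] p T_gmod[OF m T_gmod[OF n p]] h h1 h2 h3])
  note [simp] = ghom_simps(1-3)[OF u]
  have uPP: "u \<cdot> P ?T p \<cdot> (P m n \<rhd> ?p) = ?h"
    unfolding hP[symmetric] uP[symmetric] by simp
  let ?k = "P ?T p \<cdot> (P m n \<rhd> ?p) \<cdot> assoc_inv ?m ?n ?p"
  have T_la': "la ?S \<cdot> (a \<lhd> P n p) = P n p \<cdot> (la n \<rhd> ?p) \<cdot> assoc_inv a ?n ?p"
    using arg_cong[OF T_left_action[OF n p], of "\<lambda>t. t \<cdot> assoc_inv a ?n ?p"] by simp
  have penta: "assoc_inv ?m (a \<otimes>\<^sub>o ?n) ?p \<cdot> (?m \<lhd> assoc_inv a ?n ?p) \<cdot> Assoc C ?m a (?n \<otimes>\<^sub>o ?p)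
      = (Assoc C ?m a ?n \<rhd> ?p) \<cdot> assoc_inv (?m \<otimes>\<^sub>o a) ?n ?p"
  proof -
    have "assoc_inv ?m (a \<otimes>\<^sub>o ?n) ?p \<cdot> (?m \<lhd> assoc_inv a ?n ?p) \<cdot> Assoc C ?m a (?n \<otimes>\<^sub>o ?p)
      = assoc_inv ?m (a \<otimes>\<^sub>o ?n) ?p \<cdot> (?m \<lhd> assoc_inv a ?n ?p) \<cdot>
        (Assoc C ?m a (?n \<otimes>\<^sub>o ?p) \<cdot> Assoc C (?m \<otimes>\<^sub>o a) ?n ?p) \<cdot> assoc_inv (?m \<otimes>\<^sub>o a) ?n ?p"
      by simp
    also have "\<dots> = (Assoc C ?m a ?n \<rhd> ?p) \<cdot> assoc_inv (?m \<otimes>\<^sub>o a) ?n ?p"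
      by (subst pentagon[symmetric]) simp_all
    finally show ?thesis .
  qed
  \<comment> \<open>Both sides are composed with an isomorphism that brings their source into
    left-nested form; it is cancelled at the end.\<close>
  have k_bal: "?k \<cdot> (?m \<lhd> (act n \<rhd> ?p)) = ?k \<cdot> (?m \<lhd> ((?n \<lhd> la p) \<cdot> Assoc C ?n a ?p))"
  proof -
    have "?k \<cdot> (?m \<lhd> (act n \<rhd> ?p)) \<cdot> (Assoc C ?m (?n \<otimes>\<^sub>o a) ?p \<cdot> (Assoc C ?m ?n a \<rhd> ?p)) =
      P ?T p \<cdot> ((P m n \<cdot> (?m \<lhd> act n) \<cdot> Assoc C ?m ?n a) \<rhd> ?p)"
      by simp
    also have "\<dots> = (P ?T p \<cdot> (act ?T \<rhd> ?p)) \<cdot> ((P m n \<rhd> a) \<rhd> ?p)"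
      unfolding T_act[OF m n, symmetric] by simp
    also have "\<dots> = P ?T p \<cdot> (P m n \<rhd> ?p) \<cdot> ((?m \<otimes>\<^sub>o ?n) \<lhd> la p) \<cdot> Assoc C (?m \<otimes>\<^sub>o ?n) a ?p"
      by (subst P_balanced) simp_all
    also have "\<dots> = ?k \<cdot> (?m \<lhd> (?n \<lhd> la p)) \<cdot> (Assoc C ?m ?n (a \<otimes>\<^sub>o ?p) \<cdot> Assoc C (?m \<otimes>\<^sub>o ?n) a ?p)"
      by simp
    also have "\<dots> = ?k \<cdot> (?m \<lhd> ((?n \<lhd> la p) \<cdot> Assoc C ?n a ?p)) \<cdot> (Assoc C ?m (?n \<otimes>\<^sub>o a) ?p \<cdot> (Assoc C ?m ?n a \<rhd> ?p))"
      by (subst pentagon[symmetric]) simp_all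
    finally have eq: "(?k \<cdot> (?m \<lhd> (act n \<rhd> ?p))) \<cdot> (Assoc C ?m (?n \<otimes>\<^sub>o a) ?p \<cdot> (Assoc C ?m ?n a \<rhd> ?p)) =
      (?k \<cdot> (?m \<lhd> ((?n \<lhd> la p) \<cdot> Assoc C ?n a ?p))) \<cdot> (Assoc C ?m (?n \<otimes>\<^sub>o a) ?p \<cdot> (Assoc C ?m ?n a \<rhd> ?p))"
      by simp
    show ?thesis
      by (rule iso_cancel_right[OF iso_morI[of _ "(assoc_inv ?m ?n a \<rhd> ?p) \<cdot> assoc_inv ?m (?n \<otimes>\<^sub>o a) ?p"] _ _ _ _ eq]) simp_all
  qed
  obtain k where k [simp]: "k \<in> Mor C" "Dom C k = ?m \<otimes>\<^sub>o mob ?S" "Cod C k = mob ?y" and kP: "k \<cdot> (?m \<lhd> P n p) = ?k"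
    by (rule module_tensor.tensor_descend_left[OF module_tensor[OF n p] _ _ _ k_bal]) auto
  have k1: "k \<cdot> (act m \<rhd> mob ?S) = k \<cdot> (?m \<lhd> la ?S) \<cdot> Assoc C ?m a (mob ?S)"
  proof (rule P_epi_left[OF n p, of _ _ "?m \<otimes>\<^sub>o a"])
    have "(k \<cdot> (act m \<rhd> mob ?S)) \<cdot> ((?m \<otimes>\<^sub>o a) \<lhd> P n p) = (k \<cdot> (?m \<lhd> P n p)) \<cdot> (act m \<rhd> (?n \<otimes>\<^sub>o ?p))" (is "?lhs = _")
      by simp
    also have "\<dots> = P ?T p \<cdot> ((P m n \<cdot> (act m \<rhd> ?n)) \<rhd> ?p) \<cdot> assoc_inv (?m \<otimes>\<^sub>o a) ?n ?p"
      unfolding kP by simp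
    also have "\<dots> = P ?T p \<cdot> ((P m n \<cdot> (?m \<lhd> la n)) \<rhd> ?p) \<cdot> ((Assoc C ?m a ?n \<rhd> ?p) \<cdot> assoc_inv (?m \<otimes>\<^sub>o a) ?n ?p)"
      unfolding P_balanced[OF m n] by simp
    also have "\<dots> = (k \<cdot> (?m \<lhd> P n p)) \<cdot> (?m \<lhd> ((la n \<rhd> ?p) \<cdot> assoc_inv a ?n ?p)) \<cdot> Assoc C ?m a (?n \<otimes>\<^sub>o ?p)"
      unfolding kP penta[symmetric] by simp
    also have "\<dots> = k \<cdot> (?m \<lhd> (P n p \<cdot> (la n \<rhd> ?p) \<cdot> assoc_inv a ?n ?p)) \<cdot> Assoc C ?m a (?n \<otimes>\<^sub>o ?p)"
      by simp
    also have "\<dots> = (k \<cdot> (?m \<lhd> la ?S) \<cdot> Assoc C ?m a (mob ?S)) \<cdot> ((?m \<otimes>\<^sub>o a) \<lhd> P n p)"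
      unfolding T_la'[symmetric] by simp
    finally show "?lhs = \<dots>" .
  qed simp_all
  obtain v where v [simp]: "v \<in> Mor C" "Dom C v = mob ?z" "Cod C v = mob ?y" and vP: "v \<cdot> P m ?S = k"
    by (rule module_tensor.tensor_descend[OF module_tensor[OF m T_gmod[OF n p]] k(1,2) k1]) auto
  have vPP: "v \<cdot> P m ?S \<cdot> (?m \<lhd> P n p) = ?k"
    unfolding kP[symmetric] vP[symmetric] by simp
  have "v \<cdot> u = Id C (mob ?y)"
  proof (rule P_epi[OF T_gmod[OF m n] p])
    show "(v \<cdot> u) \<cdot> P ?T p = Id C (mob ?y) \<cdot> P ?T p"
    proof (rule P_epi_right[OF m n, of _ _ ?p])
      have "((v \<cdot> u) \<cdot> P ?T p) \<cdot> (P m n \<rhd> ?p) = v \<cdot> (u \<cdot> P ?T p \<cdot> (P m n \<rhd> ?p))" (is "?lhs = _") by simp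
      also have "\<dots> = (v \<cdot> P m ?S \<cdot> (?m \<lhd> P n p)) \<cdot> Assoc C ?m ?n ?p"
        unfolding uPP by simp
      also have "\<dots> = (Id C (mob ?y) \<cdot> P ?T p) \<cdot> (P m n \<rhd> ?p)"
        unfolding vPP by simp
      finally show "?lhs = \<dots>" .
    qed simp_all
  qed simp_all
  moreover have "u \<cdot> v = Id C (mob ?z)"
  proof (rule P_epi[OF m T_gmod[OF n p]])
    show "(u \<cdot> v) \<cdot> P m ?S = Id C (mob ?z) \<cdot> P m ?S"
    proof (rule P_epi_left[OF n p, of _ _ ?m])
      have "((u \<cdot> v) \<cdot> P m ?S) \<cdot> (?m \<lhd> P n p) = u \<cdot> (v \<cdot> P m ?S \<cdot> (?m \<lhd> P n p))" (is "?lhs = _") by simp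
      also have "\<dots> = (u \<cdot> P ?T p \<cdot> (P m n \<rhd> ?p)) \<cdot> assoc_inv ?m ?n ?p"
        unfolding vPP by simp
      also have "\<dots> = (Id C (mob ?z) \<cdot> P m ?S) \<cdot> (?m \<lhd> P n p)"
        unfolding uPP by simp
      finally show "?lhs = \<dots>" .
    qed simp_all
  qed simp_all
  ultimately show ?thesis using u uPP v by blast
qed

end

section \<open>Independence of the linear structure from further record fields\<close>

lemma lin_cat_extend_simps [simp]:
  "Ob (lin_cat.extend K x) = Ob K" "Mor (lin_cat.extend K x) = Mor K" "Dom (lin_cat.extend K x) = Dom K"
  "Cod (lin_cat.extend K x) = Cod K" "lin_cat.Id (lin_cat.extend K x) = lin_cat.Id K"
  "Comp (lin_cat.extend K x) = Comp K" "Add (lin_cat.extend K x) = Add K" "Zero (lin_cat.extend K x) = Zero K"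
  "Scale (lin_cat.extend K x) = Scale K"
  by (simp_all add: lin_cat.extend_def)

lemma homset_extend [simp]: "homset (lin_cat.extend K x) = homset K"
  by (simp add: homset_def fun_eq_iff)

lemma homgroup_extend [simp]: "homgroup (lin_cat.extend K x) = homgroup K"
  by (simp add: homgroup_def fun_eq_iff)

lemma iso_mor_extend [simp]: "iso_mor (lin_cat.extend K x) f = iso_mor K f"
  by (simp add: iso_mor_def inverse_mor_def)

lemma is_biproduct_extend [simp]: "is_biproduct (lin_cat.extend K x) = is_biproduct K"
  unfolding is_biproduct_def by (simp only: lin_cat_extend_simps homset_extend homgroup_extend)

lemma additive_linear_category_extend:
  "additive_linear_category K \<Longrightarrow> additive_linear_category (lin_cat.extend K x)"
  unfolding additive_linear_category_def additive_linear_category_axioms_def category_def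
  by (simp only: lin_cat_extend_simps homset_extend homgroup_extend is_biproduct_extend)

context graded_tensor_choice
begin

abbreviation "R \<equiv> regular_module A"

text \<open>The modules are arguments since a morphism of \<open>C\<close> does not determine the
  module structures at its ends. The value is the only map with this property, as \<open>P\<close>
  can be cancelled.\<close>

definition tens_map where
  "tens_map m n m' n' f g = (SOME u. ghom (T m m') (T n n') u \<and> u \<cdot> P m m' = P n n' \<cdot> (f \<otimes>\<^sub>m g))"

definition assoc_map where
  "assoc_map m n p = (SOME u. \<exists>v. ghom (T (T m n) p) (T m (T n p)) u \<and>
    u \<cdot> P (T m n) p \<cdot> (P m n \<rhd> mob p) =
      P m (T n p) \<cdot> (mob m \<lhd> P n p) \<cdot> Assoc C (mob m) (mob n) (mob p) \<and>
    v \<in> Mor C \<and> Dom C v = mob (T m (T n p)) \<and> Cod C v = mob (T (T m n) p) \<and>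
    v \<cdot> u = Id C (mob (T (T m n) p)) \<and> u \<cdot> v = Id C (mob (T m (T n p))))"

definition lunit_map where
  "lunit_map m = (SOME u. \<exists>v. ghom (T R m) m u \<and> u \<cdot> P R m = la m \<and>
    v \<in> Mor C \<and> Dom C v = mob m \<and> Cod C v = mob (T R m) \<and> v \<cdot> u = Id C (mob (T R m)) \<and> u \<cdot> v = Id C (mob m))"

definition runit_map where
  "runit_map m = (SOME u. \<exists>v. ghom (T m R) m u \<and> u \<cdot> P m R = act m \<and>
    v \<in> Mor C \<and> Dom C v = mob m \<and> Cod C v = mob (T m R) \<and> v \<cdot> u = Id C (mob (T m R)) \<and> u \<cdot> v = Id C (mob m))"

text \<open>Extending the linear record makes its truncation literally the category of graded
  modules, as an induced structure requires.\<close>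

definition module_tensor_category :: "(('a, 'b, 'e) gr_mod, ('a, 'b, 'e) gr_mor, 'c) mon_cat" where
  "module_tensor_category = lin_cat.extend (graded_module_category C A) (mon_cat.fields T
     (\<lambda>(m, f, n) (m', g, n'). (T m m', tens_map m n m' n' f g, T n n')) R
     (\<lambda>m n p. (T (T m n) p, assoc_map m n p, T m (T n p)))
     (\<lambda>m. (T R m, lunit_map m, m)) (\<lambda>m. (T m R, runit_map m, m)))"

abbreviation "M \<equiv> module_tensor_category"

lemma M_simps:
  "Tens_ob M = T" "Unit M = R"
  "Tens_mor M (m, f, n) (m', g, n') = (T m m', tens_map m n m' n' f g, T n n')"
  "Assoc M m n p = (T (T m n) p, assoc_map m n p, T m (T n p))"
  "Lunit M m = (T R m, lunit_map m, m)" "Runit M m = (T m R, runit_map m, m)"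
  by (simp_all add: module_tensor_category_def mon_cat.fields_def lin_cat.extend_def)

lemma M_lin_simps:
  "Ob M = Ob GM" "Mor M = Mor GM" "Dom M = Dom GM" "Cod M = Cod GM" "lin_cat.Id M = lin_cat.Id GM" "Comp M = Comp GM"
  "Add M = Add GM" "Zero M = Zero GM" "Scale M = Scale GM" "homset M = homset GM" "iso_mor M f = iso_mor GM f"
  by (simp_all add: module_tensor_category_def)

lemma tens_map:
  assumes "gmod m" "gmod n" "gmod m'" "gmod n'" "ghom m n f" "ghom m' n' g"
  shows "ghom (T m m') (T n n') (tens_map m n m' n' f g)" "tens_map m n m' n' f g \<cdot> P m m' = P n n' \<cdot> (f \<otimes>\<^sub>m g)"
  using someI_ex[OF tens_map_ex[OF assms]] unfolding tens_map_def by blast+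

lemmas tens_map_simps = ghom_simps(1-3)[OF tens_map(1)]

lemma assoc_map:
  assumes "gmod m" "gmod n" "gmod p"
  shows "ghom (T (T m n) p) (T m (T n p)) (assoc_map m n p)"
    "assoc_map m n p \<cdot> P (T m n) p \<cdot> (P m n \<rhd> mob p) =
      P m (T n p) \<cdot> (mob m \<lhd> P n p) \<cdot> Assoc C (mob m) (mob n) (mob p)"
    "\<exists>v. v \<in> Mor C \<and> Dom C v = mob (T m (T n p)) \<and> Cod C v = mob (T (T m n) p) \<and>
      v \<cdot> assoc_map m n p = Id C (mob (T (T m n) p)) \<and> assoc_map m n p \<cdot> v = Id C (mob (T m (T n p)))"
  using someI_ex[OF assoc_map_ex[OF assms]] unfolding assoc_map_def[symmetric] by blast+

lemmas assoc_map_simps = ghom_simps(1-3)[OF assoc_map(1)]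

lemma lunit_map:
  assumes "gmod m"
  shows "ghom (T R m) m (lunit_map m)" "lunit_map m \<cdot> P R m = la m"
    "\<exists>v. v \<in> Mor C \<and> Dom C v = mob m \<and> Cod C v = mob (T R m) \<and>
      v \<cdot> lunit_map m = Id C (mob (T R m)) \<and> lunit_map m \<cdot> v = Id C (mob m)"
  using someI_ex[OF lunit_map_ex[OF assms]] unfolding lunit_map_def[symmetric] by blast+

lemmas lunit_map_simps = ghom_simps(1-3)[OF lunit_map(1)]

lemma runit_map:
  assumes "gmod m"
  shows "ghom (T m R) m (runit_map m)" "runit_map m \<cdot> P m R = act m"
    "\<exists>v. v \<in> Mor C \<and> Dom C v = mob m \<and> Cod C v = mob (T m R) \<and>
      v \<cdot> runit_map m = Id C (mob (T m R)) \<and> runit_map m \<cdot> v = Id C (mob m)"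
  using someI_ex[OF runit_map_ex[OF assms]] unfolding runit_map_def[symmetric] by blast+

lemmas runit_map_simps = ghom_simps(1-3)[OF runit_map(1)]

lemmas map_simps = tens_map_simps assoc_map_simps lunit_map_simps runit_map_simps tens_map(1) assoc_map(1) lunit_map(1) runit_map(1)

text \<open>Morphisms out of a twofold product are compared on the plain tensor product of the
  underlying objects; the inner projection is cancellable after whiskering by preservation.\<close>

lemma P_epi3:
  assumes m: "gmod m" and n: "gmod n" and p: "gmod p"
    and u: "u \<in> Mor C" "v \<in> Mor C" "Dom C u = mob (T (T m n) p)" "Dom C v = mob (T (T m n) p)" "Cod C u = Cod C v"
    and eq: "u \<cdot> P (T m n) p \<cdot> (P m n \<rhd> mob p) = v \<cdot> P (T m n) p \<cdot> (P m n \<rhd> mob p)"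
  shows "u = v"
proof (rule P_epi[OF T_gmod[OF m n] p])
  show "u \<cdot> P (T m n) p = v \<cdot> P (T m n) p"
    by (rule P_epi_right[OF m n, of _ _ "mob p"]) (use assms in simp_all)
qed (use u in auto)

lemma P_epi4:
  assumes m: "gmod m" and n: "gmod n" and p: "gmod p" and r: "gmod r"
    and u: "u \<in> Mor C" "v \<in> Mor C" "Dom C u = mob (T (T (T m n) p) r)" "Dom C v = mob (T (T (T m n) p) r)" "Cod C u = Cod C v"
    and eq: "u \<cdot> P (T (T m n) p) r \<cdot> (P (T m n) p \<rhd> mob r) \<cdot> ((P m n \<rhd> mob p) \<rhd> mob r) =
      v \<cdot> P (T (T m n) p) r \<cdot> (P (T m n) p \<rhd> mob r) \<cdot> ((P m n \<rhd> mob p) \<rhd> mob r)"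
  shows "u = v"
proof (rule P_epi3[OF T_gmod[OF m n] p r u])
  show "u \<cdot> P (T (T m n) p) r \<cdot> (P (T m n) p \<rhd> mob r) = v \<cdot> P (T (T m n) p) r \<cdot> (P (T m n) p \<rhd> mob r)"
    by (rule P_epi_right2[OF m n, of _ _ "mob p" "mob r"]) (use assms in simp_all)
qed

lemma assoc_map_natural:
  assumes [simp]: "gmod x" "gmod y" "gmod z" "gmod x'" "gmod y'" "gmod z'"
    and f [simp]: "ghom x x' f" and g [simp]: "ghom y y' g" and h [simp]: "ghom z z' h"
  shows "assoc_map x' y' z' \<cdot> tens_map (T x y) (T x' y') z z' (tens_map x x' y y' f g) h =
    tens_map x x' (T y z) (T y' z') f (tens_map y y' z z' g h) \<cdot> assoc_map x y z"
proof (rule P_epi3[of x y z])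
  note [simp] = ghom_simps(1-3)[OF f] ghom_simps(1-3)[OF g] ghom_simps(1-3)[OF h] map_simps
  have "(assoc_map x' y' z' \<cdot> tens_map (T x y) (T x' y') z z' (tens_map x x' y y' f g) h) \<cdot> P (T x y) z \<cdot> (P x y \<rhd> mob z)
    = assoc_map x' y' z' \<cdot> (tens_map (T x y) (T x' y') z z' (tens_map x x' y y' f g) h \<cdot> P (T x y) z) \<cdot> (P x y \<rhd> mob z)"
    by simp
  also have "\<dots> = assoc_map x' y' z' \<cdot> P (T x' y') z' \<cdot> ((tens_map x x' y y' f g \<cdot> P x y) \<otimes>\<^sub>m h)"
    by (subst tens_map(2)) simp_all
  also have "\<dots> = (assoc_map x' y' z' \<cdot> P (T x' y') z' \<cdot> (P x' y' \<rhd> mob z')) \<cdot> ((f \<otimes>\<^sub>m g) \<otimes>\<^sub>m h)"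
    by (subst tens_map(2)) simp_all
  also have "\<dots> = P x' (T y' z') \<cdot> (f \<otimes>\<^sub>m (P y' z' \<cdot> (g \<otimes>\<^sub>m h))) \<cdot> Assoc C (mob x) (mob y) (mob z)"
    by (subst assoc_map(2)) simp_all
  also have "\<dots> = P x' (T y' z') \<cdot> (f \<otimes>\<^sub>m (tens_map y y' z z' g h \<cdot> P y z)) \<cdot> Assoc C (mob x) (mob y) (mob z)"
    by (subst tens_map(2)) simp_all
  also have "\<dots> = (P x' (T y' z') \<cdot> (f \<otimes>\<^sub>m tens_map y y' z z' g h)) \<cdot> (mob x \<lhd> P y z) \<cdot> Assoc C (mob x) (mob y) (mob z)"
    by simp
  also have "\<dots> = tens_map x x' (T y z) (T y' z') f (tens_map y y' z z' g h) \<cdot> (P x (T y z) \<cdot> (mob x \<lhd> P y z) \<cdot> Assoc C (mob x) (mob y) (mob z))"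
    by (subst tens_map(2)[of x x' "T y z" "T y' z'", symmetric]) simp_all
  also have "\<dots> = (tens_map x x' (T y z) (T y' z') f (tens_map y y' z z' g h) \<cdot> assoc_map x y z) \<cdot> P (T x y) z \<cdot> (P x y \<rhd> mob z)"
    by (subst assoc_map(2)[symmetric]) simp_all
  finally show "(assoc_map x' y' z' \<cdot> tens_map (T x y) (T x' y') z z' (tens_map x x' y y' f g) h) \<cdot> P (T x y) z \<cdot> (P x y \<rhd> mob z) = \<dots>" .
qed (use ghom_simps(1-3)[OF f] ghom_simps(1-3)[OF g] ghom_simps(1-3)[OF h] in \<open>simp_all add: map_simps\<close>)

text \<open>Precomposed with all projections, each induced associator turns into one of
  \<open>C\<close>, and \<open>head_tens\<close> contributes the pentagon of
  \<open>C\<close>.\<close>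

lemma assoc_map_pentagon:
  assumes w: "gmod w" and x: "gmod x" and y: "gmod y" and z: "gmod z"
  shows "tens_map w w (T (T x y) z) (T x (T y z)) (Id C (mob w)) (assoc_map x y z) \<cdot> assoc_map w (T x y) z \<cdot>
      tens_map (T (T w x) y) (T w (T x y)) z z (assoc_map w x y) (Id C (mob z)) =
    assoc_map w x (T y z) \<cdot> assoc_map (T w x) y z"
proof (rule P_epi4[OF w x y z])
  note [simp] = w x y z map_simps ghom_id
  let ?w = "mob w" and ?x = "mob x" and ?y = "mob y" and ?z = "mob z"
  let ?t1 = "tens_map w w (T (T x y) z) (T x (T y z)) (Id C ?w) (assoc_map x y z)"
  let ?t2 = "tens_map (T (T w x) y) (T w (T x y)) z z (assoc_map w x y) (Id C ?z)"
  let ?E = "P (T (T w x) y) z \<cdot> (P (T w x) y \<rhd> ?z) \<cdot> ((P w x \<rhd> ?y) \<rhd> ?z)"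
  have t2: "?t2 \<cdot> P (T (T w x) y) z = P (T w (T x y)) z \<cdot> (assoc_map w x y \<rhd> ?z)"
    by (rule tens_map(2)) simp_all
  have t1: "?t1 \<cdot> P w (T (T x y) z) = P w (T x (T y z)) \<cdot> (?w \<lhd> assoc_map x y z)"
    by (rule tens_map(2)) simp_all
  have "(?t1 \<cdot> assoc_map w (T x y) z \<cdot> ?t2) \<cdot> ?E = ?t1 \<cdot> assoc_map w (T x y) z \<cdot> (?t2 \<cdot> P (T (T w x) y) z) \<cdot>
      (P (T w x) y \<rhd> ?z) \<cdot> ((P w x \<rhd> ?y) \<rhd> ?z)" (is "?lhs = _")
    by simp
  also have "\<dots> = ?t1 \<cdot> assoc_map w (T x y) z \<cdot> P (T w (T x y)) z \<cdot>
      ((assoc_map w x y \<cdot> P (T w x) y \<cdot> (P w x \<rhd> ?y)) \<rhd> ?z)"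
    unfolding t2 by simp
  also have "\<dots> = ?t1 \<cdot> (assoc_map w (T x y) z \<cdot> P (T w (T x y)) z \<cdot> (P w (T x y) \<rhd> ?z)) \<cdot>
      (((?w \<lhd> P x y) \<cdot> Assoc C ?w ?x ?y) \<rhd> ?z)"
    unfolding assoc_map(2)[OF w x y] by simp
  also have "\<dots> = (?t1 \<cdot> P w (T (T x y) z)) \<cdot> (?w \<lhd> (P (T x y) z \<cdot> (P x y \<rhd> ?z))) \<cdot>
      Assoc C ?w (?x \<otimes>\<^sub>o ?y) ?z \<cdot> (Assoc C ?w ?x ?y \<rhd> ?z)"
    by (subst assoc_map(2)) simp_all
  also have "\<dots> = P w (T x (T y z)) \<cdot> (?w \<lhd> (assoc_map x y z \<cdot> P (T x y) z \<cdot> (P x y \<rhd> ?z))) \<cdot>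
      Assoc C ?w (?x \<otimes>\<^sub>o ?y) ?z \<cdot> (Assoc C ?w ?x ?y \<rhd> ?z)"
    unfolding t1 by simp
  also have "\<dots> = P w (T x (T y z)) \<cdot> (?w \<lhd> P x (T y z)) \<cdot> Assoc C ?w ?x (mob (T y z)) \<cdot> ((?w \<otimes>\<^sub>o ?x) \<lhd> P y z) \<cdot> Assoc C (?w \<otimes>\<^sub>o ?x) ?y ?z"
    unfolding assoc_map(2)[OF x y z] by (subst head_tens) simp_all
  also have "\<dots> = (P w (T x (T y z)) \<cdot> (?w \<lhd> P x (T y z)) \<cdot> Assoc C ?w ?x (mob (T y z))) \<cdot> ((?w \<otimes>\<^sub>o ?x) \<lhd> P y z) \<cdot> Assoc C (?w \<otimes>\<^sub>o ?x) ?y ?z"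
    by simp
  also have "\<dots> = assoc_map w x (T y z) \<cdot> (P (T w x) (T y z) \<cdot> (mob (T w x) \<lhd> P y z) \<cdot> Assoc C (mob (T w x)) ?y ?z) \<cdot> ((P w x \<rhd> ?y) \<rhd> ?z)"
    by (subst assoc_map(2)[symmetric]) simp_all
  also have "\<dots> = (assoc_map w x (T y z) \<cdot> assoc_map (T w x) y z) \<cdot> ?E"
    by (subst assoc_map(2)[symmetric]) simp_all
  finally show "?lhs = \<dots>" .
qed (use w x y z in \<open>simp_all add: map_simps ghom_id\<close>)

lemma R_ghom_id [simp]: "ghom R R (Id C a)"
  using ghom_id[OF gmod_regular] by simp

text \<open>The unitors are induced by the left and the right action, so the triangle is the
  balancing relation of m \<otimes> n for the modules x and y.\<close>

lemma assoc_map_triangle: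
  assumes x: "gmod x" and y: "gmod y"
  shows "tens_map x x (T R y) y (Id C (mob x)) (lunit_map y) \<cdot> assoc_map x R y =
    tens_map (T x R) x y y (runit_map x) (Id C (mob y))"
proof (rule P_epi3[OF x gmod_regular y])
  note [simp] = x y map_simps ghom_id P_simps[OF gmod_regular, simplified] P_simps[OF _ gmod_regular, simplified]
  let ?x = "mob x" and ?y = "mob y"
  let ?t1 = "tens_map x x (T R y) y (Id C ?x) (lunit_map y)" and ?t2 = "tens_map (T x R) x y y (runit_map x) (Id C ?y)"
  have t1: "?t1 \<cdot> P x (T R y) = P x y \<cdot> (?x \<lhd> lunit_map y)"
    by (rule tens_map(2)) simp_all
  have t2: "?t2 \<cdot> P (T x R) y = P x y \<cdot> (runit_map x \<rhd> ?y)"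
    by (rule tens_map(2)) simp_all
  have "(?t1 \<cdot> assoc_map x R y) \<cdot> P (T x R) y \<cdot> (P x R \<rhd> ?y) = ?t1 \<cdot> (assoc_map x R y \<cdot> P (T x R) y \<cdot> (P x R \<rhd> ?y))"
    by simp
  also have "\<dots> = (?t1 \<cdot> P x (T R y)) \<cdot> (?x \<lhd> P R y) \<cdot> Assoc C ?x a ?y"
    by (subst assoc_map(2)) simp_all
  also have "\<dots> = P x y \<cdot> (?x \<lhd> (lunit_map y \<cdot> P R y)) \<cdot> Assoc C ?x a ?y"
    unfolding t1 by simp
  also have "\<dots> = P x y \<cdot> (act x \<rhd> ?y)"
    unfolding lunit_map(2)[OF y] P_balanced[OF x y] ..
  also have "\<dots> = P x y \<cdot> ((runit_map x \<cdot> P x R) \<rhd> ?y)"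
    unfolding runit_map(2)[OF x] ..
  also have "\<dots> = (?t2 \<cdot> P (T x R) y) \<cdot> (P x R \<rhd> ?y)"
    unfolding t2 by simp
  finally show "(?t1 \<cdot> assoc_map x R y) \<cdot> P (T x R) y \<cdot> (P x R \<rhd> ?y) = ?t2 \<cdot> P (T x R) y \<cdot> (P x R \<rhd> ?y)"
    by simp
qed (use x y in \<open>simp_all add: map_simps ghom_id\<close>)

lemma gm_isoI:
  assumes "gmod m" "gmod n" "ghom m n u" "\<exists>v. v \<in> Mor C \<and> Dom C v = mob n \<and> Cod C v = mob m \<and> v \<cdot> u = Id C (mob m) \<and> u \<cdot> v = Id C (mob n)"
  shows "iso_mor GM (m, u, n)"
proof -
  obtain v where v: "v \<in> Mor C" "Dom C v = mob n" "Cod C v = mob m" "v \<cdot> u = Id C (mob m)" "u \<cdot> v = Id C (mob n)"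
    using assms(4) by blast
  have "inverse_mor GM (m, u, n) (n, v, m)"
    unfolding inverse_mor_def using assms(1-3) v ghom_inverse[OF assms(1-3) v] by simp
  then show ?thesis unfolding iso_mor_def by blast
qed

text \<open>Uniqueness of the induced map; functoriality and bilinearity of the product follow by
  exhibiting the expected candidate.\<close>

lemma tens_map_eqI:
  assumes "gmod m" "gmod n" "gmod m'" "gmod n'" "ghom m n f" "ghom m' n' g"
    "u \<in> Mor C" "Dom C u = mob (T m m')" "Cod C u = mob (T n n')" "u \<cdot> P m m' = P n n' \<cdot> (f \<otimes>\<^sub>m g)"
  shows "tens_map m n m' n' f g = u"
  by (rule P_epi[of m m']) (use assms in \<open>simp_all add: map_simps tens_map(2)\<close>)

lemma tens_map_comp:
  assumes [simp]: "gmod x" "gmod y" "gmod z" "gmod x'" "gmod y'" "gmod z'"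
    and f: "ghom x y f" and g: "ghom y z g" and f': "ghom x' y' f'" and g': "ghom y' z' g'"
  shows "tens_map x z x' z' (g \<cdot> f) (g' \<cdot> f') = tens_map y z y' z' g g' \<cdot> tens_map x y x' y' f f'"
proof (rule tens_map_eqI)
  note [simp] = ghom_simps(1-3)[OF f] ghom_simps(1-3)[OF g] ghom_simps(1-3)[OF f'] ghom_simps(1-3)[OF g'] f g f' g' map_simps
  show "ghom x z (g \<cdot> f)" by (rule ghom_comp[OF _ _ _ f g]) simp_all
  show "ghom x' z' (g' \<cdot> f')" by (rule ghom_comp[OF _ _ _ f' g']) simp_all
  have "(tens_map y z y' z' g g' \<cdot> tens_map x y x' y' f f') \<cdot> P x x' = tens_map y z y' z' g g' \<cdot> (tens_map x y x' y' f f' \<cdot> P x x')" (is "?lhs = _")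
    by simp
  also have "\<dots> = (tens_map y z y' z' g g' \<cdot> P y y') \<cdot> (f \<otimes>\<^sub>m f')"
    by (subst tens_map(2)) simp_all
  also have "\<dots> = P z z' \<cdot> ((g \<cdot> f) \<otimes>\<^sub>m (g' \<cdot> f'))"
    by (subst tens_map(2)) simp_all
  finally show "?lhs = \<dots>" .
  show "tens_map y z y' z' g g' \<cdot> tens_map x y x' y' f f' \<in> Mor C"
    "Dom C (tens_map y z y' z' g g' \<cdot> tens_map x y x' y' f f') = mob (T x x')"
    "Cod C (tens_map y z y' z' g g' \<cdot> tens_map x y x' y' f f') = mob (T z z')" by simp_all
qed simp_all

lemma tens_map_add:
  assumes [simp]: "gmod x" "gmod y" "gmod x'" "gmod y'"
    and f: "ghom x y f" and g: "ghom x y g" and h: "ghom x' y' h"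
  shows "tens_map x y x' y' (Add C f g) h = Add C (tens_map x y x' y' f h) (tens_map x y x' y' g h)"
    and "tens_map x' y' x y h (Add C f g) = Add C (tens_map x' y' x y h f) (tens_map x' y' x y h g)"
proof -
  note [simp] = ghom_simps(1-3)[OF f] ghom_simps(1-3)[OF g] ghom_simps(1-3)[OF h] f g h map_simps
  have "ghom x y (Add C f g)" by (rule ghom_add) simp_all
  then show "tens_map x y x' y' (Add C f g) h = Add C (tens_map x y x' y' f h) (tens_map x y x' y' g h)"
    "tens_map x' y' x y h (Add C f g) = Add C (tens_map x' y' x y h f) (tens_map x' y' x y h g)"
    by - (rule tens_map_eqI; simp add: add_comp tens_map(2) tens_add)+
qed

lemma tens_map_scale:
  assumes [simp]: "gmod x" "gmod y" "gmod x'" "gmod y'"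
    and f: "ghom x y f" and h: "ghom x' y' h"
  shows "tens_map x y x' y' (Scale C c f) h = Scale C c (tens_map x y x' y' f h)"
    and "tens_map x' y' x y h (Scale C c f) = Scale C c (tens_map x' y' x y h f)"
proof -
  note [simp] = ghom_simps(1-3)[OF f] ghom_simps(1-3)[OF h] f h map_simps
  have "ghom x y (Scale C c f)" by (rule ghom_scale) simp_all
  then show "tens_map x y x' y' (Scale C c f) h = Scale C c (tens_map x y x' y' f h)"
    "tens_map x' y' x y h (Scale C c f) = Scale C c (tens_map x' y' x y h f)"
    by - (rule tens_map_eqI; simp add: tens_map(2))+
qed

lemma M_monoidal: "linear_monoidal_category M"
proof (intro linear_monoidal_category.intro linear_monoidal_category_axioms.intro)
  show "additive_linear_category M"
    unfolding module_tensor_category_def by (rule additive_linear_category_extend[OF gm_additive])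
next
  note [simp] = M_simps M_lin_simps map_simps
  fix F G H F' G' and w x y z x' y' z' :: "('a, 'b, 'e) gr_mod" and c :: 'c
  show "Unit M \<in> Ob M" by simp
  show "x \<in> Ob M \<Longrightarrow> y \<in> Ob M \<Longrightarrow> Tens_ob M x y \<in> Ob M" by simp
  show "F \<in> homset M x y \<Longrightarrow> G \<in> homset M x' y' \<Longrightarrow> Tens_mor M F G \<in> homset M (Tens_ob M x x') (Tens_ob M y y')"
    by (simp, elim gm_hom_cases) simp
  show "x \<in> Ob M \<Longrightarrow> y \<in> Ob M \<Longrightarrow> Tens_mor M (lin_cat.Id M x) (lin_cat.Id M y) = lin_cat.Id M (Tens_ob M x y)"
    by (simp add: tens_map_eqI ghom_id)
  show "F \<in> homset M x y \<Longrightarrow> G \<in> homset M y z \<Longrightarrow> F' \<in> homset M x' y' \<Longrightarrow> G' \<in> homset M y' z' \<Longrightarrow>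
      Tens_mor M (Comp M G F) (Comp M G' F') = Comp M (Tens_mor M G G') (Tens_mor M F F')"
    by (simp, elim gm_hom_cases) (simp add: tens_map_comp)
  show "F \<in> homset M x y \<Longrightarrow> G \<in> homset M x y \<Longrightarrow> H \<in> Mor M \<Longrightarrow>
      Tens_mor M (Add M F G) H = Add M (Tens_mor M F H) (Tens_mor M G H)"
    by (simp, elim gm_hom_cases gm_mor_cases) (simp add: tens_map_add)
  show "F \<in> homset M x y \<Longrightarrow> G \<in> homset M x y \<Longrightarrow> H \<in> Mor M \<Longrightarrow>
      Tens_mor M H (Add M F G) = Add M (Tens_mor M H F) (Tens_mor M H G)"
    by (simp, elim gm_hom_cases gm_mor_cases) (simp add: tens_map_add)
  show "F \<in> Mor M \<Longrightarrow> G \<in> Mor M \<Longrightarrow> Tens_mor M (Scale M c F) G = Scale M c (Tens_mor M F G)"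
    "F \<in> Mor M \<Longrightarrow> G \<in> Mor M \<Longrightarrow> Tens_mor M F (Scale M c G) = Scale M c (Tens_mor M F G)"
    by (simp, elim gm_mor_cases, simp add: tens_map_scale)+
  show "x \<in> Ob M \<Longrightarrow> y \<in> Ob M \<Longrightarrow> z \<in> Ob M \<Longrightarrow>
      Assoc M x y z \<in> homset M (Tens_ob M (Tens_ob M x y) z) (Tens_ob M x (Tens_ob M y z))"
    "x \<in> Ob M \<Longrightarrow> Lunit M x \<in> homset M (Tens_ob M (Unit M) x) x"
    "x \<in> Ob M \<Longrightarrow> Runit M x \<in> homset M (Tens_ob M x (Unit M)) x"
    by simp_all
  show "x \<in> Ob M \<Longrightarrow> y \<in> Ob M \<Longrightarrow> z \<in> Ob M \<Longrightarrow> iso_mor M (Assoc M x y z)"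
    using assoc_map(3)[of x y z] by (simp add: gm_isoI)
  show "x \<in> Ob M \<Longrightarrow> iso_mor M (Lunit M x)"
    using lunit_map(3)[of x] by (simp add: gm_isoI)
  show "x \<in> Ob M \<Longrightarrow> iso_mor M (Runit M x)"
    using runit_map(3)[of x] by (simp add: gm_isoI)
  show "F \<in> homset M x x' \<Longrightarrow> G \<in> homset M y y' \<Longrightarrow> H \<in> homset M z z' \<Longrightarrow>
      Comp M (Assoc M x' y' z') (Tens_mor M (Tens_mor M F G) H) = Comp M (Tens_mor M F (Tens_mor M G H)) (Assoc M x y z)"
    by (simp, elim gm_hom_cases) (simp add: assoc_map_natural)
  show "F \<in> homset M x y \<Longrightarrow> Comp M (Lunit M y) (Tens_mor M (lin_cat.Id M (Unit M)) F) = Comp M F (Lunit M x)"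
  proof (simp, elim gm_hom_cases)
    fix f assume F: "F = (x, f, y)" and [simp]: "gmod x" "gmod y" and f [simp]: "ghom x y f" "f \<in> Mor C" "Dom C f = mob x" "Cod C f = mob y"
    have "lunit_map y \<cdot> tens_map R R x y (Id C a) f = f \<cdot> lunit_map x"
    proof (rule P_epi[of R x])
      have "(lunit_map y \<cdot> tens_map R R x y (Id C a) f) \<cdot> P R x = lunit_map y \<cdot> (tens_map R R x y (Id C a) f \<cdot> P R x)"
        by simp
      also have "\<dots> = (lunit_map y \<cdot> P R y) \<cdot> (a \<lhd> f)"
        by (subst tens_map(2)) simp_all
      \<comment> \<open>Naturality of the left unitor is compatibility of graded morphisms with the
        left actions.\<close>
      also have "\<dots> = f \<cdot> la x"
        by (subst lunit_map(2)) (simp_all add: ghom_simps(6)[OF f(1)])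
      finally show "(lunit_map y \<cdot> tens_map R R x y (Id C a) f) \<cdot> P R x = (f \<cdot> lunit_map x) \<cdot> P R x"
        by (simp add: lunit_map(2))
    qed simp_all
    then show "Comp GM (T R y, lunit_map y, y) (Tens_mor M (R, Id C a, R) F) = Comp GM F (T R x, lunit_map x, x)"
      by (simp add: F)
  qed
  show "F \<in> homset M x y \<Longrightarrow> Comp M (Runit M y) (Tens_mor M F (lin_cat.Id M (Unit M))) = Comp M F (Runit M x)"
  proof (simp, elim gm_hom_cases)
    fix f assume F: "F = (x, f, y)" and [simp]: "gmod x" "gmod y" and f [simp]: "ghom x y f" "f \<in> Mor C" "Dom C f = mob x" "Cod C f = mob y"
    have "runit_map y \<cdot> tens_map x y R R f (Id C a) = f \<cdot> runit_map x"
    proof (rule P_epi[of x R])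
      have "(runit_map y \<cdot> tens_map x y R R f (Id C a)) \<cdot> P x R = runit_map y \<cdot> (tens_map x y R R f (Id C a) \<cdot> P x R)"
        by simp
      also have "\<dots> = (runit_map y \<cdot> P y R) \<cdot> (f \<rhd> a)"
        by (subst tens_map(2)) simp_all
      also have "\<dots> = f \<cdot> act x"
        by (subst runit_map(2)) (simp_all add: ghom_simps(4)[OF f(1)])
      finally show "(runit_map y \<cdot> tens_map x y R R f (Id C a)) \<cdot> P x R = (f \<cdot> runit_map x) \<cdot> P x R"
        by (simp add: runit_map(2))
    qed simp_all
    then show "Comp GM (T y R, runit_map y, y) (Tens_mor M F (R, Id C a, R)) = Comp GM F (T x R, runit_map x, x)"
      by (simp add: F)
  qed
  show "w \<in> Ob M \<Longrightarrow> x \<in> Ob M \<Longrightarrow> y \<in> Ob M \<Longrightarrow> z \<in> Ob M \<Longrightarrow>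
      Comp M (Tens_mor M (lin_cat.Id M w) (Assoc M x y z)) (Comp M (Assoc M w (Tens_ob M x y) z)
        (Tens_mor M (Assoc M w x y) (lin_cat.Id M z))) =
      Comp M (Assoc M w x (Tens_ob M y z)) (Assoc M (Tens_ob M w x) y z)"
    by (simp add: assoc_map_pentagon)
  show "x \<in> Ob M \<Longrightarrow> y \<in> Ob M \<Longrightarrow>
      Comp M (Tens_mor M (lin_cat.Id M x) (Lunit M y)) (Assoc M x (Unit M) y) = Tens_mor M (Runit M x) (lin_cat.Id M y)"
    by (simp add: assoc_map_triangle)
qed

lemma M_induced: "is_induced_structure C A \<kappa> T P M"
  unfolding is_induced_structure_def
proof (intro conjI ballI)
  note [simp] = M_simps M_lin_simps map_simps
  show "lin_cat.truncate M = graded_module_category C A"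
    by (simp add: module_tensor_category_def lin_cat.truncate_def lin_cat.extend_def)
  show "Unit M = R" by simp
  fix F G assume "F \<in> Mor M" "G \<in> Mor M"
  then show "underlying (Tens_mor M F G) \<cdot> P (Dom M F) (Dom M G) = P (Cod M F) (Cod M G) \<cdot> (underlying F \<otimes>\<^sub>m underlying G)"
    by (simp, elim gm_mor_cases) (simp add: underlying_def tens_map(2))
next
  note [simp] = M_simps M_lin_simps map_simps
  fix m n p assume "m \<in> Ob M" "n \<in> Ob M" "p \<in> Ob M"
  then show "underlying (Assoc M m n p) \<cdot> P (T m n) p \<cdot> (P m n \<rhd> mob p) =
      P m (T n p) \<cdot> (mob m \<lhd> P n p) \<cdot> Assoc C (mob m) (mob n) (mob p)"
    by (simp add: underlying_def assoc_map(2))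
qed (simp_all add: M_simps M_lin_simps underlying_def lunit_map(2) runit_map(2))

end

text \<open>Homogeneous parts guard only the existence of a choice, since a given choice already
  carries its gradings. The image statement concerns every coequalizer and also identifies the
  factorization of p through it. The case of characteristic 0 is listed separately because
  \<open>coprime 0 n\<close> holds only for n = 1.\<close>

theorem proposition3p4:
  fixes C :: "('o, 'm, 'k :: alg_closed_field, 'x) braided_cat_scheme"
    and A :: "('o, 'm, 'g :: {finite, ab_group_add}) gr_alg"
    and \<kappa> :: "'g \<Rightarrow> 'g \<Rightarrow> 'k"
  assumes "CHAR('k) = 0 \<or> coprime CHAR('k) CARD('g)"
    and "linear_braided_category C"
    and "is_graded_algebra C A"
    and "bimodule_tensor_exists C A"
    and "normalized_two_cocycle \<kappa>"
    and "bicharacter \<kappa>"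
    and "graded_commutative C A \<kappa>"
  shows
    "(homogeneous_parts_exist C A \<kappa> \<longrightarrow> (\<exists>T P. is_graded_tensor_choice C A \<kappa> T P)) \<and>
     (\<forall>T P. is_graded_tensor_choice C A \<kappa> T P \<longrightarrow>
        (\<exists>M. is_induced_structure C A \<kappa> T P M \<and> linear_monoidal_category M)) \<and>
     (\<forall>\<Delta> \<epsilon>. is_frobenius C A \<Delta> \<epsilon> \<and> coproduct_separable C A \<Delta> \<longrightarrow>
        (\<forall>m n. is_graded_module C A m \<and> is_graded_module C A n \<longrightarrow>
           p_mor C A \<kappa> \<Delta> m n \<in> homset C (mob m \<otimes>\<^sub>o\<^bsub>C\<^esub> mob n) (mob m \<otimes>\<^sub>o\<^bsub>C\<^esub> mob n) \<and>
           p_mor C A \<kappa> \<Delta> m n \<cdot>\<^bsub>C\<^esub> p_mor C A \<kappa> \<Delta> m n = p_mor C A \<kappa> \<Delta> m n \<and>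
           (\<forall>q \<pi>. is_tensor_over C A (mob m) (act m) (mob n) (left_action C A \<kappa> n) q \<pi> \<longrightarrow>
              (\<exists>s. is_image C (p_mor C A \<kappa> \<Delta> m n) q s \<and> s \<cdot>\<^bsub>C\<^esub> \<pi> = p_mor C A \<kappa> \<Delta> m n))))"
proof -
  interpret graded_commutative_algebra C A \<kappa>
    using assms by (intro graded_commutative_algebra.intro graded_commutative_algebra_axioms.intro)
  have tensor_ex: "\<exists>q \<pi>. is_tensor_over C A (mob m) (act m) (mob n) (la n) q \<pi>" if "gmod m" "gmod n" for m n
    using tensor_exists bimodule[OF that(1)] bimodule[OF that(2)] unfolding bimodule_tensor_exists_def by blast
  have mt: "module_tensor C A \<kappa> m n q \<pi>"
    if "gmod m" "gmod n" "is_tensor_over C A (mob m) (act m) (mob n) (la n) q \<pi>" for m n q \<pi>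
    using that by (intro module_tensor.intro module_tensor_axioms.intro graded_commutative_algebra_axioms)
  have "\<exists>T P. is_graded_tensor_choice C A \<kappa> T P" if parts: "homogeneous_parts_exist C A \<kappa>"
  proof -
    \<comment> \<open>The implication stands below the quantifiers so that choice yields total
      functions, with arbitrary values outside the graded modules.\<close>
    have "\<exists>t \<pi>. gmod m \<and> gmod n \<longrightarrow> is_graded_tensor C A \<kappa> m n t \<pi>" for m n
      using tensor_ex[of m n] module_tensor.graded_tensor_ex[OF mt parts] by blast
    then obtain T P where "\<And>m n. gmod m \<and> gmod n \<longrightarrow> is_graded_tensor C A \<kappa> m n (T m n) (P m n)"
      by metis
    then show ?thesis unfolding is_graded_tensor_choice_def by blast
  qed
  moreover have "\<exists>M. is_induced_structure C A \<kappa> T P M \<and> linear_monoidal_category M"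
    if "is_graded_tensor_choice C A \<kappa> T P" for T P
  proof -
    interpret graded_tensor_choice C A \<kappa> T P
      using that by unfold_locales
    show ?thesis using M_monoidal M_induced by blast
  qed
  moreover have "p_mor C A \<kappa> \<Delta> m n \<in> homset C (mob m \<otimes>\<^sub>o\<^bsub>C\<^esub> mob n) (mob m \<otimes>\<^sub>o\<^bsub>C\<^esub> mob n) \<and>
      p_mor C A \<kappa> \<Delta> m n \<cdot>\<^bsub>C\<^esub> p_mor C A \<kappa> \<Delta> m n = p_mor C A \<kappa> \<Delta> m n \<and>
      (\<forall>q \<pi>. is_tensor_over C A (mob m) (act m) (mob n) (la n) q \<pi> \<longrightarrow>
        (\<exists>s. is_image C (p_mor C A \<kappa> \<Delta> m n) q s \<and> s \<cdot>\<^bsub>C\<^esub> \<pi> = p_mor C A \<kappa> \<Delta> m n))"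
    if "is_frobenius C A \<Delta> \<epsilon>" "coproduct_separable C A \<Delta>" "gmod m" "gmod n" for \<Delta> \<epsilon> m n
    using tensor_ex[OF that(3,4)] module_tensor.p_mor_image[OF mt[OF that(3,4)] that(1,2)] by blast
  ultimately show ?thesis by blast
qed

end
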